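(* Let $G$ be a locally compact Hausdorff group with left Haar measure $\mu$ and let $H$ be a closed subgroup of $G$ with left Haar measure $\nu$. Then there exists a Haar measure $\xi$ on $G/H$ if and only if $\Delta_G(h)=\Delta_H(h)$ for all $h\in H$. In this case, $\xi$ is unique up to strictly positive scalar multiples and, suitably normalized, satisfies for all $f\in C_c(G)$: $$\int_G f(g)\,d\mu(g)=\int_{G/H}\int_H f(gh)\,d\nu(h)\,d\xi(gH).$$
   Context: $C_c(X)$ denotes the space of continuous complex-valued functions with compact support on $X$; $\mathcal{B}(X)$ is the Borel $\sigma$-algebra of $X$. A Radon measure on a topological space $X$ is a measure $\mu$ on $(X,\mathcal{B}(X))$ that is finite on compact sets, outer regular on all measurable sets ($\mu(E)=\inf\{\mu(U)\mid U\supseteq E\text{ open}\}$) and inner regular on open sets ($\mu(U)=\sup\{\mu(K)\mid K\subseteq U\text{ compact}\}$). A left Haar measure on a locally compact Hausdorff group $G$ is a Radon measure $\mu$ on $G$ with $\mu(U)>0$ for every non-empty open $U$ and $\mu(gE)=\mu(E)$ for all $g\in G$, $E\in\mathcal{B}(G)$; it exists and is unique up to strictly positive scalar multiples. The modular function $\Delta_G:G\to\mathbb{R}_{>0}$ is determined by $\mu(Eg)=\Delta_G(g)\mu(E)$ for all $g\in G$, $E\in\mathcal{B}(G)$, where $\mu$ is any left Haar measure on $G$; $\Delta_H$ is the modular function of the locally compact Hausdorff group $H$. $G/H$ is the set of left cosets $gH$ with the quotient topology, on which $G$ acts by left multiplication. A Haar measure on $G/H$ is a $G$-invariant Radon measure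 on $G/H$ that is non-zero on non-empty open sets. *)

theory Defs
  imports "HOL-Analysis.Analysis" "HOL-Algebra.Left_Coset"
begin

section \<open>Locally compact Hausdorff groups\<close>

locale topological_group = group G for G (structure) +
  fixes T :: "'a topology"
  assumes topspace_eq_carrier: "topspace T = carrier G"
    and continuous_mult: "continuous_map (prod_topology T T) T (\<lambda>(x, y). x \<otimes> y)"
    and continuous_inv: "continuous_map T T (\<lambda>x. inv x)"

locale locally_compact_hausdorff_group = topological_group +
  assumes locally_compact: "locally_compact_space T"
    and hausdorff: "Hausdorff_space T"

section \<open>Quotient topology and coset spaces\<close>

definition quotient_topology :: "'a topology \<Rightarrow> ('a \<Rightarrow> 'b) \<Rightarrow> 'b topology" where
  "quotient_topology X f =
     topology (\<lambda>U. U \<subseteq> f ` topspace X \<and> openin X {x \<in> topspace X. f x \<in> U})"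

lemma openin_quotient_topology:
  "openin (quotient_topology X f) U \<longleftrightarrow>
     U \<subseteq> f ` topspace X \<and> openin X {x \<in> topspace X. f x \<in> U}"
proof -
  have "istopology (\<lambda>U. U \<subseteq> f ` topspace X \<and> openin X {x \<in> topspace X. f x \<in> U})"
    unfolding istopology_def
  proof (intro conjI allI impI)
    fix S T
    assume S: "S \<subseteq> f ` topspace X \<and> openin X {x \<in> topspace X. f x \<in> S}"
      and T: "T \<subseteq> f ` topspace X \<and> openin X {x \<in> topspace X. f x \<in> T}"
    show "S \<inter> T \<subseteq> f ` topspace X" using S by blast
    have "{x \<in> topspace X. f x \<in> S \<inter> T} =
          {x \<in> topspace X. f x \<in> S} \<inter> {x \<in> topspace X. f x \<in> T}" by blast
    then show "openin X {x \<in> topspace X. f x \<in> S \<inter> T}" using S T by auto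
  next
    fix K
    assume K: "\<forall>U\<in>K. U \<subseteq> f ` topspace X \<and> openin X {x \<in> topspace X. f x \<in> U}"
    show "\<Union>K \<subseteq> f ` topspace X" using K by blast
    have "{x \<in> topspace X. f x \<in> \<Union>K} = (\<Union>U\<in>K. {x \<in> topspace X. f x \<in> U})" by blast
    then show "openin X {x \<in> topspace X. f x \<in> \<Union>K}" using K by auto
  qed
  then show ?thesis by (simp add: quotient_topology_def)
qed

lemma topspace_quotient_topology: "topspace (quotient_topology X f) = f ` topspace X"
proof
  show "topspace (quotient_topology X f) \<subseteq> f ` topspace X"
    by (meson openin_quotient_topology openin_topspace)
  have "{x \<in> topspace X. f x \<in> f ` topspace X} = topspace X" by blast
  then show "f ` topspace X \<subseteq> topspace (quotient_topology X f)"
    by (simp add: openin_quotient_topology openin_subset)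
qed

lemma quotient_map_quotient_topology: "quotient_map X (quotient_topology X f) f"
  unfolding quotient_map_def
  by (simp add: topspace_quotient_topology openin_quotient_topology)

definition coset_space_topology ::
    "('a, 'c) monoid_scheme \<Rightarrow> 'a topology \<Rightarrow> 'a set \<Rightarrow> 'a set topology" where
  "coset_space_topology G T H = quotient_topology T (\<lambda>g. g <#\<^bsub>G\<^esub> H)"

lemma (in topological_group) topspace_coset_space_topology:
  "topspace (coset_space_topology G T H) = lcosets H"
  by (auto simp: coset_space_topology_def topspace_quotient_topology topspace_eq_carrier
      LCOSETS_def)

section \<open>Radon measures and Haar measures\<close>

definition borel_of :: "'a topology \<Rightarrow> 'a measure" where
  "borel_of X = sigma (topspace X) {U. openin X U}"

text \<open>
  In a non-Hausdorff space a compact set need not be Borel; \<^const>\<open>emeasure\<close> gives such a set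
  the value 0, so that it affects neither finiteness nor inner regularity below.
\<close>

definition radon_measure :: "'a topology \<Rightarrow> 'a measure \<Rightarrow> bool" where
  "radon_measure X M \<longleftrightarrow>
     sets M = sets (borel_of X) \<and>
     (\<forall>K. compactin X K \<longrightarrow> emeasure M K < \<infinity>) \<and>
     (\<forall>E\<in>sets M. emeasure M E = (INF U\<in>{U. openin X U \<and> E \<subseteq> U}. emeasure M U)) \<and>
     (\<forall>U. openin X U \<longrightarrow> emeasure M U = (SUP K\<in>{K. compactin X K \<and> K \<subseteq> U}. emeasure M K))"

definition left_haar_measure ::
    "('a, 'c) monoid_scheme \<Rightarrow> 'a topology \<Rightarrow> 'a measure \<Rightarrow> bool" where
  "left_haar_measure G T M \<longleftrightarrow>
     radon_measure T M \<and>
     (\<forall>U. openin T U \<and> U \<noteq> {} \<longrightarrow> 0 < emeasure M U) \<and>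
     (\<forall>g\<in>carrier G. \<forall>E\<in>sets M. emeasure M (g <#\<^bsub>G\<^esub> E) = emeasure M E)"

definition modular_function ::
    "('a, 'c) monoid_scheme \<Rightarrow> 'a topology \<Rightarrow> 'a \<Rightarrow> real" where
  "modular_function G T g =
     (THE r. 0 < r \<and>
        (\<forall>M. left_haar_measure G T M \<longrightarrow>
           (\<forall>E\<in>sets M. emeasure M (E #>\<^bsub>G\<^esub> g) = ennreal r * emeasure M E)))"

text \<open>The action of \<open>g\<close> on \<open>G/H\<close> sends a coset \<open>C\<close> to its translate \<open>g C\<close>.\<close>

definition haar_measure_on_cosets ::
    "('a, 'c) monoid_scheme \<Rightarrow> 'a topology \<Rightarrow> 'a set \<Rightarrow> 'a set measure \<Rightarrow> bool" where
  "haar_measure_on_cosets G T H M \<longleftrightarrow>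
     radon_measure (coset_space_topology G T H) M \<and>
     (\<forall>U. openin (coset_space_topology G T H) U \<and> U \<noteq> {} \<longrightarrow> emeasure M U \<noteq> 0) \<and>
     (\<forall>g\<in>carrier G. \<forall>E\<in>sets M. emeasure M ((\<lambda>C. g <#\<^bsub>G\<^esub> C) ` E) = emeasure M E)"

section \<open>Integration over cosets\<close>

text \<open>Only the values of \<open>f\<close> on \<^term>\<open>topspace X\<close> are constrained.\<close>

definition Cc :: "'a topology \<Rightarrow> ('a \<Rightarrow> complex) set" where
  "Cc X = {f. continuous_map X euclidean f \<and>
              compactin X (X closure_of {x \<in> topspace X. f x \<noteq> 0})}"

text \<open>
  The function \<open>gH \<mapsto> \<integral>\<^sub>H f(gh) d\<nu>(h)\<close> on \<open>G/H\<close>: its value at a coset \<open>C\<close> is the common value of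
  the integral for all representatives \<open>g \<in> C\<close>.
\<close>

definition coset_integral ::
    "('a, 'c) monoid_scheme \<Rightarrow> 'a measure \<Rightarrow> ('a \<Rightarrow> complex) \<Rightarrow> 'a set \<Rightarrow> complex" where
  "coset_integral G N f C = (THE z. \<forall>g\<in>C. (\<integral>h. f (g \<otimes>\<^bsub>G\<^esub> h) \<partial>N) = z)"

end

theory Submission
  imports Defs
begin

text \<open>
  Write \<open>P f (gH)\<close> for the integral of \<open>f (g h)\<close> over \<open>h \<in> H\<close> against \<open>\<nu>\<close> (\<open>coset_average\<close>). Everything rests on the
  averaging map \<open>P\<close> from compactly supported functions on \<open>G\<close> to those on \<open>G/H\<close>, which is onto
  (\<open>coset_average_surj\<close>), and on the uniqueness of Haar integrals: a left-invariant positive functional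
  on \<open>C\<^sub>c(G)\<close> is a multiple of integration against \<open>\<mu>\<close> (\<open>invariant_functional_proportional\<close>).

  If \<open>\<xi>\<close> is a Haar measure on \<open>G/H\<close>, then integrating \<open>P f\<close> against \<open>\<xi>\<close> is left-invariant in \<open>f\<close>, hence equal
  to \<open>c\<close> times integration of \<open>f\<close> against \<open>\<mu>\<close> with \<open>c > 0\<close> (\<open>coset_haar_proportional\<close>). This is the quotient
  integral formula up to normalisation. As \<open>P\<close> is onto, it determines the integrals of all compactly
  supported functions against \<open>\<xi>\<close> up to a factor, and so \<open>\<xi>\<close> itself. Moreover, translating \<open>f\<close> on the right by
  \<open>k \<in> H\<close> multiplies the integral against \<open>\<mu>\<close> by the value of \<open>\<Delta>\<^sub>G\<close> at the inverse of \<open>k\<close>, and \<open>P f\<close> by that of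
  \<open>\<Delta>\<^sub>H\<close>. So \<open>\<Delta>\<^sub>G\<close> and \<open>\<Delta>\<^sub>H\<close> agree on \<open>H\<close>.

  Conversely, if they agree on \<open>H\<close>, the functional \<open>P f \<mapsto> \<integral> f d\<mu>\<close> on \<open>C\<^sub>c(G/H)\<close> is well defined. The reason is the
  symmetry \<open>\<integral> p (P f \<circ> \<pi>) d\<mu> = \<integral> f (P p \<circ> \<pi>) d\<mu>\<close>, where \<open>\<pi>\<close> is the projection to \<open>G/H\<close>
  (\<open>coset_average_symmetric\<close>): taking \<open>p\<close> with \<open>P p = 1\<close> on the image of the support of \<open>f\<close>, it expresses
  \<open>\<integral> f d\<mu>\<close> through \<open>P f\<close>. The functional is positive and invariant, and the Riesz representation theorem
  turns it into the required measure.

  The Riesz theorem is needed on arbitrary locally compact Hausdorff spaces (\<open>riesz_representation\<close>). On such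
  spaces Radon measures may fail to be \<open>\<sigma>\<close>-finite, which is why iterated integrals are interchanged for
  compactly supported continuous integrands only (\<open>radon_Fubini\<close>). Uniqueness of Haar integrals follows from
  the identity \<open>haar_integral_product\<close>; applied to one and the same Haar measure twice, it also gives the
  effect of the inversion \<open>x \<mapsto> x\<inverse>\<close> on that measure (\<open>haar_integral_inverse\<close>), which the symmetry
  above uses for \<open>\<nu>\<close>.
\<close>

section \<open>Borel sets and compactly supported functions\<close>

lemma space_borel_of [simp]: "space (borel_of X) = topspace X"
  by (simp add: borel_of_def space_measure_of_conv)

lemma sets_borel_of: "sets (borel_of X) = sigma_sets (topspace X) {U. openin X U}"
  unfolding borel_of_def by (rule sets_measure_of) (use openin_subset in auto)

lemma openin_sets_borel_of: "openin X U \<Longrightarrow> U \<in> sets (borel_of X)"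
  by (auto simp: sets_borel_of)

lemma closedin_sets_borel_of:
  assumes "closedin X C"
  shows "C \<in> sets (borel_of X)"
proof -
  have "topspace X - (topspace X - C) \<in> sets (borel_of X)"
    using assms by (metis closedin_def openin_sets_borel_of sets.compl_sets space_borel_of)
  then show ?thesis
    using assms by (simp add: closedin_subset double_diff)
qed

lemma continuous_map_measurable_borel_of:
  assumes "continuous_map X Y f"
  shows "f \<in> measurable (borel_of X) (borel_of Y)"
  unfolding borel_of_def[of Y]
proof (rule measurable_measure_of)
  show "f -` U \<inter> space (borel_of X) \<in> sets (borel_of X)" if "U \<in> {U. openin Y U}" for U
    using openin_continuous_map_preimage[OF assms, of U] that
    by (auto intro!: openin_sets_borel_of simp: Int_def vimage_def conj_commute)
qed (use assms openin_subset in \<open>auto simp: continuous_map_def\<close>)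

lemma borel_of_euclidean: "borel_of euclidean = borel"
  by (simp add: borel_of_def borel_def)

lemma continuous_map_borel_measurable:
  "continuous_map X euclidean f \<Longrightarrow> f \<in> borel_measurable (borel_of X)"
  using continuous_map_measurable_borel_of[of X euclidean f] by (simp add: borel_of_euclidean)

text \<open>The support condition is that \<open>f\<close> vanishes on the space outside some compact set; on a Hausdorff space this is
equivalent to compactness of the closure of the set where \<open>f\<close> is non-zero, but is easier to verify.\<close>

definition Cc_real :: "'a topology \<Rightarrow> ('a \<Rightarrow> real) set" where
  "Cc_real X = {f. continuous_map X euclideanreal f \<and>
                   (\<exists>K. compactin X K \<and> (\<forall>x\<in>topspace X - K. f x = 0))}"

lemma continuous_map_compose_fun:
  "\<lbrakk>continuous_map X Z f; continuous_map Y X u\<rbrakk> \<Longrightarrow> continuous_map Y Z (\<lambda>y. f (u y))"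
  using continuous_map_compose by (force simp: o_def)

lemma Cc_realI:
  "\<lbrakk>continuous_map X euclideanreal f; compactin X K; \<And>x. \<lbrakk>x \<in> topspace X; x \<notin> K\<rbrakk> \<Longrightarrow> f x = 0\<rbrakk>
   \<Longrightarrow> f \<in> Cc_real X"
  by (auto simp: Cc_real_def)

lemma Cc_real_continuous: "f \<in> Cc_real X \<Longrightarrow> continuous_map X euclideanreal f"
  by (auto simp: Cc_real_def)

lemma Cc_real_cong:
  assumes "f \<in> Cc_real X" "\<And>x. x \<in> topspace X \<Longrightarrow> f x = g x"
  shows "g \<in> Cc_real X"
  using assms continuous_map_eq[of X euclideanreal f g] by (auto simp: Cc_real_def)

lemma Cc_realE:
  assumes "f \<in> Cc_real X"
  obtains K where "compactin X K" "\<And>x. \<lbrakk>x \<in> topspace X; x \<notin> K\<rbrakk> \<Longrightarrow> f x = 0"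
  using assms by (auto simp: Cc_real_def)

lemma Cc_real_mult:
  assumes "f \<in> Cc_real X" "continuous_map X euclideanreal g"
  shows "(\<lambda>x. f x * g x) \<in> Cc_real X" "(\<lambda>x. g x * f x) \<in> Cc_real X"
  using assms by (auto simp: Cc_real_def intro!: continuous_intros)

lemma Cc_real_cmult: "f \<in> Cc_real X \<Longrightarrow> (\<lambda>x. c * f x) \<in> Cc_real X"
  by (rule Cc_real_mult) auto

lemma Cc_real_add:
  assumes f: "f \<in> Cc_real X" and g: "g \<in> Cc_real X"
  shows "(\<lambda>x. f x + g x) \<in> Cc_real X"
proof -
  obtain K L where "compactin X K" "\<And>x. \<lbrakk>x \<in> topspace X; x \<notin> K\<rbrakk> \<Longrightarrow> f x = 0"
    and "compactin X L" "\<And>x. \<lbrakk>x \<in> topspace X; x \<notin> L\<rbrakk> \<Longrightarrow> g x = 0"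
    using f g by (meson Cc_realE)
  then show ?thesis
    using Cc_real_continuous[OF f] Cc_real_continuous[OF g]
    by (intro Cc_realI[where K="K \<union> L"]) (auto intro: continuous_map_add compactin_Un)
qed

lemma Cc_real_diff: "\<lbrakk>f \<in> Cc_real X; g \<in> Cc_real X\<rbrakk> \<Longrightarrow> (\<lambda>x. f x - g x) \<in> Cc_real X"
  using Cc_real_add[of f X "\<lambda>x. -1 * g x"] Cc_real_cmult[of g X "-1"] by simp

lemma Cc_real_sum:
  assumes "finite A" "\<And>i. i \<in> A \<Longrightarrow> f i \<in> Cc_real X"
  shows "(\<lambda>x. \<Sum>i\<in>A. f i x) \<in> Cc_real X"
  using assms
proof (induction A rule: finite_induct)
  case empty
  then show ?case by (auto intro!: Cc_realI[where K="{}"])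
next
  case (insert a A)
  then show ?case by (simp add: Cc_real_add)
qed

lemma Cc_real_compose:
  assumes f: "f \<in> Cc_real Y" and p: "continuous_map X Y p"
    and K: "compactin Y K" "\<And>y. \<lbrakk>y \<in> topspace Y; y \<notin> K\<rbrakk> \<Longrightarrow> f y = 0"
    and L: "compactin X L" "\<And>x. \<lbrakk>x \<in> topspace X; p x \<in> K\<rbrakk> \<Longrightarrow> x \<in> L"
  shows "(\<lambda>x. f (p x)) \<in> Cc_real X"
proof (rule Cc_realI[OF _ L(1)])
  show "continuous_map X euclideanreal (\<lambda>x. f (p x))"
    using continuous_map_compose[OF p Cc_real_continuous[OF f]] by (simp add: o_def)
  show "f (p x) = 0" if "x \<in> topspace X" "x \<notin> L" for x
  proof -
    have "p x \<in> topspace Y" using p that(1) by (auto simp: continuous_map_def)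
    then show ?thesis using that K(2) L(2) by blast
  qed
qed

lemma Cc_real_bounded:
  assumes "f \<in> Cc_real X"
  obtains B where "0 < B" "\<And>x. x \<in> topspace X \<Longrightarrow> \<bar>f x\<bar> \<le> B"
proof -
  obtain K where K: "compactin X K" "\<And>x. \<lbrakk>x \<in> topspace X; x \<notin> K\<rbrakk> \<Longrightarrow> f x = 0"
    using assms by (meson Cc_realE)
  have "compactin euclideanreal (f ` K)"
    using K(1) assms image_compactin Cc_real_continuous by blast
  then have "bounded (f ` K)" by (simp add: compact_imp_bounded)
  then obtain B where "0 < B" "\<forall>x\<in>f ` K. norm x \<le> B" by (auto simp: bounded_pos)
  then show ?thesis using K(2) that[of B] by (metis abs_zero image_eqI less_eq_real_def real_norm_def)
qed

text \<open>This is the relation \<open>f \<prec> U\<close> that is customary in proofs of the Riesz representation theorem.\<close>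

definition subordinate :: "'a topology \<Rightarrow> 'a set \<Rightarrow> ('a \<Rightarrow> real) set" where
  "subordinate X U = {f \<in> Cc_real X. (\<forall>x\<in>topspace X. 0 \<le> f x \<and> f x \<le> 1) \<and>
      (\<exists>K. compactin X K \<and> K \<subseteq> U \<and> (\<forall>x\<in>topspace X - K. f x = 0))}"

lemma subordinateI:
  assumes "continuous_map X euclideanreal f" "\<And>x. x \<in> topspace X \<Longrightarrow> 0 \<le> f x"
    "\<And>x. x \<in> topspace X \<Longrightarrow> f x \<le> 1" "compactin X K" "K \<subseteq> U"
    "\<And>x. \<lbrakk>x \<in> topspace X; x \<notin> K\<rbrakk> \<Longrightarrow> f x = 0"
  shows "f \<in> subordinate X U"
  using assms by (auto simp: subordinate_def Cc_real_def)

lemma subordinateD: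
  assumes "f \<in> subordinate X U"
  shows "f \<in> Cc_real X" "x \<in> topspace X \<Longrightarrow> 0 \<le> f x" "x \<in> topspace X \<Longrightarrow> f x \<le> 1"
  using assms by (auto simp: subordinate_def)

lemma subordinateE:
  assumes "f \<in> subordinate X U"
  obtains K where "compactin X K" "K \<subseteq> U" "\<And>x. \<lbrakk>x \<in> topspace X; x \<notin> K\<rbrakk> \<Longrightarrow> f x = 0"
  using assms unfolding subordinate_def by blast

lemma subordinate_mono: "U \<subseteq> V \<Longrightarrow> subordinate X U \<subseteq> subordinate X V"
  by (auto simp: subordinate_def)

lemma zero_subordinate: "(\<lambda>x. 0) \<in> subordinate X U"
  by (rule subordinateI[where K="{}"]) auto

locale lch_space =
  fixes X :: "'a topology"
  assumes locally_compact_space: "locally_compact_space X"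
    and Hausdorff_space: "Hausdorff_space X"
begin

lemma compactin_closedin: "compactin X K \<Longrightarrow> closedin X K"
  using compactin_imp_closedin Hausdorff_space by blast

lemma compactin_sets_borel_of: "compactin X K \<Longrightarrow> K \<in> sets (borel_of X)"
  by (simp add: closedin_sets_borel_of compactin_closedin)

lemma subordinate_Urysohn:
  assumes K: "compactin X K" and U: "openin X U" "K \<subseteq> U"
  obtains f where "f \<in> subordinate X U" "\<And>x. x \<in> K \<Longrightarrow> f x = 1"
proof -
  obtain V L where V: "openin X V" "compactin X L" "closedin X L" "K \<subseteq> V" "V \<subseteq> L"
    using K locally_compact_space Hausdorff_space locally_compact_space_compact_closed_compact
    by metis
  have "completely_regular_space X"
    using locally_compact_regular_imp_completely_regular_space locally_compact_space Hausdorff_space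
    by blast
  moreover have "closedin X (topspace X - (U \<inter> V))" using U V by blast
  moreover have "disjnt K (topspace X - (U \<inter> V))" using U V by (auto simp: disjnt_def)
  ultimately obtain f where f: "continuous_map X (subtopology euclidean {0..1::real}) f"
    "f ` (topspace X - (U \<inter> V)) \<subseteq> {0}" "f ` K \<subseteq> {1}"
    using K Urysohn_completely_regular_compact_closed[of 0 1 X K "topspace X - (U \<inter> V)"]
    by auto
  then have fc: "continuous_map X euclideanreal f" and f01: "\<And>x. x \<in> topspace X \<Longrightarrow> f x \<in> {0..1}"
    by (auto simp: continuous_map_in_subtopology)
  define S where "S = {x \<in> topspace X. f x \<in> {1/2..}}"
  have "closedin X S"
    unfolding S_def using fc by (rule closedin_continuous_map_preimage) auto
  moreover have S: "S \<subseteq> U \<inter> V" using f(2) by (force simp: S_def)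
  ultimately have "compactin X S" using V closed_compactin by blast
  show ?thesis
  proof
    \<comment> \<open>Raising the threshold to one half makes the support closed, hence compact, inside \<open>U\<close>.\<close>
    show "(\<lambda>x. max 0 (2 * f x - 1)) \<in> subordinate X U"
      using S f01 \<open>compactin X S\<close>
      by (intro subordinateI[where K=S]) (auto intro!: continuous_intros fc simp: S_def)
    show "max 0 (2 * f x - 1) = 1" if "x \<in> K" for x
      using f(3) that by force
  qed
qed

text \<open>The parts of \<open>K\<close> outside \<open>V\<close> and outside \<open>U\<close> are disjoint compact sets, so disjoint open sets separate
them; each piece of the decomposition omits one of these open sets.\<close>

lemma compactin_split:
  assumes K: "compactin X K" and U: "openin X U" and V: "openin X V" and sub: "K \<subseteq> U \<union> V"
  obtains K1 K2 where "compactin X K1" "K1 \<subseteq> U" "compactin X K2" "K2 \<subseteq> V" "K = K1 \<union> K2"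
proof -
  have cU: "compactin X (K - V)" and cV: "compactin X (K - U)"
    using K U V by (metis closed_compactin closedin_diff compactin_closedin Diff_subset)+
  have "disjnt (K - V) (K - U)" using sub by (auto simp: disjnt_def)
  then obtain W1 W2 where W: "openin X W1" "openin X W2" "K - V \<subseteq> W1" "K - U \<subseteq> W2" "disjnt W1 W2"
    using Hausdorff_space_compact_sets Hausdorff_space cU cV by metis
  show ?thesis
  proof
    show "compactin X (K - W2)" "compactin X (K - W1)"
      using K W by (metis closed_compactin closedin_diff compactin_closedin Diff_subset)+
    show "K - W2 \<subseteq> U" "K - W1 \<subseteq> V" "K = K - W2 \<union> (K - W1)"
      using W by (auto simp: disjnt_def)
  qed
qed

end

section \<open>Radon measures and integrals of compactly supported functions\<close>

lemma radon_measure_sets: "radon_measure X M \<Longrightarrow> sets M = sets (borel_of X)"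
  by (simp add: radon_measure_def)

lemma radon_measure_space: "radon_measure X M \<Longrightarrow> space M = topspace X"
  using sets_eq_imp_space_eq[OF radon_measure_sets] by simp

lemma radon_measure_compact: "radon_measure X M \<Longrightarrow> compactin X K \<Longrightarrow> emeasure M K < \<infinity>"
  by (simp add: radon_measure_def)

lemma radon_measure_outer:
  "radon_measure X M \<Longrightarrow> E \<in> sets M \<Longrightarrow>
     emeasure M E = (INF U\<in>{U. openin X U \<and> E \<subseteq> U}. emeasure M U)"
  by (simp add: radon_measure_def)

lemma radon_measure_inner:
  "radon_measure X M \<Longrightarrow> openin X U \<Longrightarrow>
     emeasure M U = (SUP K\<in>{K. compactin X K \<and> K \<subseteq> U}. emeasure M K)"
  by (simp add: radon_measure_def)

lemma radon_measure_measurable: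
  assumes "radon_measure X M" "continuous_map X euclidean f"
  shows "f \<in> borel_measurable M"
  using continuous_map_borel_measurable[OF assms(2)] measurable_cong_sets[OF radon_measure_sets[OF assms(1)] refl]
  by blast

lemma radon_measure_continuous_measurable:
  assumes "radon_measure X M" "continuous_map X X p"
  shows "p \<in> measurable M M"
  using continuous_map_measurable_borel_of[OF assms(2)]
  by (simp add: measurable_cong_sets[OF radon_measure_sets[OF assms(1)] radon_measure_sets[OF assms(1)]])

context lch_space
begin

lemma compactin_sets_radon:
  "radon_measure X M \<Longrightarrow> compactin X K \<Longrightarrow> K \<in> sets M"
  by (simp add: radon_measure_sets compactin_sets_borel_of)

lemma integrable_bounded_compact_support:
  fixes f :: "'a \<Rightarrow> 'b::{banach, second_countable_topology}"
  assumes M: "radon_measure X M" and f: "f \<in> borel_measurable M" and K: "compactin X K"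
    and 0: "\<And>x. \<lbrakk>x \<in> topspace X; x \<notin> K\<rbrakk> \<Longrightarrow> f x = 0"
    and B: "\<And>x. x \<in> topspace X \<Longrightarrow> norm (f x) \<le> B"
  shows "integrable M f"
proof (rule integrableI_bounded_set[where A=K and B=B])
  show "K \<in> sets M" using M K by (rule compactin_sets_radon)
  show "emeasure M K < \<infinity>" using M K by (rule radon_measure_compact)
qed (use 0 B f M in \<open>auto simp: radon_measure_space\<close>)

lemma Cc_real_integrable:
  assumes M: "radon_measure X M" and f: "f \<in> Cc_real X"
  shows "integrable M f"
proof -
  obtain K where "compactin X K" "\<And>x. \<lbrakk>x \<in> topspace X; x \<notin> K\<rbrakk> \<Longrightarrow> f x = 0"
    using f by (meson Cc_realE)
  moreover obtain B where "\<And>x. x \<in> topspace X \<Longrightarrow> \<bar>f x\<bar> \<le> B"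
    using f by (meson Cc_real_bounded)
  ultimately show ?thesis
    using M f by (intro integrable_bounded_compact_support)
      (auto intro: radon_measure_measurable Cc_real_continuous)
qed

lemma radon_measure_ge_integral:
  assumes M: "radon_measure X M" and K: "K \<in> sets M" and f: "f \<in> Cc_real X"
    and le: "\<And>x. x \<in> topspace X \<Longrightarrow> f x \<le> indicat_real K x"
  shows "ennreal (\<integral>x. f x \<partial>M) \<le> emeasure M K"
proof (cases "emeasure M K = \<infinity>")
  case False
  then have "integrable M (indicat_real K)"
    using K by (auto simp: integrable_indicator_iff top.not_eq_extremum)
  then have "(\<integral>x. f x \<partial>M) \<le> (\<integral>x. indicat_real K x \<partial>M)"
    using le M f by (intro integral_mono) (auto simp: radon_measure_space intro: Cc_real_integrable)
  then show ?thesis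
    using False K sets.sets_into_space[OF K]
    by (simp add: emeasure_eq_ennreal_measure ennreal_leI Int_absorb2)
qed simp

lemma radon_measure_le_integral:
  assumes M: "radon_measure X M" and K: "K \<in> sets M" and f: "f \<in> Cc_real X"
    and le: "\<And>x. x \<in> topspace X \<Longrightarrow> indicat_real K x \<le> f x"
  shows "emeasure M K \<le> ennreal (\<integral>x. f x \<partial>M)"
proof -
  have "emeasure M K = (\<integral>\<^sup>+x. indicator K x \<partial>M)" using K by simp
  also have "\<dots> \<le> (\<integral>\<^sup>+x. ennreal (f x) \<partial>M)"
  proof (rule nn_integral_mono)
    show "indicator K x \<le> ennreal (f x)" if "x \<in> space M" for x
      using le[of x] that M by (cases "x \<in> K") (auto simp: radon_measure_space)
  qed
  also have "\<dots> = ennreal (\<integral>x. f x \<partial>M)"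
  proof (rule nn_integral_eq_integral)
    show "integrable M f" using M f by (rule Cc_real_integrable)
    have "0 \<le> f x" if "x \<in> topspace X" for x
      using le[OF that] by (cases "x \<in> K") auto
    then show "AE x in M. 0 \<le> f x" using M by (auto simp: radon_measure_space)
  qed
  finally show ?thesis .
qed

text \<open>Open sets are approximated from inside by compact ones, and Urysohn functions fit between:
  so a Radon measure is recovered from the integrals of compactly supported functions.\<close>

lemma radon_measure_open_eq_SUP:
  assumes M: "radon_measure X M" and U: "openin X U"
  shows "emeasure M U = (SUP f\<in>subordinate X U. ennreal (\<integral>x. f x \<partial>M))"
proof (rule antisym)
  have UM: "U \<in> sets M" using M U by (simp add: radon_measure_sets openin_sets_borel_of)
  show "emeasure M U \<le> (SUP f\<in>subordinate X U. ennreal (\<integral>x. f x \<partial>M))"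
    unfolding radon_measure_inner[OF M U]
  proof (rule SUP_mono)
    fix K assume "K \<in> {K. compactin X K \<and> K \<subseteq> U}"
    then obtain f where f: "f \<in> subordinate X U" "\<And>x. x \<in> K \<Longrightarrow> f x = 1" "compactin X K"
      using U subordinate_Urysohn by blast
    then have "emeasure M K \<le> ennreal (\<integral>x. f x \<partial>M)"
      using M by (intro radon_measure_le_integral)
        (auto simp: indicator_def intro: compactin_sets_radon dest: subordinateD)
    then show "\<exists>f\<in>subordinate X U. emeasure M K \<le> ennreal (\<integral>x. f x \<partial>M)"
      using f by blast
  qed
  show "(SUP f\<in>subordinate X U. ennreal (\<integral>x. f x \<partial>M)) \<le> emeasure M U"
  proof (rule SUP_least)
    fix f assume f: "f \<in> subordinate X U"
    show "ennreal (\<integral>x. f x \<partial>M) \<le> emeasure M U"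
      using M UM
    proof (rule radon_measure_ge_integral)
      show "f \<in> Cc_real X" using f by (rule subordinateD)
      show "f x \<le> indicat_real U x" if "x \<in> topspace X" for x
        using that subordinateD(3)[OF f] subordinateE[OF f]
        by (metis indicator_simps order_refl subsetD)
    qed
  qed
qed

lemma radon_measure_eqI:
  assumes M: "radon_measure X M" and N: "radon_measure X N"
    and eq: "\<And>f. \<lbrakk>f \<in> Cc_real X; \<And>x. x \<in> topspace X \<Longrightarrow> 0 \<le> f x\<rbrakk> \<Longrightarrow> (\<integral>x. f x \<partial>M) = (\<integral>x. f x \<partial>N)"
  shows "M = N"
proof (rule measure_eqI)
  show sets: "sets M = sets N" using M N by (simp add: radon_measure_sets)
  have op: "emeasure M U = emeasure N U" if "openin X U" for U
    unfolding radon_measure_open_eq_SUP[OF M that] radon_measure_open_eq_SUP[OF N that]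
    by (rule SUP_cong) (auto simp: eq subordinateD)
  show "emeasure M E = emeasure N E" if "E \<in> sets M" for E
    using that sets unfolding radon_measure_outer[OF M that]
    by (subst radon_measure_outer[OF N]) (auto intro!: INF_cong op)
qed

lemma radon_integral_pos:
  assumes M: "radon_measure X M" and pos: "\<And>U. openin X U \<Longrightarrow> U \<noteq> {} \<Longrightarrow> emeasure M U \<noteq> 0"
    and f: "f \<in> Cc_real X" and nonneg: "\<And>x. x \<in> topspace X \<Longrightarrow> 0 \<le> f x"
    and x: "x \<in> topspace X" "0 < f x"
  shows "0 < (\<integral>x. f x \<partial>M)"
proof -
  let ?U = "{y \<in> topspace X. f y \<in> {0<..}}"
  have U: "openin X ?U"
    using f by (intro openin_continuous_map_preimage) (auto intro: Cc_real_continuous)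
  then have "emeasure M ?U \<noteq> 0" using x pos by blast
  moreover have "?U \<in> sets M" using M U by (simp add: radon_measure_sets openin_sets_borel_of)
  moreover have "{y \<in> space M. \<not> f y \<le> 0} = ?U" using M by (auto simp: radon_measure_space)
  ultimately have "\<not> (AE y in M. f y \<le> 0)" by (simp add: AE_iff_measurable)
  then have "\<not> (AE y in M. f y = 0)" by (rule contrapos_nn) auto
  moreover have "AE x in M. 0 \<le> f x"
    using nonneg M by (intro AE_I2) (auto simp: radon_measure_space)
  ultimately have "(\<integral>x. f x \<partial>M) \<noteq> 0"
    using integral_nonneg_eq_0_iff_AE[OF Cc_real_integrable[OF M f]] by simp
  moreover have "0 \<le> (\<integral>x. f x \<partial>M)"
    using nonneg M by (intro integral_nonneg_AE) (auto simp: radon_measure_space)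
  ultimately show ?thesis by simp
qed

end

text \<open>Multiplication by \<open>c\<close> is an order automorphism of the extended half line, with inverse multiplication by
\<open>1 / c\<close>.\<close>

lemma ennreal_INF_cmult:
  assumes c: "0 < c"
  shows "(INF i\<in>A. ennreal c * f i) = ennreal c * (INF i\<in>A. f i)"
proof (rule antisym)
  have inv: "ennreal c * (ennreal (1 / c) * z) = z" for z
    using c by (simp add: mult.assoc[symmetric] ennreal_mult[symmetric])
  have "ennreal (1 / c) * (INF i\<in>A. ennreal c * f i) \<le> (INF i\<in>A. f i)"
  proof (rule INF_greatest)
    fix i assume "i \<in> A"
    then have "ennreal (1 / c) * (INF i\<in>A. ennreal c * f i) \<le> ennreal (1 / c) * (ennreal c * f i)"
      by (intro mult_left_mono INF_lower) auto
    then show "ennreal (1 / c) * (INF i\<in>A. ennreal c * f i) \<le> f i"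
      using inv by (simp add: mult.left_commute)
  qed
  then show "(INF i\<in>A. ennreal c * f i) \<le> ennreal c * (INF i\<in>A. f i)"
    using inv by (metis mult_left_mono zero_le)
  show "ennreal c * (INF i\<in>A. f i) \<le> (INF i\<in>A. ennreal c * f i)"
    by (intro INF_greatest mult_left_mono INF_lower) auto
qed

lemma radon_measure_scale:
  assumes M: "radon_measure X M" and c: "0 < c"
  shows "radon_measure X (scale_measure (ennreal c) M)"
proof -
  have "(INF U\<in>{U. openin X U \<and> E \<subseteq> U}. ennreal c * emeasure M U) = 
        ennreal c * (INF U\<in>{U. openin X U \<and> E \<subseteq> U}. emeasure M U)" if "E \<in> sets M" for E
    using c by (rule ennreal_INF_cmult)
  moreover have "(SUP K\<in>{K. compactin X K \<and> K \<subseteq> U}. ennreal c * emeasure M K) =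
       ennreal c * (SUP K\<in>{K. compactin X K \<and> K \<subseteq> U}. emeasure M K)" for U
    by (rule SUP_mult_left_ennreal[symmetric])
  ultimately show ?thesis
    using M by (auto simp: radon_measure_def ennreal_mult_less_top)
qed

lemma integral_scale_measure:
  fixes f :: "'a \<Rightarrow> 'e::{banach, second_countable_topology}"
  assumes "f \<in> borel_measurable M" "0 \<le> c"
  shows "(\<integral>x. f x \<partial>scale_measure (ennreal c) M) = c *\<^sub>R (\<integral>x. f x \<partial>M)"
proof -
  have "scale_measure (ennreal c) M = density M (\<lambda>x. ennreal c)"
    by (rule measure_eqI) (auto simp: emeasure_density_const)
  then show ?thesis using assms by (simp add: integral_density)
qed

text \<open>All conditions on a Radon measure are topological, so a self-homeomorphism transports them. The measure of
a transported set is given through images, because the invariance conditions for Haar measures are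
conditions on translated sets.\<close>

lemma radon_measure_distr:
  assumes M: "radon_measure X M" and hom: "homeomorphic_maps X X p q"
  shows "radon_measure X (distr M M p)"
    and "E \<in> sets M \<Longrightarrow> emeasure (distr M M p) E = emeasure M (q ` E)"
proof -
  have p: "continuous_map X X p" and q: "continuous_map X X q"
    and qp: "\<And>x. x \<in> topspace X \<Longrightarrow> q (p x) = x" and pq: "\<And>x. x \<in> topspace X \<Longrightarrow> p (q x) = x"
    using hom by (auto simp: homeomorphic_maps_def)
  have pX: "\<And>x. x \<in> topspace X \<Longrightarrow> p x \<in> topspace X" and qX: "\<And>x. x \<in> topspace X \<Longrightarrow> q x \<in> topspace X"
    using p q by (auto simp: continuous_map_def)
  note sp = radon_measure_space[OF M] and st = radon_measure_sets[OF M]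
  have pm: "p \<in> measurable M M"
    using M p by (rule radon_measure_continuous_measurable)
  have vimage: "p -` E \<inter> topspace X = q ` E" if "E \<subseteq> topspace X" for E
  proof (intro Set.set_eqI iffI)
    show "x \<in> q ` E" if "x \<in> p -` E \<inter> topspace X" for x
      using that qp[of x] by (intro image_eqI[of x q "p x"]) auto
    show "x \<in> p -` E \<inter> topspace X" if "x \<in> q ` E" for x
      using that \<open>E \<subseteq> topspace X\<close> pq qX by auto
  qed
  show em: "emeasure (distr M M p) E = emeasure M (q ` E)" if "E \<in> sets M" for E
    using that sets.sets_into_space[OF that] by (simp add: emeasure_distr[OF pm] sp vimage)
  have openp: "openin X (p ` U)" and openq: "openin X (q ` U)" if "openin X U" for U
    using that hom homeomorphic_maps_map[of X X p q] homeomorphic_map_openness_eq by metis+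
  have pqU: "p ` q ` U = U" and qpU: "q ` p ` U = U" if "U \<subseteq> topspace X" for U
    using that qp pq by (auto simp: image_image subset_iff image_iff cong: image_cong)
  have opM: "U \<in> sets M" if "openin X U" for U
    using that st openin_sets_borel_of by blast
  show "radon_measure X (distr M M p)"
    unfolding radon_measure_def
  proof (intro conjI allI ballI impI)
    show "sets (distr M M p) = sets (borel_of X)" using st by simp
    show "emeasure (distr M M p) K < \<infinity>" if K: "compactin X K" for K
    proof (cases "K \<in> sets M")
      case True
      then show ?thesis
        using K q by (simp add: em) (metis M image_compactin radon_measure_compact infinity_ennreal_def)
    next
      case False
      \<comment> \<open>Compact sets may be non-measurable when \<open>X\<close> is not Hausdorff; then \<^const>\<open>emeasure\<close> is 0.\<close>
      then show ?thesis by (simp add: emeasure_notin_sets)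
    qed
    show "emeasure (distr M M p) E = (INF U\<in>{U. openin X U \<and> E \<subseteq> U}. emeasure (distr M M p) U)"
      if "E \<in> sets (distr M M p)" for E
    proof (rule antisym)
      have E: "E \<in> sets M" "E \<subseteq> topspace X" using that sets.sets_into_space sp by fastforce+
      show "emeasure (distr M M p) E \<le> (INF U\<in>{U. openin X U \<and> E \<subseteq> U}. emeasure (distr M M p) U)"
        using opM by (intro INF_greatest emeasure_mono) auto
      have qE: "q ` E \<in> sets M"
        using measurable_sets[OF pm E(1)] vimage[OF E(2)] by (simp add: sp)
      show "(INF U\<in>{U. openin X U \<and> E \<subseteq> U}. emeasure (distr M M p) U) \<le> emeasure (distr M M p) E"
        unfolding em[OF E(1)] radon_measure_outer[OF M qE]
      proof (rule INF_mono)
        fix V assume "V \<in> {U. openin X U \<and> q ` E \<subseteq> U}"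
        then have V: "openin X V" "q ` E \<subseteq> V" by auto
        then have "E \<subseteq> p ` V" using pqU[OF E(2)] by blast
        moreover have "emeasure (distr M M p) (p ` V) = emeasure M V"
          using em[OF opM[OF openp[OF V(1)]]] qpU[OF openin_subset[OF V(1)]] by simp
        ultimately show "\<exists>U\<in>{U. openin X U \<and> E \<subseteq> U}. emeasure (distr M M p) U \<le> emeasure M V"
          using V openp by (intro bexI[of _ "p ` V"]) auto
      qed
    qed
    show "emeasure (distr M M p) U = (SUP K\<in>{K. compactin X K \<and> K \<subseteq> U}. emeasure (distr M M p) K)"
      if U: "openin X U" for U
    proof (rule antisym)
      show "(SUP K\<in>{K. compactin X K \<and> K \<subseteq> U}. emeasure (distr M M p) K) \<le> emeasure (distr M M p) U"
        using U opM by (intro SUP_least emeasure_mono) auto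
      show "emeasure (distr M M p) U \<le> (SUP K\<in>{K. compactin X K \<and> K \<subseteq> U}. emeasure (distr M M p) K)"
        unfolding em[OF opM[OF U]] radon_measure_inner[OF M openq[OF U]]
      proof (rule SUP_mono)
        fix L assume "L \<in> {K. compactin X K \<and> K \<subseteq> q ` U}"
        then have L: "compactin X L" "L \<subseteq> q ` U" by auto
        then have LX: "L \<subseteq> topspace X" by (simp add: compactin_subset_topspace)
        have "p ` L \<subseteq> U" using L(2) pqU[OF openin_subset[OF U]] by blast
        moreover have "emeasure M L \<le> emeasure (distr M M p) (p ` L)"
        proof (cases "L \<in> sets M")
          case True
          have "p ` L = q -` L \<inter> topspace X"
          proof (intro Set.set_eqI iffI)
            show "x \<in> p ` L" if "x \<in> q -` L \<inter> topspace X" for x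
              using that pq[of x] by (intro image_eqI[of x p "q x"]) auto
            show "x \<in> q -` L \<inter> topspace X" if "x \<in> p ` L" for x
              using that LX qp pX by auto
          qed
          then have "p ` L \<in> sets M"
            using True continuous_map_measurable_borel_of[OF q] st by (metis measurable_sets space_borel_of)
          then show ?thesis using LX by (simp add: em qpU)
        qed (simp add: emeasure_notin_sets)
        ultimately show "\<exists>K\<in>{K. compactin X K \<and> K \<subseteq> U}. emeasure M L \<le> emeasure (distr M M p) K"
          using image_compactin[OF L(1) p] by blast
      qed
    qed
  qed
qed

section \<open>The Riesz representation theorem\<close>

definition positive_linear_functional :: "'a topology \<Rightarrow> (('a \<Rightarrow> real) \<Rightarrow> real) \<Rightarrow> bool" where
  "positive_linear_functional X I \<longleftrightarrow>
     (\<forall>f\<in>Cc_real X. \<forall>g\<in>Cc_real X. I (\<lambda>x. f x + g x) = I f + I g) \<and>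
     (\<forall>f\<in>Cc_real X. \<forall>c. I (\<lambda>x. c * f x) = c * I f) \<and>
     (\<forall>f\<in>Cc_real X. (\<forall>x\<in>topspace X. 0 \<le> f x) \<longrightarrow> 0 \<le> I f)"

locale riesz = lch_space +
  fixes I :: "('a \<Rightarrow> real) \<Rightarrow> real"
  assumes I: "positive_linear_functional X I"
begin

lemma I_add: "\<lbrakk>f \<in> Cc_real X; g \<in> Cc_real X\<rbrakk> \<Longrightarrow> I (\<lambda>x. f x + g x) = I f + I g"
  and I_cmult: "f \<in> Cc_real X \<Longrightarrow> I (\<lambda>x. c * f x) = c * I f"
  and I_nonneg: "\<lbrakk>f \<in> Cc_real X; \<And>x. x \<in> topspace X \<Longrightarrow> 0 \<le> f x\<rbrakk> \<Longrightarrow> 0 \<le> I f"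
  using I by (auto simp: positive_linear_functional_def)

lemma I_mono:
  assumes f: "f \<in> Cc_real X" and g: "g \<in> Cc_real X" and le: "\<And>x. x \<in> topspace X \<Longrightarrow> f x \<le> g x"
  shows "I f \<le> I g"
proof -
  have "0 \<le> I (\<lambda>x. g x - f x)" using f g le by (intro I_nonneg Cc_real_diff) auto
  moreover have "I (\<lambda>x. f x + (g x - f x)) = I f + I (\<lambda>x. g x - f x)"
    using f g by (intro I_add Cc_real_diff)
  ultimately show ?thesis by simp
qed

lemma I_cong:
  "\<lbrakk>f \<in> Cc_real X; g \<in> Cc_real X; \<And>x. x \<in> topspace X \<Longrightarrow> f x = g x\<rbrakk> \<Longrightarrow> I f = I g"
  by (intro antisym I_mono) auto

lemma I_zero: "I (\<lambda>x. 0) = 0"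
  using I_cmult[of "\<lambda>x. 0" 0] subordinateD(1)[OF zero_subordinate[of X "{}"]] by simp

lemma I_sum:
  assumes "finite A" "\<And>i. i \<in> A \<Longrightarrow> f i \<in> Cc_real X"
  shows "I (\<lambda>x. \<Sum>i\<in>A. f i x) = (\<Sum>i\<in>A. I (f i))"
  using assms
  by (induction A rule: finite_induct) (simp_all add: I_zero I_add Cc_real_sum)

definition content_open :: "'a set \<Rightarrow> ennreal" where
  "content_open U = (SUP f\<in>subordinate X U. ennreal (I f))"

definition outer :: "'a set \<Rightarrow> ennreal" where
  "outer E = (INF U\<in>{U. openin X U \<and> E \<subseteq> U}. content_open U)"

lemma le_content_open: "f \<in> subordinate X U \<Longrightarrow> ennreal (I f) \<le> content_open U"
  unfolding content_open_def by (rule SUP_upper)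

lemma content_open_mono: "U \<subseteq> V \<Longrightarrow> content_open U \<le> content_open V"
  unfolding content_open_def by (rule SUP_subset_mono[OF subordinate_mono]) auto

lemma content_open_empty: "content_open {} = 0"
proof -
  have "ennreal (I f) \<le> 0" if f: "f \<in> subordinate X {}" for f
  proof -
    have "f x = 0" if "x \<in> topspace X" for x
      using f that by (auto elim!: subordinateE)
    then have "I f = I (\<lambda>x. 0)"
      using f by (intro I_cong) (auto intro: subordinateD zero_subordinate)
    then show ?thesis by (simp add: I_zero)
  qed
  then show ?thesis
    unfolding content_open_def by (metis SUP_least le_zero_eq)
qed

text \<open>A function subordinate to \<open>U \<union> V\<close> is cut by a Urysohn function into a part subordinate to
  \<open>U\<close> and a part subordinate to \<open>V\<close>; this replaces a partition of unity.\<close>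

lemma content_open_Un:
  assumes U: "openin X U" and V: "openin X V"
  shows "content_open (U \<union> V) \<le> content_open U + content_open V"
  unfolding content_open_def[of "U \<union> V"]
proof (rule SUP_least)
  fix f assume f: "f \<in> subordinate X (U \<union> V)"
  then obtain K where K: "compactin X K" "K \<subseteq> U \<union> V" "\<And>x. \<lbrakk>x \<in> topspace X; x \<notin> K\<rbrakk> \<Longrightarrow> f x = 0"
    by (metis subordinateE)
  obtain K1 K2 where K12: "compactin X K1" "K1 \<subseteq> U" "compactin X K2" "K2 \<subseteq> V" "K = K1 \<union> K2"
    using compactin_split[OF K(1) U V K(2)] by metis
  obtain p where p: "p \<in> subordinate X U" "\<And>x. x \<in> K1 \<Longrightarrow> p x = 1"
    using subordinate_Urysohn[OF K12(1) U K12(2)] by metis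
  obtain L where L: "compactin X L" "L \<subseteq> U" "\<And>x. \<lbrakk>x \<in> topspace X; x \<notin> L\<rbrakk> \<Longrightarrow> p x = 0"
    using p by (metis subordinateE)
  note cont = Cc_real_continuous[OF subordinateD(1)[OF f]] Cc_real_continuous[OF subordinateD(1)[OF p(1)]]
  note bd = subordinateD(2,3)[OF f] subordinateD(2,3)[OF p(1)]
  have f1: "(\<lambda>x. f x * p x) \<in> subordinate X U"
    using L bd by (intro subordinateI[where K=L] continuous_map_real_mult cont) (auto intro: mult_le_one)
  have f2: "(\<lambda>x. f x * (1 - p x)) \<in> subordinate X V"
    using K12 K(3) p(2) bd
    by (intro subordinateI[where K=K2] continuous_map_real_mult continuous_map_diff cont)
      (auto intro: mult_le_one)
  have "I f = I (\<lambda>x. f x * p x + f x * (1 - p x))" by (simp add: algebra_simps)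
  also have "\<dots> = I (\<lambda>x. f x * p x) + I (\<lambda>x. f x * (1 - p x))"
    using f1 f2 by (intro I_add) (auto dest: subordinateD)
  finally have "ennreal (I f) = ennreal (I (\<lambda>x. f x * p x)) + ennreal (I (\<lambda>x. f x * (1 - p x)))"
    using f1 f2 by (simp add: I_nonneg subordinateD[of "\<lambda>x. f x * p x"] subordinateD[of "\<lambda>x. f x * (1 - p x)"])
  also have "\<dots> \<le> content_open U + content_open V"
    using f1 f2 by (intro add_mono le_content_open)
  finally show "ennreal (I f) \<le> content_open U + content_open V" .
qed

lemma content_open_finite_UN:
  assumes "\<And>i. i < (n::nat) \<Longrightarrow> openin X (U i)"
  shows "content_open (\<Union>i<n. U i) \<le> (\<Sum>i<n. content_open (U i))"
  using assms
proof (induction n)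
  case 0
  then show ?case by (simp add: content_open_empty)
next
  case (Suc n)
  have "content_open (\<Union>i<Suc n. U i) \<le> content_open (\<Union>i<n. U i) + content_open (U n)"
    using content_open_Un[of "\<Union>i<n. U i" "U n"] Suc.prems
    by (simp add: lessThan_Suc Un_commute) (metis (no_types, lifting) imageE lessThan_iff less_Suc_eq openin_Union)
  also have "\<dots> \<le> (\<Sum>i<Suc n. content_open (U i))"
    using Suc by (simp add: add_right_mono)
  finally show ?case .
qed

lemma content_open_UN:
  fixes U :: "nat \<Rightarrow> 'a set"
  assumes U: "\<And>i. openin X (U i)"
  shows "content_open (\<Union>i. U i) \<le> (\<Sum>i. content_open (U i))"
  unfolding content_open_def[of "\<Union>i. U i"]
proof (rule SUP_least)
  fix f assume f: "f \<in> subordinate X (\<Union>i. U i)"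
  then obtain K where K: "compactin X K" "K \<subseteq> (\<Union>i. U i)" "\<And>x. \<lbrakk>x \<in> topspace X; x \<notin> K\<rbrakk> \<Longrightarrow> f x = 0"
    by (metis subordinateE)
  obtain \<F> where "finite \<F>" "\<F> \<subseteq> range U" "K \<subseteq> \<Union>\<F>"
    using compactinD[OF K(1), of "range U"] U K(2) by auto
  then obtain A where A: "finite A" "K \<subseteq> (\<Union>i\<in>A. U i)"
    by (metis finite_subset_image)
  then obtain n where "A \<subseteq> {..<n}"
    using finite_nat_iff_bounded by blast
  then have "f \<in> subordinate X (\<Union>i<n. U i)"
    using f K(1,3) subset_trans[OF A(2) UN_mono[OF _ subset_refl]]
    by (intro subordinateI[where K=K])
      (auto dest: subordinateD Cc_real_continuous[OF subordinateD(1)])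
  then have "ennreal (I f) \<le> content_open (\<Union>i<n. U i)" by (rule le_content_open)
  also have "\<dots> \<le> (\<Sum>i<n. content_open (U i))" using U by (rule content_open_finite_UN)
  also have "\<dots> \<le> (\<Sum>i. content_open (U i))" by (intro sum_le_suminf) auto
  finally show "ennreal (I f) \<le> (\<Sum>i. content_open (U i))" .
qed

lemma outer_open: "openin X U \<Longrightarrow> outer U = content_open U"
  unfolding outer_def
  by (rule antisym) (auto intro!: INF_lower INF_greatest content_open_mono)

lemma outer_le: "\<lbrakk>openin X U; E \<subseteq> U\<rbrakk> \<Longrightarrow> outer E \<le> content_open U"
  unfolding outer_def by (rule INF_lower) auto

lemma outer_mono: "E \<subseteq> F \<Longrightarrow> outer E \<le> outer F"
  unfolding outer_def by (rule INF_superset_mono) auto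

lemma outer_approx:
  assumes "0 < e" "outer E < \<infinity>"
  obtains U where "openin X U" "E \<subseteq> U" "content_open U \<le> outer E + e"
proof -
  have "outer E < outer E + e"
    using assms by (simp add: ennreal_add_left_cancel_less less_top[symmetric])
  then have "(INF U\<in>{U. openin X U \<and> E \<subseteq> U}. content_open U) < outer E + e"
    by (simp add: outer_def)
  then obtain U where "openin X U" "E \<subseteq> U" "content_open U < outer E + e"
    unfolding INF_less_iff by blast
  then show ?thesis using that[of U] by (simp add: less_imp_le)
qed

lemma outer_subadditive:
  assumes A: "\<And>i. A i \<subseteq> topspace X"
  shows "outer (\<Union>i::nat. A i) \<le> (\<Sum>i. outer (A i))"
proof (cases "\<exists>i. outer (A i) = \<infinity>")
  case True
  then obtain i where "outer (A i) = \<infinity>" ..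
  moreover have "outer (A i) \<le> (\<Sum>i. outer (A i))"
    using sum_le_suminf[of "\<lambda>i. outer (A i)" "{i}"] by auto
  ultimately show ?thesis by (simp add: top_unique)
next
  case False
  show ?thesis
  proof (rule ennreal_le_epsilon)
    fix e :: real assume e: "0 < e"
    have "\<exists>U. openin X U \<and> A i \<subseteq> U \<and> content_open U \<le> outer (A i) + ennreal (e * (1/2)^Suc i)" for i
    proof (rule outer_approx)
      show "0 < ennreal (e * (1/2)^Suc i)" using e by simp
      show "outer (A i) < \<infinity>" using False by (simp add: less_top[symmetric])
    qed blast
    then obtain U where U: "\<And>i. openin X (U i)" "\<And>i. A i \<subseteq> U i"
      "\<And>i. content_open (U i) \<le> outer (A i) + ennreal (e * (1/2)^Suc i)"
      by metis
    have "outer (\<Union>i. A i) \<le> content_open (\<Union>i. U i)"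
      using U by (intro outer_le) blast+
    also have "\<dots> \<le> (\<Sum>i. content_open (U i))" using U(1) by (rule content_open_UN)
    also have "\<dots> \<le> (\<Sum>i. outer (A i) + ennreal (e * (1/2)^Suc i))"
      using U by (intro suminf_le) auto
    also have "\<dots> = (\<Sum>i. outer (A i)) + (\<Sum>i. ennreal (e * (1/2)^Suc i))"
      by (rule suminf_add[symmetric]) auto
    also have "(\<Sum>i. ennreal (e * (1/2)^Suc i)) = ennreal e"
      using e sums_mult[OF power_half_series, of e]
      by (intro sums_unique[symmetric]) (simp add: sums_ennreal)
    finally show "outer (\<Union>i. A i) \<le> (\<Sum>i. outer (A i)) + ennreal e" .
  qed
qed

lemma outer_empty: "outer {} = 0"
  using outer_open[of "{}"] content_open_empty by simp

lemma outer_Un: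
  assumes "E \<subseteq> topspace X" "F \<subseteq> topspace X"
  shows "outer (E \<union> F) \<le> outer E + outer F"
proof -
  define A where "A i = (if i = 0 then E else if i = 1 then F else {})" for i :: nat
  have "outer (\<Union>i. A i) \<le> (\<Sum>i. outer (A i))"
    using assms by (intro outer_subadditive) (auto simp: A_def)
  also have "(\<Union>i. A i) = E \<union> F" by (auto simp: A_def split: if_splits)
  also have "(\<Sum>i. outer (A i)) = (\<Sum>i<2. outer (A i))"
    by (rule suminf_finite) (auto simp: A_def outer_empty)
  finally show ?thesis by (simp add: A_def numeral_2_eq_2)
qed

text \<open>If \<open>f\<close> is subordinate to \<open>U \<inter> V\<close> and vanishes off the compact set \<open>K\<close>, and \<open>g\<close> is subordinate to
\<open>U - K\<close>, then \<open>f + g\<close> is still bounded by 1 and hence subordinate to \<open>U\<close>.\<close>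

lemma content_open_split:
  assumes U: "openin X U" and V: "openin X V"
  shows "content_open (U \<inter> V) + outer (U - V) \<le> content_open U"
  unfolding content_open_def[of "U \<inter> V"]
proof (subst ennreal_SUP_add_left[symmetric])
  show "subordinate X (U \<inter> V) \<noteq> {}" using zero_subordinate by blast
  show "(SUP f\<in>subordinate X (U \<inter> V). ennreal (I f) + outer (U - V)) \<le> content_open U"
  proof (rule SUP_least)
    fix f assume f: "f \<in> subordinate X (U \<inter> V)"
    then obtain K where K: "compactin X K" "K \<subseteq> U \<inter> V" "\<And>x. \<lbrakk>x \<in> topspace X; x \<notin> K\<rbrakk> \<Longrightarrow> f x = 0"
      by (metis subordinateE)
    have "openin X (U - K)" using U K compactin_closedin by (blast intro: openin_diff)
    then have "ennreal (I f) + outer (U - V) \<le> ennreal (I f) + content_open (U - K)"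
      using K by (intro add_left_mono outer_le) auto
    also have "\<dots> = (SUP g\<in>subordinate X (U - K). ennreal (I f) + ennreal (I g))"
      unfolding content_open_def using zero_subordinate
      by (subst ennreal_SUP_add_right) auto
    also have "\<dots> \<le> content_open U"
    proof (rule SUP_least)
      fix g assume g: "g \<in> subordinate X (U - K)"
      then obtain L where L: "compactin X L" "L \<subseteq> U - K" "\<And>x. \<lbrakk>x \<in> topspace X; x \<notin> L\<rbrakk> \<Longrightarrow> g x = 0"
        by (metis subordinateE)
      have bd: "0 \<le> f x" "f x \<le> 1" "0 \<le> g x" "g x \<le> 1" if "x \<in> topspace X" for x
        using subordinateD(2,3)[OF f that] subordinateD(2,3)[OF g that] by auto
      have "(\<lambda>x. f x + g x) \<in> subordinate X U"
      proof (rule subordinateI[where K="K \<union> L"])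
        show "f x + g x \<le> 1" if "x \<in> topspace X" for x
          using bd[OF that] K(3)[OF that] L(2) L(3)[OF that] by (cases "x \<in> K") force+
        show "continuous_map X euclideanreal (\<lambda>x. f x + g x)"
          by (intro continuous_map_add Cc_real_continuous subordinateD(1)[OF f] subordinateD(1)[OF g])
      qed (use K L bd in \<open>auto intro: compactin_Un\<close>)
      then have "ennreal (I (\<lambda>x. f x + g x)) \<le> content_open U" by (rule le_content_open)
      then show "ennreal (I f) + ennreal (I g) \<le> content_open U"
        using f g bd by (simp add: I_add I_nonneg subordinateD)
    qed
    finally show "ennreal (I f) + outer (U - V) \<le> content_open U" .
  qed
qed

text \<open>This is Caratheodory's condition for open sets. By definition of the outer measure it is enough to split open
sets \<open>E\<close>, which is \<open>content_open_split\<close>.\<close>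

lemma openin_lambda_system:
  assumes V: "openin X V"
  shows "V \<in> lambda_system (topspace X) (Pow (topspace X)) outer"
proof -
  have "outer (E \<inter> V) + outer (E - V) = outer E" if E: "E \<subseteq> topspace X" for E
  proof (rule antisym)
    show "outer (E \<inter> V) + outer (E - V) \<le> outer E"
      unfolding outer_def[of E]
    proof (rule INF_greatest)
      fix U assume "U \<in> {U. openin X U \<and> E \<subseteq> U}"
      then have U: "openin X U" "E \<subseteq> U" by auto
      then have "outer (E \<inter> V) + outer (E - V) \<le> content_open (U \<inter> V) + outer (U - V)"
        using V by (intro add_mono outer_le outer_mono) auto
      also have "\<dots> \<le> content_open U" using U V by (intro content_open_split)
      finally show "outer (E \<inter> V) + outer (E - V) \<le> content_open U" .
    qed
    have "outer ((E \<inter> V) \<union> (E - V)) \<le> outer (E \<inter> V) + outer (E - V)"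
      using E by (intro outer_Un) auto
    then show "outer E \<le> outer (E \<inter> V) + outer (E - V)" by (simp add: Int_Diff_Un)
  qed
  then show ?thesis
    using openin_subset[OF V] by (simp add: algebra.lambda_system_eq algebra_Pow)
qed

lemma measure_space_outer: "measure_space (topspace X) (sets (borel_of X)) outer"
proof (rule measure_down)
  have "outer_measure_space (Pow (topspace X)) outer"
    unfolding outer_measure_space_def
  proof (intro conjI)
    show "positive (Pow (topspace X)) outer" by (simp add: positive_def outer_empty)
    show "increasing (Pow (topspace X)) outer" by (simp add: increasing_def outer_mono)
    show "countably_subadditive (Pow (topspace X)) outer"
      using outer_subadditive by (auto simp: countably_subadditive_def)
  qed
  then show *: "measure_space (topspace X) (lambda_system (topspace X) (Pow (topspace X)) outer) outer"
    by (rule sigma_algebra.caratheodory_lemma[OF sigma_algebra_Pow])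
  show "sigma_algebra (topspace X) (sets (borel_of X))"
    using sets.sigma_algebra_axioms[of "borel_of X"] by simp
  have "sigma_algebra (topspace X) (lambda_system (topspace X) (Pow (topspace X)) outer)"
    using * by (simp add: measure_space_def)
  then show "sets (borel_of X) \<subseteq> lambda_system (topspace X) (Pow (topspace X)) outer"
    unfolding sets_borel_of by (rule sigma_algebra.sigma_sets_subset) (auto simp: openin_lambda_system)
qed

definition riesz_measure :: "'a measure" where
  "riesz_measure = measure_of (topspace X) (sets (borel_of X)) outer"

lemma sets_riesz_measure: "sets riesz_measure = sets (borel_of X)"
  unfolding riesz_measure_def
  using sets.sets_measure_of_eq[of "borel_of X"] by simp

lemma emeasure_riesz_measure: "E \<in> sets (borel_of X) \<Longrightarrow> emeasure riesz_measure E = outer E"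
  unfolding riesz_measure_def using measure_space_outer
  by (intro emeasure_measure_of_sigma) (auto simp: measure_space_def)

text \<open>For \<open>a > 1\<close> the open set where \<open>f > 1 / a\<close> contains \<open>K\<close>, and every function subordinate to it is at most
\<open>a f\<close>.\<close>

lemma outer_compact_le:
  assumes f: "f \<in> Cc_real X" and nonneg: "\<And>x. x \<in> topspace X \<Longrightarrow> 0 \<le> f x"
    and K: "K \<subseteq> topspace X" and 1: "\<And>x. x \<in> K \<Longrightarrow> 1 \<le> f x"
  shows "outer K \<le> ennreal (I f)"
proof -
  have I0: "0 \<le> I f" using f nonneg by (rule I_nonneg)
  have *: "outer K \<le> ennreal (a * I f)" if a: "1 < a" for a
  proof -
    let ?U = "{x \<in> topspace X. f x \<in> {1 / a<..}}"
    have U: "openin X ?U"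
      using f by (intro openin_continuous_map_preimage) (auto intro: Cc_real_continuous)
    have "1 / a < 1" using a by simp
    then have "K \<subseteq> ?U" using K 1 by force
    then have "outer K \<le> content_open ?U" using U by (intro outer_le)
    also have "\<dots> \<le> ennreal (a * I f)"
      unfolding content_open_def
    proof (rule SUP_least)
      fix g assume g: "g \<in> subordinate X ?U"
      have "g x \<le> a * f x" if x: "x \<in> topspace X" for x
      proof (cases "x \<in> ?U")
        case True
        then have "1 \<le> a * f x" using a by (simp add: field_simps)
        then show ?thesis using subordinateD(3)[OF g x] by simp
      next
        case False
        obtain L where "compactin X L" "L \<subseteq> ?U" "\<And>x. \<lbrakk>x \<in> topspace X; x \<notin> L\<rbrakk> \<Longrightarrow> g x = 0"
          by (rule subordinateE[OF g]) blast
        then have "g x = 0" using False x by (metis subsetD)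
        then show ?thesis using a nonneg[OF x] by simp
      qed
      then have "I g \<le> I (\<lambda>x. a * f x)"
        by (rule I_mono[OF subordinateD(1)[OF g] Cc_real_cmult[OF f]])
      then show "ennreal (I g) \<le> ennreal (a * I f)"
        using f by (simp add: I_cmult ennreal_leI)
    qed
    finally show ?thesis .
  qed
  show ?thesis
  proof (rule ennreal_le_epsilon)
    fix e :: real assume e: "0 < e"
    \<comment> \<open>With this \<open>a\<close>, the bound \<open>a I(f)\<close> exceeds \<open>I(f)\<close> by at most \<open>e\<close>, also when \<open>I(f) = 0\<close>.\<close>
    define a where "a = 1 + e / (I f + 1)"
    have "1 < a" using e I0 by (simp add: a_def)
    have "a * I f = I f + e * (I f / (I f + 1))" by (simp add: a_def algebra_simps)
    also have "\<dots> \<le> I f + e * 1"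
      using e I0 by (intro add_left_mono mult_left_mono) (auto simp: divide_le_eq)
    finally have "ennreal (a * I f) \<le> ennreal (I f + e)" by (simp add: ennreal_leI)
    also have "\<dots> = ennreal (I f) + ennreal e" using I0 e by simp
    finally show "outer K \<le> ennreal (I f) + ennreal e"
      using *[OF \<open>1 < a\<close>] by (rule order_trans[rotated])
  qed
qed

lemma le_outer_compact:
  assumes f: "f \<in> Cc_real X" and nonneg: "\<And>x. x \<in> topspace X \<Longrightarrow> 0 \<le> f x"
    and le: "\<And>x. x \<in> topspace X \<Longrightarrow> f x \<le> 1"
    and K: "compactin X K" and 0: "\<And>x. \<lbrakk>x \<in> topspace X; x \<notin> K\<rbrakk> \<Longrightarrow> f x = 0"
  shows "ennreal (I f) \<le> outer K"
  unfolding outer_def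
proof (rule INF_greatest)
  fix U assume "U \<in> {U. openin X U \<and> K \<subseteq> U}"
  then have "f \<in> subordinate X U"
    using assms by (intro subordinateI[where K=K]) (auto intro: Cc_real_continuous)
  then show "ennreal (I f) \<le> content_open U" by (rule le_content_open)
qed

lemma outer_compact_finite:
  assumes "compactin X K"
  shows "outer K < \<infinity>"
proof -
  obtain f where "f \<in> subordinate X (topspace X)" "\<And>x. x \<in> K \<Longrightarrow> f x = 1"
    using subordinate_Urysohn[OF assms openin_topspace compactin_subset_topspace[OF assms]] by metis
  then have "outer K \<le> ennreal (I f)"
    using compactin_subset_topspace[OF assms] by (intro outer_compact_le) (auto dest: subordinateD)
  then show ?thesis by (metis ennreal_less_top le_less_trans infinity_ennreal_def)
qed

lemma radon_riesz_measure: "radon_measure X riesz_measure"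
  unfolding radon_measure_def
proof (intro conjI allI ballI impI)
  show "sets riesz_measure = sets (borel_of X)" by (rule sets_riesz_measure)
  show "emeasure riesz_measure K < \<infinity>" if "compactin X K" for K
    using that by (simp add: emeasure_riesz_measure compactin_sets_borel_of outer_compact_finite[simplified])
  show "emeasure riesz_measure E = (INF U\<in>{U. openin X U \<and> E \<subseteq> U}. emeasure riesz_measure U)"
    if "E \<in> sets riesz_measure" for E
  proof -
    have "(INF U\<in>{U. openin X U \<and> E \<subseteq> U}. emeasure riesz_measure U) = outer E"
      unfolding outer_def
      by (intro INF_cong) (auto simp: emeasure_riesz_measure openin_sets_borel_of outer_open)
    then show ?thesis using that by (simp add: emeasure_riesz_measure sets_riesz_measure)
  qed
  fix U assume U: "openin X U"
  show "emeasure riesz_measure U = (SUP K\<in>{K. compactin X K \<and> K \<subseteq> U}. emeasure riesz_measure K)"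
  proof (rule antisym)
    have "emeasure riesz_measure U = (SUP f\<in>subordinate X U. ennreal (I f))"
      using U by (simp add: emeasure_riesz_measure openin_sets_borel_of outer_open content_open_def)
    also have "\<dots> \<le> (SUP K\<in>{K. compactin X K \<and> K \<subseteq> U}. emeasure riesz_measure K)"
    proof (rule SUP_mono)
      fix f assume f: "f \<in> subordinate X U"
      then obtain K where K: "compactin X K" "K \<subseteq> U" "\<And>x. \<lbrakk>x \<in> topspace X; x \<notin> K\<rbrakk> \<Longrightarrow> f x = 0"
        by (metis subordinateE)
      then have "ennreal (I f) \<le> outer K"
        using f by (intro le_outer_compact) (auto dest: subordinateD)
      then show "\<exists>K\<in>{K. compactin X K \<and> K \<subseteq> U}. ennreal (I f) \<le> emeasure riesz_measure K"
        using K by (auto simp: emeasure_riesz_measure compactin_sets_borel_of)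
    qed
    finally show "emeasure riesz_measure U \<le> (SUP K\<in>{K. compactin X K \<and> K \<subseteq> U}. emeasure riesz_measure K)" .
    show "(SUP K\<in>{K. compactin X K \<and> K \<subseteq> U}. emeasure riesz_measure K) \<le> emeasure riesz_measure U"
      using U by (intro SUP_least emeasure_mono)
        (auto simp: sets_riesz_measure openin_sets_borel_of)
  qed
qed

text \<open>The functional and the integral are compared slice by slice: the part of \<open>f\<close> between the
  heights \<open>j e\<close> and \<open>(j + 1) e\<close> is \<open>e\<close> times a function squeezed between the indicators of two
  consecutive superlevel sets, so both \<open>I\<close> and the integral of it lie between \<open>e\<close> times the measures of
  these sets. The differences telescope.\<close>

lemma integral_riesz_measure_nonneg:
  assumes f: "f \<in> Cc_real X" and nonneg: "\<And>x. x \<in> topspace X \<Longrightarrow> 0 \<le> f x"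
  shows "(\<integral>x. f x \<partial>riesz_measure) = I f"
proof -
  let ?M = riesz_measure
  note M = radon_riesz_measure
  obtain K where K: "compactin X K" "\<And>x. \<lbrakk>x \<in> topspace X; x \<notin> K\<rbrakk> \<Longrightarrow> f x = 0"
    using f by (meson Cc_realE)
  obtain B where B: "0 < B" "\<And>x. x \<in> topspace X \<Longrightarrow> \<bar>f x\<bar> \<le> B"
    using f by (meson Cc_real_bounded)
  have bound: "\<bar>(\<integral>x. f x \<partial>?M) - I f\<bar> \<le> B / Suc n * measure ?M K" for n
  proof -
    define N where "N = Suc n"
    define e where "e = B / N"
    have e: "0 < e" "N * e = B" using B by (auto simp: e_def N_def)
    define s where "s j x = min 1 (max 0 (f x / e - real j))" for j :: nat and x
    \<comment> \<open>At height 0 the superlevel set is all of \<open>X\<close>; the compact support \<open>K\<close> replaces it.\<close>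
    define L where "L j = (if j = 0 then K else {x \<in> topspace X. f x \<in> {real j * e..}})" for j :: nat
    have L: "compactin X (L j)" for j
    proof (cases "j = 0")
      case False
      then have "L j \<subseteq> K" using e K(2) by (force simp: L_def mult_le_0_iff)
      moreover have "closedin X (L j)"
        using False f by (auto simp: L_def simp del: atLeast_iff
            intro!: closedin_continuous_map_preimage[OF Cc_real_continuous])
      ultimately show ?thesis using K closed_compactin by blast
    qed (use K in \<open>simp add: L_def\<close>)
    have scont: "continuous_map X euclideanreal (s j)" for j
      unfolding s_def using Cc_real_continuous[OF f] e
      by (intro continuous_map_real_min continuous_map_real_max continuous_map_diff
          continuous_map_real_divide) auto
    have s0: "s j x = 0" if "x \<in> topspace X" "x \<notin> L j" for j x
      using that K(2)[of x] e by (cases "j = 0") (auto simp: s_def L_def field_simps)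
    have s1: "s j x = 1" if "x \<in> L (Suc j)" for j x
      using that e by (auto simp: s_def L_def field_simps)
    have s01: "0 \<le> s j x" "s j x \<le> 1" for j x by (auto simp: s_def)
    have sCc: "s j \<in> Cc_real X" for j
      using scont L s0 by (rule Cc_realI)
    have slices: "(\<Sum>j<N. s j x) = f x / e" if "x \<in> topspace X" for x
    proof -
      have "(\<Sum>j<k. s j x) = min (real k) (f x / e)" for k
        using nonneg[OF that] e by (induction k) (auto simp: s_def min_def max_def)
      moreover have "f x / e \<le> real N" using B(2)[OF that] e by (simp add: field_simps)
      ultimately show ?thesis by simp
    qed
    define F where "F j = measure ?M (L j)" for j
    have F: "emeasure ?M (L j) = ennreal (F j)" for j
      unfolding F_def using radon_measure_compact[OF M L]
      by (intro emeasure_eq_ennreal_measure) (simp add: less_top[symmetric])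
    have F0: "0 \<le> F j" for j by (simp add: F_def)
    have LX: "L j \<subseteq> topspace X" for j using L compactin_subset_topspace by blast
    have LM: "L j \<in> sets ?M" for j using M L by (rule compactin_sets_radon)
    have outer_F: "outer (L j) = ennreal (F j)" for j
      using F L by (simp add: emeasure_riesz_measure compactin_sets_borel_of)
    have I_le: "I (s j) \<le> F j" for j
      using le_outer_compact[of "s j" "L j"] sCc L s0 s01 F0 by (auto simp: outer_F)
    have I_ge: "F (Suc j) \<le> I (s j)" for j
      using outer_compact_le[of "s j" "L (Suc j)"] sCc LX s1 s01
      by (auto simp: outer_F ennreal_le_iff I_nonneg)
    have int_le: "(\<integral>x. s j x \<partial>?M) \<le> F j" for j
      using radon_measure_ge_integral[OF M LM sCc, of j j] s0 s01 F0
      by (auto simp: F indicator_def)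
    have int_ge: "F (Suc j) \<le> (\<integral>x. s j x \<partial>?M)" for j
    proof -
      have "emeasure ?M (L (Suc j)) \<le> ennreal (\<integral>x. s j x \<partial>?M)"
        using s1 s01 by (intro radon_measure_le_integral[OF M LM sCc]) (auto simp: indicator_def)
      then show ?thesis using s01 by (simp add: F ennreal_le_iff)
    qed
    have f_eq: "f x = e * (\<Sum>j<N. s j x)" if "x \<in> topspace X" for x
      using slices[OF that] e by simp
    have "I f = I (\<lambda>x. e * (\<Sum>j<N. s j x))"
      using f f_eq sCc by (intro I_cong Cc_real_cmult Cc_real_sum) auto
    also have "\<dots> = e * (\<Sum>j<N. I (s j))"
      using sCc by (simp add: I_cmult I_sum Cc_real_sum)
    finally have If: "I f = e * (\<Sum>j<N. I (s j))" .
    have "(\<integral>x. f x \<partial>?M) = (\<integral>x. e * (\<Sum>j<N. s j x) \<partial>?M)"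
      using f_eq by (intro Bochner_Integration.integral_cong) (auto simp: radon_measure_space[OF M])
    also have "\<dots> = e * (\<Sum>j<N. \<integral>x. s j x \<partial>?M)"
      using Cc_real_integrable[OF M sCc] by simp
    finally have "(\<integral>x. f x \<partial>?M) - I f = e * (\<Sum>j<N. (\<integral>x. s j x \<partial>?M) - I (s j))"
      by (simp add: If sum_subtractf right_diff_distrib)
    then have "\<bar>(\<integral>x. f x \<partial>?M) - I f\<bar> = e * \<bar>\<Sum>j<N. (\<integral>x. s j x \<partial>?M) - I (s j)\<bar>"
      using e by (simp add: abs_mult)
    also have "\<dots> \<le> e * (\<Sum>j<N. \<bar>(\<integral>x. s j x \<partial>?M) - I (s j)\<bar>)"
      using e by (intro mult_left_mono sum_abs) auto
    also have "\<dots> \<le> e * (\<Sum>j<N. F j - F (Suc j))"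
    proof (intro mult_left_mono sum_mono)
      show "\<bar>(\<integral>x. s j x \<partial>?M) - I (s j)\<bar> \<le> F j - F (Suc j)" for j
        using I_le[of j] I_ge[of j] int_le[of j] int_ge[of j] by linarith
    qed (use e in simp)
    also have "(\<Sum>j<N. F j - F (Suc j)) = F 0 - F N" by (rule sum_lessThan_telescope')
    also have "e * (F 0 - F N) \<le> e * F 0" using e F0 by (intro mult_left_mono) auto
    finally show ?thesis by (simp add: e_def N_def F_def L_def)
  qed
  have "(\<lambda>n. B / Suc n * measure ?M K) \<longlonglongrightarrow> 0 * measure ?M K"
    by (intro tendsto_intros LIMSEQ_Suc lim_const_over_n)
  then have "\<bar>(\<integral>x. f x \<partial>?M) - I f\<bar> \<le> 0"
    using bound by (intro LIMSEQ_le_const) auto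
  then show ?thesis by simp
qed

lemma integral_riesz_measure:
  assumes f: "f \<in> Cc_real X"
  shows "(\<integral>x. f x \<partial>riesz_measure) = I f"
proof -
  define p where "p x = max 0 (f x)" for x
  define q where "q x = max 0 (- f x)" for x
  obtain K where K: "compactin X K" "\<And>x. \<lbrakk>x \<in> topspace X; x \<notin> K\<rbrakk> \<Longrightarrow> f x = 0"
    using f by (meson Cc_realE)
  have p: "p \<in> Cc_real X" and q: "q \<in> Cc_real X"
    using K Cc_real_continuous[OF f] unfolding p_def q_def
    by (auto intro!: Cc_realI[where K=K] continuous_map_real_max continuous_map_minus)
  have eq: "f x + q x = p x" for x by (simp add: p_def q_def)
  have "(\<integral>x. f x \<partial>riesz_measure) + (\<integral>x. q x \<partial>riesz_measure) = (\<integral>x. f x + q x \<partial>riesz_measure)"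
    using f q by (intro Bochner_Integration.integral_add[symmetric] Cc_real_integrable[OF radon_riesz_measure])
  moreover have "I f + I q = I (\<lambda>x. f x + q x)" using f q by (rule I_add[symmetric])
  moreover have "(\<integral>x. p x \<partial>riesz_measure) = I p" "(\<integral>x. q x \<partial>riesz_measure) = I q"
    by (rule integral_riesz_measure_nonneg[OF p], simp add: p_def)
      (rule integral_riesz_measure_nonneg[OF q], simp add: q_def)
  ultimately show ?thesis by (simp add: eq)
qed

end

theorem riesz_representation:
  assumes "locally_compact_space X" "Hausdorff_space X" "positive_linear_functional X I"
  obtains M where "radon_measure X M" "\<And>f. f \<in> Cc_real X \<Longrightarrow> (\<integral>x. f x \<partial>M) = I f"
proof -
  interpret riesz X I by standard (use assms in auto)
  show ?thesis using that radon_riesz_measure integral_riesz_measure by blast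
qed

section \<open>Integrals depending on a parameter and iterated integrals\<close>

lemma continuous_map_real_epsI:
  assumes "\<And>x e. \<lbrakk>x \<in> topspace X; 0 < e\<rbrakk> \<Longrightarrow>
             \<exists>U. openin X U \<and> x \<in> U \<and> (\<forall>y\<in>U. \<bar>f y - f x\<bar> < (e::real))"
  shows "continuous_map X euclideanreal f"
proof -
  have "(f \<longlongrightarrow> f x) (atin X x)" if x: "x \<in> topspace X" for x
  proof (rule tendstoI)
    fix e :: real assume "0 < e"
    then obtain U where "openin X U" "x \<in> U" "\<forall>y\<in>U. \<bar>f y - f x\<bar> < e"
      using assms[OF x] by blast
    then show "eventually (\<lambda>y. dist (f y) (f x) < e) (atin X x)"
      unfolding eventually_atin by (auto simp: dist_real_def)
  qed
  then show ?thesis by (simp add: continuous_map_atin)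
qed

lemma continuous_map_slice:
  assumes "continuous_map (prod_topology X Y) Z (case_prod F)"
  shows "x \<in> topspace X \<Longrightarrow> continuous_map Y Z (F x)"
    and "y \<in> topspace Y \<Longrightarrow> continuous_map X Z (\<lambda>x. F x y)"
proof -
  show "continuous_map Y Z (F x)" if "x \<in> topspace X"
    using continuous_map_compose[OF _ assms, of Y "\<lambda>y. (x, y)"] that
    by (simp add: continuous_map_paired o_def)
  show "continuous_map X Z (\<lambda>x. F x y)" if "y \<in> topspace Y"
    using continuous_map_compose[OF _ assms, of X "\<lambda>x. (x, y)"] that
    by (simp add: continuous_map_paired o_def)
qed

text \<open>The points where \<open>F(x', y)\<close> is within \<open>e\<close> of \<open>F(x, y)\<close> form an open subset of the product that contains
\<open>{x} \<times> L\<close>, so the tube lemma applies.\<close>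

lemma continuous_map_slices_close:
  fixes F :: "'a \<Rightarrow> 'b \<Rightarrow> real"
  assumes F: "continuous_map (prod_topology X Y) euclideanreal (case_prod F)"
    and L: "compactin Y L" and x: "x \<in> topspace X" and e: "0 < e"
  obtains U where "openin X U" "x \<in> U" "\<And>x' y. \<lbrakk>x' \<in> U; y \<in> L\<rbrakk> \<Longrightarrow> \<bar>F x' y - F x y\<bar> < e"
proof -
  let ?W = "{p \<in> topspace (prod_topology X Y). \<bar>case_prod F p - F x (snd p)\<bar> \<in> {..<e}}"
  have "continuous_map (prod_topology X Y) euclideanreal (\<lambda>p. F x (snd p))"
    using continuous_map_compose[OF continuous_map_snd continuous_map_slice(1)[OF F x]]
    by (simp add: o_def)
  then have "openin (prod_topology X Y) ?W"
    using F
    by (intro openin_continuous_map_preimage[where Y=euclideanreal] continuous_map_real_abs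
        continuous_map_diff) auto
  moreover have "{x} \<times> L \<subseteq> ?W" using x e compactin_subset_topspace[OF L] by auto
  ultimately have "\<exists>U V. openin X U \<and> openin Y V \<and> x \<in> U \<and> L \<subseteq> V \<and> U \<times> V \<subseteq> ?W"
    by (rule tube_lemma_right[OF _ L x])
  then obtain U V where UV: "openin X U" "x \<in> U" "L \<subseteq> V" "U \<times> V \<subseteq> ?W" by blast
  show ?thesis
  proof (rule that[OF UV(1,2)])
    show "\<bar>F x' y - F x y\<bar> < e" if "x' \<in> U" "y \<in> L" for x' y
    proof -
      have "(x', y) \<in> ?W" using UV(3,4) that by blast
      then show ?thesis by simp
    qed
  qed
qed

context lch_space
begin

lemma radon_abs_integral_le:
  fixes f :: "'a \<Rightarrow> real"
  assumes M: "radon_measure X M" and K: "compactin X K" and f: "integrable M f"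
    and le: "\<And>x. x \<in> topspace X \<Longrightarrow> \<bar>f x\<bar> \<le> B * indicator K x"
  shows "\<bar>\<integral>x. f x \<partial>M\<bar> \<le> B * measure M K"
proof -
  have fin: "emeasure M K < \<infinity>" and KM: "K \<in> sets M"
    using M K radon_measure_compact compactin_sets_radon by blast+
  have "\<bar>\<integral>x. f x \<partial>M\<bar> \<le> (\<integral>x. \<bar>f x\<bar> \<partial>M)" by (rule integral_abs_bound)
  also have "\<dots> \<le> (\<integral>x. B * indicator K x \<partial>M)"
    using le f fin KM
    by (intro integral_mono integrable_mult_right integrable_real_indicator integrable_abs)
      (auto simp: radon_measure_space[OF M])
  also have "\<dots> = B * measure M K"
    using compactin_subset_topspace[OF K] by (simp add: radon_measure_space[OF M] Int_absorb2)
  finally show ?thesis .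
qed

text \<open>The local bound on the supports makes the slices uniformly close near \<open>z\<close> on a set of finite measure.\<close>

lemma continuous_map_integral_parameter:
  fixes F :: "'b \<Rightarrow> 'a \<Rightarrow> real"
  assumes N: "radon_measure X N"
    and F: "continuous_map (prod_topology Z X) euclideanreal (case_prod F)"
    and loc: "\<And>z. z \<in> topspace Z \<Longrightarrow> \<exists>U L. openin Z U \<and> z \<in> U \<and> compactin X L \<and>
                (\<forall>z'\<in>U. \<forall>x\<in>topspace X - L. F z' x = 0)"
  shows "continuous_map Z euclideanreal (\<lambda>z. \<integral>x. F z x \<partial>N)"
proof (rule continuous_map_real_epsI)
  fix z e assume z: "z \<in> topspace Z" and e: "0 < (e::real)"
  obtain U L where U: "openin Z U" "z \<in> U" "compactin X L" "\<forall>z'\<in>U. \<forall>x\<in>topspace X - L. F z' x = 0"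
    using loc[OF z] by blast
  define d where "d = e / (measure N L + 1)"
  have m: "0 < measure N L + 1" using measure_nonneg[of N L] by linarith
  have d: "0 < d" using e m by (simp add: d_def)
  obtain V where V: "openin Z V" "z \<in> V" "\<And>z' x. \<lbrakk>z' \<in> V; x \<in> L\<rbrakk> \<Longrightarrow> \<bar>F z' x - F z x\<bar> < d"
    using continuous_map_slices_close[OF F U(3) z d] by metis
  have "\<bar>(\<integral>x. F z' x \<partial>N) - (\<integral>x. F z x \<partial>N)\<bar> < e" if z': "z' \<in> U \<inter> V" for z'
  proof -
    have "z' \<in> topspace Z" using z' U openin_subset by blast
    then have "F z' \<in> Cc_real X" "F z \<in> Cc_real X"
      using U z z' by (auto intro!: Cc_realI[where K=L] continuous_map_slice(1)[OF F])
    then have int: "integrable N (F z')" "integrable N (F z)"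
      using N by (auto intro: Cc_real_integrable)
    have "\<bar>\<integral>x. F z' x - F z x \<partial>N\<bar> \<le> d * measure N L"
      using N U(3)
    proof (rule radon_abs_integral_le)
      show "integrable N (\<lambda>x. F z' x - F z x)" using int by simp
      show "\<bar>F z' x - F z x\<bar> \<le> d * indicator L x" if "x \<in> topspace X" for x
        using U(2,4) V(3)[of z' x] z' that d by (cases "x \<in> L") (auto intro: less_imp_le)
    qed
    also have "\<dots> < d * (measure N L + 1)" using d by simp
    also have "\<dots> = e" using m by (simp add: d_def)
    finally show ?thesis using int by simp
  qed
  then show "\<exists>U. openin Z U \<and> z \<in> U \<and> (\<forall>y\<in>U. \<bar>(\<integral>x. F y x \<partial>N) - (\<integral>x. F z x \<partial>N)\<bar> < e)"
    using U V by (intro exI[of _ "U \<inter> V"]) (auto intro: openin_Int)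
qed

end

text \<open>On \<open>K \<times> L\<close> the function \<open>F\<close> is uniformly close to a finite sum of products \<open>1\<^sub>A(x) F(a, y)\<close>. For these the
two iterated integrals agree by linearity, and both depend on \<open>F\<close> in a uniformly continuous way because
\<open>K\<close> and \<open>L\<close> have finite measure.\<close>

lemma radon_Fubini:
  fixes F :: "'a \<Rightarrow> 'b \<Rightarrow> real"
  assumes X: "lch_space X" and Y: "lch_space Y"
    and M: "radon_measure X M" and N: "radon_measure Y N"
    and F: "continuous_map (prod_topology X Y) euclideanreal (case_prod F)"
    and K: "compactin X K" and L: "compactin Y L"
    and 0: "\<And>x y. \<lbrakk>x \<in> topspace X; y \<in> topspace Y; x \<notin> K \<or> y \<notin> L\<rbrakk> \<Longrightarrow> F x y = 0"
  shows "(\<integral>x. (\<integral>y. F x y \<partial>N) \<partial>M) = (\<integral>y. (\<integral>x. F x y \<partial>M) \<partial>N)"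
proof -
  interpret X: lch_space X by (rule X)
  interpret Y: lch_space Y by (rule Y)
  note spM = radon_measure_space[OF M] and spN = radon_measure_space[OF N]
  have KX: "K \<subseteq> topspace X" and LY: "L \<subseteq> topspace Y"
    using K L compactin_subset_topspace by blast+
  have fx: "F x \<in> Cc_real Y" if "x \<in> topspace X" for x
    using L 0 that by (auto intro!: Cc_realI[where K=L] continuous_map_slice(1)[OF F])
  have fy: "(\<lambda>x. F x y) \<in> Cc_real X" if "y \<in> topspace Y" for y
    using K 0 that by (auto intro!: Cc_realI[where K=K] continuous_map_slice(2)[OF F])
  have ix: "integrable N (F x)" if "x \<in> topspace X" for x
    using N fx[OF that] by (rule Y.Cc_real_integrable)
  have iy: "integrable M (\<lambda>x. F x y)" if "y \<in> topspace Y" for y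
    using M fy[OF that] by (rule X.Cc_real_integrable)
  have "(\<lambda>x. \<integral>y. F x y \<partial>N) \<in> Cc_real X"
  proof (rule Cc_realI[OF _ K])
    show "continuous_map X euclideanreal (\<lambda>x. \<integral>y. F x y \<partial>N)"
      using 0 L by (intro Y.continuous_map_integral_parameter[OF N F] exI[of _ "topspace X"] exI[of _ L]) auto
    show "(\<integral>y. F x y \<partial>N) = 0" if "x \<in> topspace X" "x \<notin> K" for x
      using that 0 spN Bochner_Integration.integral_cong[of N N "F x" "\<lambda>_. 0"] by simp
  qed
  then have iN: "integrable M (\<lambda>x. \<integral>y. F x y \<partial>N)"
    using M by (intro X.Cc_real_integrable)
  have F': "continuous_map (prod_topology Y X) euclideanreal (\<lambda>(y, x). F x y)"
    using continuous_map_compose[OF continuous_map_pairedI[OF continuous_map_snd continuous_map_fst] F]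
    by (simp add: o_def case_prod_unfold)
  have "(\<lambda>y. \<integral>x. F x y \<partial>M) \<in> Cc_real Y"
  proof (rule Cc_realI[OF _ L])
    show "continuous_map Y euclideanreal (\<lambda>y. \<integral>x. F x y \<partial>M)"
      using 0 K by (intro X.continuous_map_integral_parameter[OF M F'] exI[of _ "topspace Y"] exI[of _ K]) auto
    show "(\<integral>x. F x y \<partial>M) = 0" if "y \<in> topspace Y" "y \<notin> L" for y
      using that 0 spM Bochner_Integration.integral_cong[of M M "\<lambda>x. F x y" "\<lambda>_. 0"] by simp
  qed
  then have iM: "integrable N (\<lambda>y. \<integral>x. F x y \<partial>M)"
    using N by (intro Y.Cc_real_integrable)
  have main: "\<bar>(\<integral>x. (\<integral>y. F x y \<partial>N) \<partial>M) - (\<integral>y. (\<integral>x. F x y \<partial>M) \<partial>N)\<bar>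
              \<le> e * (2 * measure M K * measure N L)" if e: "0 < e" for e
  proof -
    have "\<exists>U. openin X U \<and> x \<in> U \<and> (\<forall>x'\<in>U. \<forall>y\<in>L. \<bar>F x' y - F x y\<bar> < e)" if "x \<in> K" for x
      using continuous_map_slices_close[OF F L _ e, of x] that KX by (metis subsetD)
    then obtain U where U: "\<And>x. x \<in> K \<Longrightarrow> openin X (U x)" "\<And>x. x \<in> K \<Longrightarrow> x \<in> U x"
      "\<And>x x' y. \<lbrakk>x \<in> K; x' \<in> U x; y \<in> L\<rbrakk> \<Longrightarrow> \<bar>F x' y - F x y\<bar> < e"
      by metis
    obtain \<F> where "finite \<F>" "\<F> \<subseteq> U ` K" "K \<subseteq> \<Union>\<F>"
      using compactinD[OF K, of "U ` K"] U(1,2) by blast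
    then obtain P where P: "finite P" "P \<subseteq> K" "K \<subseteq> (\<Union>p\<in>P. U p)"
      by (metis finite_subset_image)
    obtain p n where p: "P = p ` {i::nat. i < n}"
      using finite_imp_nat_seg_image_inj_on[OF P(1)] by blast
    \<comment> \<open>Making the cover disjoint gives a Borel partition of \<open>K\<close> on whose \<open>i\<close>-th part \<open>F\<close> is close to \<open>F (p i)\<close>.\<close>
    define A where "A i = (if i < n then K \<inter> U (p i) else {})" for i
    define D where "D = disjointed A"
    have pK: "p i \<in> K" if "i < n" for i using P p that by auto
    have DA: "D i \<subseteq> A i" for i unfolding D_def by (rule disjointed_subset)
    have KM: "K \<in> sets M" using M K by (rule X.compactin_sets_radon)
    have AM: "A i \<in> sets M" for i
      using KM U(1) pK by (auto simp: A_def radon_measure_sets[OF M] openin_sets_borel_of)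
    then have DM: "D i \<in> sets M" for i
      unfolding D_def using sets.range_disjointed_sets[of A M] by auto
    have DK: "D i \<subseteq> K" for i using DA[of i] by (auto simp: A_def split: if_splits)
    have iD: "integrable M (indicat_real (D i))" for i
    proof -
      have "emeasure M (D i) \<le> emeasure M K" using DK KM by (intro emeasure_mono)
      also have "\<dots> < \<infinity>" using M K by (rule radon_measure_compact)
      finally show ?thesis using DM by (intro integrable_real_indicator) auto
    qed
    have K_UN: "K = (\<Union>i. D i)"
      unfolding D_def UN_disjointed_eq using P p by (auto simp: A_def split: if_splits)
    define S where "S x y = (\<Sum>i<n. indicator (D i) x * F (p i) y)" for x y
    have S_eq: "S x y = F (p i) y" if "x \<in> D i" "i < n" for x y i
    proof -
      have "S x y = (\<Sum>j<n. if j = i then F (p i) y else 0)"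
        unfolding S_def
      proof (rule sum.cong)
        show "indicator (D j) x * F (p j) y = (if j = i then F (p i) y else 0)" for j
          using that disjoint_family_disjointed[of A] by (auto simp: D_def disjoint_family_on_def indicator_def)
      qed simp
      then show ?thesis using that by simp
    qed
    have S_0: "S x y = 0" if "y \<in> topspace Y" "x \<notin> K \<or> y \<notin> L" for x y
      unfolding S_def
    proof (rule sum.neutral, rule ballI)
      fix i assume "i \<in> {..<n}"
      then have "p i \<in> topspace X" using pK KX by auto
      then show "indicator (D i) x * F (p i) y = 0"
        using that DK[of i] 0[of "p i" y] by (auto simp: indicator_def)
    qed
    have close: "\<bar>F x y - S x y\<bar> \<le> e * indicator K x * indicator L y"
      if x: "x \<in> topspace X" and y: "y \<in> topspace Y" for x y
    proof (cases "x \<in> K \<and> y \<in> L")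
      case True
      then obtain i where i: "x \<in> D i" using K_UN by blast
      then have "x \<in> A i" using DA by blast
      then have "i < n" "x \<in> U (p i)" by (auto simp: A_def split: if_splits)
      then show ?thesis using True U(3)[of "p i" x y] pK S_eq[OF i] by (auto intro: less_imp_le)
    next
      case False
      then show ?thesis using 0[OF x y] S_0[OF y, of x] e by auto
    qed
    define c where "c = (\<Sum>i<n. measure M (D i) * (\<integral>y. F (p i) y \<partial>N))"
    have iSx: "integrable N (S x)" for x
      unfolding S_def using ix pK KX by (intro Bochner_Integration.integrable_sum integrable_mult_right) auto
    have iSy: "integrable M (\<lambda>x. S x y)" for y
      unfolding S_def using iD by (intro Bochner_Integration.integrable_sum integrable_mult_left)
    have S_N: "(\<integral>y. S x y \<partial>N) = (\<Sum>i<n. indicator (D i) x * (\<integral>y. F (p i) y \<partial>N))" for x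
      unfolding S_def using ix pK KX
      by (subst Bochner_Integration.integral_sum) (auto intro!: integrable_mult_right)
    have S_M: "(\<integral>x. S x y \<partial>M) = (\<Sum>i<n. measure M (D i) * F (p i) y)" for y
      unfolding S_def using iD sets.sets_into_space[OF DM]
      by (subst Bochner_Integration.integral_sum) (auto intro!: integrable_mult_left simp: Int_absorb2)
    have iSN: "integrable M (\<lambda>x. \<integral>y. S x y \<partial>N)"
      unfolding S_N using iD by (intro Bochner_Integration.integrable_sum integrable_mult_left)
    have iSM: "integrable N (\<lambda>y. \<integral>x. S x y \<partial>M)"
      unfolding S_M using ix pK KX by (intro Bochner_Integration.integrable_sum integrable_mult_right) auto
    have SNM: "(\<integral>x. (\<integral>y. S x y \<partial>N) \<partial>M) = c"
      unfolding S_N c_def using iD sets.sets_into_space[OF DM]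
      by (subst Bochner_Integration.integral_sum) (auto intro!: integrable_mult_left simp: Int_absorb2)
    have SMN: "(\<integral>y. (\<integral>x. S x y \<partial>M) \<partial>N) = c"
      unfolding S_M c_def using ix pK KX
      by (subst Bochner_Integration.integral_sum) (auto intro!: integrable_mult_right)
    have "\<bar>\<integral>x. (\<integral>y. F x y \<partial>N) - (\<integral>y. S x y \<partial>N) \<partial>M\<bar> \<le> (e * measure N L) * measure M K"
      using M K
    proof (rule X.radon_abs_integral_le)
      fix x assume x: "x \<in> topspace X"
      have "\<bar>\<integral>y. F x y - S x y \<partial>N\<bar> \<le> (e * indicator K x) * measure N L"
        using N L by (rule Y.radon_abs_integral_le) (use ix[OF x] iSx close[OF x] in auto)
      then show "\<bar>(\<integral>y. F x y \<partial>N) - (\<integral>y. S x y \<partial>N)\<bar> \<le> e * measure N L * indicator K x"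
        using ix[OF x] iSx by (simp add: ac_simps)
    qed (use iN iSN in simp)
    then have 1: "\<bar>(\<integral>x. (\<integral>y. F x y \<partial>N) \<partial>M) - c\<bar> \<le> e * measure M K * measure N L"
      using iN iSN by (simp add: SNM ac_simps)
    have "\<bar>\<integral>y. (\<integral>x. F x y \<partial>M) - (\<integral>x. S x y \<partial>M) \<partial>N\<bar> \<le> (e * measure M K) * measure N L"
      using N L
    proof (rule Y.radon_abs_integral_le)
      fix y assume y: "y \<in> topspace Y"
      have "\<bar>\<integral>x. F x y - S x y \<partial>M\<bar> \<le> (e * indicator L y) * measure M K"
        using M K
        by (rule X.radon_abs_integral_le) (use iy[OF y] iSy close[OF _ y] in \<open>auto simp: ac_simps\<close>)
      then show "\<bar>(\<integral>x. F x y \<partial>M) - (\<integral>x. S x y \<partial>M)\<bar> \<le> e * measure M K * indicator L y"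
        using iy[OF y] iSy by (simp add: ac_simps)
    qed (use iM iSM in simp)
    then have 2: "\<bar>(\<integral>y. (\<integral>x. F x y \<partial>M) \<partial>N) - c\<bar> \<le> e * measure M K * measure N L"
      using iM iSM by (simp add: SMN)
    show ?thesis using 1 2 by (simp add: algebra_simps abs_le_iff)
  qed
  have "\<bar>(\<integral>x. (\<integral>y. F x y \<partial>N) \<partial>M) - (\<integral>y. (\<integral>x. F x y \<partial>M) \<partial>N)\<bar> \<le> 0 + e" if e: "0 < e" for e
  proof -
    have "0 \<le> 2 * measure M K * measure N L" by simp
    then have "0 < e / (2 * measure M K * measure N L + 1)" using e by (intro divide_pos_pos) linarith+
    from main[OF this] \<open>0 \<le> 2 * measure M K * measure N L\<close> show ?thesis
      using e by (smt (verit) divide_le_eq mult_left_mono times_divide_eq_left)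
  qed
  then have "\<bar>(\<integral>x. (\<integral>y. F x y \<partial>N) \<partial>M) - (\<integral>y. (\<integral>x. F x y \<partial>M) \<partial>N)\<bar> \<le> 0"
    by (rule field_le_epsilon)
  then show ?thesis by simp
qed

section \<open>Uniqueness of Haar integrals\<close>

context locally_compact_hausdorff_group
begin

sublocale lch_space T
  by standard (rule locally_compact, rule hausdorff)

lemma continuous_map_group_mult:
  assumes "continuous_map Z T f" "continuous_map Z T g"
  shows "continuous_map Z T (\<lambda>z. f z \<otimes> g z)"
  using continuous_map_compose[OF continuous_map_pairedI[OF assms] continuous_mult] by (simp add: o_def)

lemma continuous_map_group_inv:
  assumes "continuous_map Z T f"
  shows "continuous_map Z T (\<lambda>z. inv (f z))"
  using continuous_map_compose[OF assms continuous_inv] by (simp add: o_def)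

lemma continuous_map_left_translation: "g \<in> carrier G \<Longrightarrow> continuous_map T T (\<lambda>x. g \<otimes> x)"
  and continuous_map_right_translation: "g \<in> carrier G \<Longrightarrow> continuous_map T T (\<lambda>x. x \<otimes> g)"
  by (auto intro!: continuous_map_group_mult simp: topspace_eq_carrier)

lemma homeomorphic_maps_right_translation:
  "g \<in> carrier G \<Longrightarrow> homeomorphic_maps T T (\<lambda>x. x \<otimes> g) (\<lambda>x. x \<otimes> inv g)"
  by (auto simp: homeomorphic_maps_def continuous_map_right_translation topspace_eq_carrier m_assoc)

lemma compactin_group_mult:
  assumes K: "compactin T K" and L: "compactin T L"
  shows "compactin T ((\<lambda>(x, y). x \<otimes> y) ` (K \<times> L))"
  by (rule image_compactin[OF _ continuous_mult]) (simp add: compactin_Times K L)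

lemma compactin_group_inv: "compactin T K \<Longrightarrow> compactin T (m_inv G ` K)"
  using continuous_inv image_compactin by blast

lemma Cc_real_translate:
  assumes f: "f \<in> Cc_real T" and g: "g \<in> carrier G"
  shows "(\<lambda>x. f (g \<otimes> x)) \<in> Cc_real T" "(\<lambda>x. f (x \<otimes> g)) \<in> Cc_real T"
proof -
  obtain K where K: "compactin T K" "\<And>x. \<lbrakk>x \<in> topspace T; x \<notin> K\<rbrakk> \<Longrightarrow> f x = 0"
    using f by (meson Cc_realE)
  have 1: "x \<in> (\<lambda>x. inv g \<otimes> x) ` K" if "x \<in> topspace T" "g \<otimes> x \<in> K" for x
    using g that by (intro image_eqI[of x _ "g \<otimes> x"]) (auto simp: m_assoc[symmetric] topspace_eq_carrier)
  have 2: "x \<in> (\<lambda>x. x \<otimes> inv g) ` K" if "x \<in> topspace T" "x \<otimes> g \<in> K" for x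
    using g that by (intro image_eqI[of x _ "x \<otimes> g"]) (auto simp: m_assoc topspace_eq_carrier)
  show "(\<lambda>x. f (g \<otimes> x)) \<in> Cc_real T"
    using Cc_real_compose[OF f continuous_map_left_translation[OF g] K
        image_compactin[OF K(1) continuous_map_left_translation[OF inv_closed[OF g]]]] 1 by blast
  show "(\<lambda>x. f (x \<otimes> g)) \<in> Cc_real T"
    using Cc_real_compose[OF f continuous_map_right_translation[OF g] K
        image_compactin[OF K(1) continuous_map_right_translation[OF inv_closed[OF g]]]] 2 by blast
qed

lemma Cc_real_group_inv:
  assumes f: "f \<in> Cc_real T"
  shows "(\<lambda>x. f (inv x)) \<in> Cc_real T"
proof -
  obtain K where K: "compactin T K" "\<And>x. \<lbrakk>x \<in> topspace T; x \<notin> K\<rbrakk> \<Longrightarrow> f x = 0"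
    using f by (meson Cc_realE)
  have "x \<in> m_inv G ` K" if "x \<in> topspace T" "inv x \<in> K" for x
    using that by (intro image_eqI[of x _ "inv x"]) (auto simp: topspace_eq_carrier)
  then show ?thesis
    using Cc_real_compose[OF f continuous_inv K compactin_group_inv[OF K(1)]] by blast
qed

lemma haar_radon: "left_haar_measure G T M \<Longrightarrow> radon_measure T M"
  by (simp add: left_haar_measure_def)

lemma haar_open_pos: "\<lbrakk>left_haar_measure G T M; openin T U; U \<noteq> {}\<rbrakk> \<Longrightarrow> emeasure M U \<noteq> 0"
  by (auto simp: left_haar_measure_def)

lemma haar_integral_left_translate:
  fixes f :: "'a \<Rightarrow> 'e::{banach, second_countable_topology}"
  assumes M: "left_haar_measure G T M" and g: "g \<in> carrier G" and f: "f \<in> borel_measurable M"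
  shows "(\<integral>x. f (g \<otimes> x) \<partial>M) = (\<integral>x. f x \<partial>M)"
proof -
  have sp: "space M = carrier G"
    using haar_radon[OF M] radon_measure_space topspace_eq_carrier by metis
  have tm: "(\<lambda>x. g \<otimes> x) \<in> measurable M M"
    using haar_radon[OF M] continuous_map_left_translation[OF g]
    by (rule radon_measure_continuous_measurable)
  have "distr M M (\<lambda>x. g \<otimes> x) = M"
  proof (rule measure_eqI)
    fix E assume "E \<in> sets (distr M M (\<lambda>x. g \<otimes> x))"
    then have E: "E \<in> sets M" "E \<subseteq> carrier G" using sets.sets_into_space sp by fastforce+
    have "(\<lambda>x. g \<otimes> x) -` E \<inter> space M = inv g <# E"
    proof (intro Set.set_eqI iffI)
      fix x assume x: "x \<in> (\<lambda>x. g \<otimes> x) -` E \<inter> space M"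
      then have "x = inv g \<otimes> (g \<otimes> x)" using g by (simp add: sp m_assoc[symmetric])
      then show "x \<in> inv g <# E" using x by (auto simp: l_coset_def)
    next
      fix x assume "x \<in> inv g <# E"
      then show "x \<in> (\<lambda>x. g \<otimes> x) -` E \<inter> space M"
        using g E(2) by (auto simp: l_coset_def sp m_assoc[symmetric] subset_iff)
    qed
    then show "emeasure (distr M M (\<lambda>x. g \<otimes> x)) E = emeasure M E"
      using M E g by (simp add: emeasure_distr[OF tm] left_haar_measure_def)
  qed simp
  then show ?thesis using integral_distr[OF tm f] by simp
qed

text \<open>Invariance is required of integrals only, because this is what a measure that represents an invariant
functional satisfies by construction.\<close>

definition left_invariant_integral :: "'a measure \<Rightarrow> bool" where
  "left_invariant_integral N \<longleftrightarrow> radon_measure T N \<and>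
     (\<forall>g\<in>carrier G. \<forall>f\<in>Cc_real T. (\<integral>x. f (g \<otimes> x) \<partial>N) = (\<integral>x. f x \<partial>N))"

lemma haar_left_invariant_integral:
  "left_haar_measure G T M \<Longrightarrow> left_invariant_integral M"
  using haar_integral_left_translate haar_radon radon_measure_measurable Cc_real_continuous
  unfolding left_invariant_integral_def by metis

lemma haar_test_function:
  assumes "left_haar_measure G T M"
  obtains f where "f \<in> Cc_real T" "\<And>x. x \<in> carrier G \<Longrightarrow> 0 \<le> f x" "f \<one> = 1" "0 < (\<integral>x. f x \<partial>M)"
proof -
  have "compactin T {\<one>}" "{\<one>} \<subseteq> topspace T" by (auto simp: topspace_eq_carrier)
  then obtain f where f: "f \<in> subordinate T (topspace T)" "f \<one> = 1"
    using subordinate_Urysohn[OF _ openin_topspace] by (metis insertI1)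
  then have "0 < (\<integral>x. f x \<partial>M)"
    using assms by (intro radon_integral_pos[where x="\<one>"])
      (auto simp: haar_radon haar_open_pos topspace_eq_carrier dest: subordinateD)
  then show ?thesis
    using f(2) subordinateD(1,2)[OF f(1)] that[of f] by (auto simp: topspace_eq_carrier)
qed

text \<open>For \<open>s\<close> in a compact set \<open>C\<close>, the integrand can be non-zero only for \<open>t\<close> in the compact set \<open>K C\<inverse>\<close>, where
\<open>K\<close> carries \<open>f\<close>.\<close>

lemma continuous_right_translate_integral:
  assumes N: "radon_measure T N" and f: "f \<in> Cc_real T"
  shows "continuous_map T euclideanreal (\<lambda>s. \<integral>t. f (t \<otimes> s) \<partial>N)"
proof (rule continuous_map_integral_parameter[OF N])
  obtain K where K: "compactin T K" "\<And>x. \<lbrakk>x \<in> topspace T; x \<notin> K\<rbrakk> \<Longrightarrow> f x = 0"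
    using f by (meson Cc_realE)
  show "continuous_map (prod_topology T T) euclideanreal (\<lambda>(s, t). f (t \<otimes> s))"
    unfolding case_prod_unfold
    by (intro continuous_map_compose_fun[OF Cc_real_continuous[OF f]] continuous_map_group_mult
        continuous_map_fst continuous_map_snd)
  fix s assume "s \<in> topspace T"
  then obtain U C where U: "openin T U" "compactin T C" "s \<in> U" "U \<subseteq> C"
    using locally_compact by (auto simp: locally_compact_space_def)
  let ?L = "(\<lambda>(x, y). x \<otimes> y) ` (K \<times> m_inv G ` C)"
  have "f (t \<otimes> s') = 0" if "s' \<in> U" "t \<in> topspace T - ?L" for s' t
  proof (rule ccontr)
    assume nz: "f (t \<otimes> s') \<noteq> 0"
    have c: "s' \<in> carrier G" "t \<in> carrier G"
      using that openin_subset[OF U(1)] by (auto simp: topspace_eq_carrier)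
    then have "t \<otimes> s' \<in> K" using nz K(2) by (auto simp: topspace_eq_carrier)
    moreover have "t = t \<otimes> s' \<otimes> inv s'" using c by (simp add: m_assoc)
    ultimately have "t \<in> ?L" using that(1) U(4) by force
    then show False using that by simp
  qed
  then show "\<exists>U L. openin T U \<and> s \<in> U \<and> compactin T L \<and> (\<forall>s'\<in>U. \<forall>t\<in>topspace T - L. f (t \<otimes> s') = 0)"
    using U compactin_group_mult[OF K(1) compactin_group_inv[OF U(2)]] by blast
qed

text \<open>By invariance of \<open>N\<close> the left side is the double integral of \<open>f(s) k(s\<inverse> t)\<close>. Exchanging the order of
integration and replacing \<open>s\<close> by \<open>t s\<close>, by invariance of \<open>M\<close>, turns the integrand into
\<open>f(t s) k(s\<inverse>)\<close>. The left side depends on \<open>f\<close> only through its integral against \<open>M\<close>, so the same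
holds for the right side. This is the source of all uniqueness statements.\<close>

lemma haar_integral_product:
  assumes M: "left_haar_measure G T M" and N: "left_invariant_integral N"
    and f: "f \<in> Cc_real T" and k: "k \<in> Cc_real T"
  shows "(\<integral>s. f s \<partial>M) * (\<integral>t. k t \<partial>N) = (\<integral>s. (\<integral>t. f (t \<otimes> s) \<partial>N) * k (inv s) \<partial>M)"
proof -
  have RM: "radon_measure T M" and RN: "radon_measure T N"
    using M N by (auto simp: left_invariant_integral_def haar_radon)
  have spM: "space M = carrier G" and spN: "space N = carrier G"
    using RM RN radon_measure_space topspace_eq_carrier by metis+
  obtain K where K: "compactin T K" "\<And>x. \<lbrakk>x \<in> topspace T; x \<notin> K\<rbrakk> \<Longrightarrow> f x = 0"
    using f by (meson Cc_realE)
  obtain L where L: "compactin T L" "\<And>x. \<lbrakk>x \<in> topspace T; x \<notin> L\<rbrakk> \<Longrightarrow> k x = 0"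
    using k by (meson Cc_realE)
  let ?KL = "(\<lambda>(x, y). x \<otimes> y) ` (K \<times> L)"
  have KL: "compactin T ?KL" using K(1) L(1) by (rule compactin_group_mult)
  have lch: "lch_space T" by unfold_locales
  note cont = continuous_map_compose_fun[OF Cc_real_continuous[OF f]]
    continuous_map_compose_fun[OF Cc_real_continuous[OF k]]
  have "(\<integral>s. f s \<partial>M) * (\<integral>t. k t \<partial>N) = (\<integral>s. f s * (\<integral>t. k t \<partial>N) \<partial>M)" by simp
  also have "\<dots> = (\<integral>s. (\<integral>t. f s * k (inv s \<otimes> t) \<partial>N) \<partial>M)"
  proof (rule Bochner_Integration.integral_cong)
    fix s assume "s \<in> space M"
    then have "(\<integral>t. k (inv s \<otimes> t) \<partial>N) = (\<integral>t. k t \<partial>N)"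
      using N k by (simp add: spM left_invariant_integral_def)
    then show "f s * (\<integral>t. k t \<partial>N) = (\<integral>t. f s * k (inv s \<otimes> t) \<partial>N)" by simp
  qed simp
  also have "\<dots> = (\<integral>t. (\<integral>s. f s * k (inv s \<otimes> t) \<partial>M) \<partial>N)"
    using lch lch RM RN _ K(1) KL
  proof (rule radon_Fubini)
    show "continuous_map (prod_topology T T) euclideanreal (\<lambda>(s, t). f s * k (inv s \<otimes> t))"
      unfolding case_prod_unfold
      by (intro continuous_map_real_mult cont continuous_map_group_mult continuous_map_group_inv
          continuous_map_fst continuous_map_snd)
    fix s t assume st: "s \<in> topspace T" "t \<in> topspace T" "s \<notin> K \<or> t \<notin> ?KL"
    show "f s * k (inv s \<otimes> t) = 0"
    proof (rule ccontr)
      assume "f s * k (inv s \<otimes> t) \<noteq> 0"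
      then have "s \<in> K" "inv s \<otimes> t \<in> L" using st K(2) L(2) by (auto simp: topspace_eq_carrier)
      moreover have "t = s \<otimes> (inv s \<otimes> t)"
        using st by (simp add: topspace_eq_carrier m_assoc[symmetric])
      ultimately show False using st by force
    qed
  qed
  also have "\<dots> = (\<integral>t. (\<integral>s. f (t \<otimes> s) * k (inv s) \<partial>M) \<partial>N)"
  proof (rule Bochner_Integration.integral_cong)
    fix t assume "t \<in> space N"
    then have t: "t \<in> carrier G" by (simp add: spN)
    have "continuous_map T euclideanreal (\<lambda>s. f s * k (inv s \<otimes> t))"
      using t by (intro continuous_map_real_mult cont continuous_map_group_mult continuous_map_group_inv)
        (auto simp: topspace_eq_carrier Cc_real_continuous[OF f])
    then have "(\<integral>s. f s * k (inv s \<otimes> t) \<partial>M) = (\<integral>s. f (t \<otimes> s) * k (inv (t \<otimes> s) \<otimes> t) \<partial>M)"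
      using M t RM by (intro haar_integral_left_translate[symmetric] radon_measure_measurable)
    also have "\<dots> = (\<integral>s. f (t \<otimes> s) * k (inv s) \<partial>M)"
      using t by (intro Bochner_Integration.integral_cong) (auto simp: spM inv_mult_group m_assoc)
    finally show "(\<integral>s. f s * k (inv s \<otimes> t) \<partial>M) = (\<integral>s. f (t \<otimes> s) * k (inv s) \<partial>M)" .
  qed simp
  also have "\<dots> = (\<integral>s. (\<integral>t. f (t \<otimes> s) * k (inv s) \<partial>N) \<partial>M)"
    using lch lch RN RM _ KL compactin_group_inv[OF L(1)]
  proof (rule radon_Fubini)
    show "continuous_map (prod_topology T T) euclideanreal (\<lambda>(t, s). f (t \<otimes> s) * k (inv s))"
      unfolding case_prod_unfold
      by (intro continuous_map_real_mult cont continuous_map_group_mult continuous_map_group_inv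
          continuous_map_fst continuous_map_snd)
    fix t s assume st: "t \<in> topspace T" "s \<in> topspace T" "t \<notin> ?KL \<or> s \<notin> m_inv G ` L"
    show "f (t \<otimes> s) * k (inv s) = 0"
    proof (rule ccontr)
      assume "f (t \<otimes> s) * k (inv s) \<noteq> 0"
      then have "t \<otimes> s \<in> K" "inv s \<in> L" using st K(2) L(2) by (auto simp: topspace_eq_carrier)
      moreover have "t = (t \<otimes> s) \<otimes> inv s" "s = inv (inv s)"
        using st by (simp_all add: topspace_eq_carrier m_assoc)
      ultimately show False using st by force
    qed
  qed
  finally show ?thesis by simp
qed

text \<open>Test against \<open>k = f D\<close> for a bump function \<open>f\<close> at \<open>x\<close>: the integrand \<open>f D\<^sup>2\<close> would have positive integral.\<close>

lemma haar_orthogonal_imp_zero: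
  assumes M: "left_haar_measure G T M" and D: "continuous_map T euclideanreal D"
    and 0: "\<And>k. k \<in> Cc_real T \<Longrightarrow> (\<integral>s. D s * k s \<partial>M) = 0" and x: "x \<in> carrier G"
  shows "D x = 0"
proof (rule ccontr)
  assume nz: "D x \<noteq> 0"
  have "compactin T {x}" "{x} \<subseteq> topspace T" using x by (auto simp: topspace_eq_carrier)
  then obtain f where f: "f \<in> subordinate T (topspace T)" "f x = 1"
    using subordinate_Urysohn[OF _ openin_topspace] by (metis insertI1)
  have k: "(\<lambda>s. f s * D s) \<in> Cc_real T"
    using D subordinateD(1)[OF f(1)] by (intro Cc_real_mult)
  have "0 < (\<integral>s. D s * (f s * D s) \<partial>M)"
  proof (rule radon_integral_pos[where x=x])
    show "radon_measure T M" using M by (rule haar_radon)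
    show "(\<lambda>s. D s * (f s * D s)) \<in> Cc_real T" using k D by (rule Cc_real_mult)
    show "0 \<le> D s * (f s * D s)" if "s \<in> topspace T" for s
      using mult_nonneg_nonneg[OF subordinateD(2)[OF f(1) that] zero_le_square[of "D s"]]
      by (simp add: ac_simps)
    show "0 < D x * (f x * D x)" using nz f(2) by (auto simp: zero_less_mult_iff neq_iff)
  qed (use x M in \<open>auto simp: topspace_eq_carrier haar_open_pos\<close>)
  then show False using 0[OF k] by simp
qed

text \<open>Multiply \<open>haar_integral_product\<close> for \<open>f2\<close> by the integral of \<open>f1\<close> and vice versa. The results are equal, so the
difference of the two sides of the claim, a continuous function of \<open>s\<close>, is orthogonal to all test
functions. At \<open>s = \<one>\<close> the claim compares \<open>M\<close> with \<open>N\<close>; for \<open>N = M\<close> it says that a right translation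
multiplies all integrals by the same factor.\<close>

lemma haar_proportional:
  assumes M: "left_haar_measure G T M" and N: "left_invariant_integral N"
    and f1: "f1 \<in> Cc_real T" and f2: "f2 \<in> Cc_real T" and s: "s \<in> carrier G"
  shows "(\<integral>x. f1 x \<partial>M) * (\<integral>t. f2 (t \<otimes> s) \<partial>N) = (\<integral>x. f2 x \<partial>M) * (\<integral>t. f1 (t \<otimes> s) \<partial>N)"
proof -
  have RM: "radon_measure T M" and RN: "radon_measure T N"
    using M N by (auto simp: left_invariant_integral_def haar_radon)
  let ?D = "\<lambda>f s. \<integral>t. f (t \<otimes> s) \<partial>N"
  let ?d = "\<lambda>s. (\<integral>x. f1 x \<partial>M) * ?D f2 s - (\<integral>x. f2 x \<partial>M) * ?D f1 s"
  have cont: "continuous_map T euclideanreal (?D f1)" "continuous_map T euclideanreal (?D f2)"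
    using RN f1 f2 by (auto intro: continuous_right_translate_integral)
  have "?d s = 0"
  proof (rule haar_orthogonal_imp_zero[OF M _ _ s])
    show "continuous_map T euclideanreal ?d"
      by (intro continuous_map_diff continuous_map_real_mult_left cont)
    fix k assume "k \<in> Cc_real T"
    then have k': "(\<lambda>x. k (inv x)) \<in> Cc_real T" by (rule Cc_real_group_inv)
    have spM: "space M = carrier G" using RM radon_measure_space topspace_eq_carrier by metis
    have *: "(\<integral>x. f x \<partial>M) * (\<integral>t. k (inv t) \<partial>N) = (\<integral>s. ?D f s * k s \<partial>M)" if "f \<in> Cc_real T" for f
      unfolding haar_integral_product[OF M N that k']
      by (rule Bochner_Integration.integral_cong) (auto simp: spM)
    have int: "integrable M (\<lambda>s. ?D f1 s * k s)" "integrable M (\<lambda>s. ?D f2 s * k s)"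
      using \<open>k \<in> Cc_real T\<close> cont RM by (auto intro!: Cc_real_integrable Cc_real_mult)
    have "(\<integral>s. ?d s * k s \<partial>M) = (\<integral>s. (\<integral>x. f1 x \<partial>M) * (?D f2 s * k s) - (\<integral>x. f2 x \<partial>M) * (?D f1 s * k s) \<partial>M)"
      by (simp add: algebra_simps)
    also have "\<dots> = (\<integral>x. f1 x \<partial>M) * (\<integral>s. ?D f2 s * k s \<partial>M) - (\<integral>x. f2 x \<partial>M) * (\<integral>s. ?D f1 s * k s \<partial>M)"
      using int by simp
    also have "\<dots> = 0" using *[OF f1] *[OF f2] by (simp flip: *[OF f1] *[OF f2])
    finally show "(\<integral>s. ?d s * k s \<partial>M) = 0" .
  qed
  then show ?thesis by simp
qed

text \<open>The functional is integration against a Radon measure, by the Riesz theorem, so \<open>haar_proportional\<close> applies with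
\<open>s = \<one>\<close>.\<close>

lemma invariant_functional_proportional:
  assumes M: "left_haar_measure G T M" and I: "positive_linear_functional T I"
    and inv: "\<And>g f. \<lbrakk>g \<in> carrier G; f \<in> Cc_real T\<rbrakk> \<Longrightarrow> I (\<lambda>x. f (g \<otimes> x)) = I f"
  obtains c where "0 \<le> c" "\<And>f. f \<in> Cc_real T \<Longrightarrow> I f = c * (\<integral>x. f x \<partial>M)"
proof -
  obtain N where N: "radon_measure T N" "\<And>f. f \<in> Cc_real T \<Longrightarrow> (\<integral>x. f x \<partial>N) = I f"
    using riesz_representation[OF locally_compact hausdorff I] by metis
  have inv_N: "left_invariant_integral N"
    using N inv Cc_real_translate(1) by (simp add: left_invariant_integral_def)
  obtain k where k: "k \<in> Cc_real T" "\<And>x. x \<in> carrier G \<Longrightarrow> 0 \<le> k x" "0 < (\<integral>x. k x \<partial>M)"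
    using haar_test_function[OF M] by metis
  have spN: "space N = carrier G" using N radon_measure_space topspace_eq_carrier by metis
  have N1: "(\<integral>t. f (t \<otimes> \<one>) \<partial>N) = I f" if "f \<in> Cc_real T" for f
    unfolding N(2)[OF that, symmetric]
    by (intro Bochner_Integration.integral_cong) (auto simp: spN)
  show ?thesis
  proof
    show "0 \<le> I k / (\<integral>x. k x \<partial>M)"
      using k I by (auto simp: positive_linear_functional_def topspace_eq_carrier)
    show "I f = I k / (\<integral>x. k x \<partial>M) * (\<integral>x. f x \<partial>M)" if f: "f \<in> Cc_real T" for f
      using haar_proportional[OF M inv_N k(1) f one_closed] k(3) by (simp add: N1 f k(1) field_simps)
  qed
qed

lemma haar_measure_unique:
  assumes M: "left_haar_measure G T M" and N: "left_haar_measure G T N"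
  obtains c where "0 < c" "N = scale_measure (ennreal c) M"
proof -
  note RM = haar_radon[OF M] and RN = haar_radon[OF N]
  obtain k where k: "k \<in> Cc_real T" "\<And>x. x \<in> carrier G \<Longrightarrow> 0 \<le> k x" "k \<one> = 1" "0 < (\<integral>x. k x \<partial>M)"
    using haar_test_function[OF M] by metis
  have "0 < (\<integral>x. k x \<partial>N)"
    using k RN N by (intro radon_integral_pos[where x="\<one>"]) (auto simp: topspace_eq_carrier haar_open_pos)
  define c where "c = (\<integral>x. k x \<partial>N) / (\<integral>x. k x \<partial>M)"
  have c: "0 < c" using k \<open>0 < (\<integral>x. k x \<partial>N)\<close> by (simp add: c_def)
  have spN: "space N = carrier G" using RN radon_measure_space topspace_eq_carrier by metis
  have N1: "(\<integral>t. f (t \<otimes> \<one>) \<partial>N) = (\<integral>t. f t \<partial>N)" for f :: "'a \<Rightarrow> real"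
    by (intro Bochner_Integration.integral_cong) (auto simp: spN)
  have "N = scale_measure (ennreal c) M"
  proof (rule radon_measure_eqI[OF RN radon_measure_scale[OF RM c]])
    fix f assume f: "f \<in> Cc_real T" 
    have "(\<integral>x. f x \<partial>N) = c * (\<integral>x. f x \<partial>M)"
      using haar_proportional[OF M haar_left_invariant_integral[OF N] k(1) f one_closed] k(4)
      by (simp add: N1 c_def field_simps)
    then show "(\<integral>x. f x \<partial>N) = (\<integral>x. f x \<partial>scale_measure (ennreal c) M)"
      using c radon_measure_measurable[OF RM Cc_real_continuous[OF f]] by (simp add: integral_scale_measure)
  qed
  then show ?thesis using c that by blast
qed

end

section \<open>The modular function\<close>

context locally_compact_hausdorff_group
begin

text \<open>The factor is the one by which right translation multiplies integrals, according to \<open>haar_proportional\<close>.\<close>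

lemma haar_distr_right_translation:
  assumes M: "left_haar_measure G T M" and s: "s \<in> carrier G"
  obtains r where "0 < r" "distr M M (\<lambda>x. x \<otimes> s) = scale_measure (ennreal r) M"
proof -
  note RM = haar_radon[OF M]
  obtain k where k: "k \<in> Cc_real T" "\<And>x. x \<in> carrier G \<Longrightarrow> 0 \<le> k x" "k \<one> = 1" "0 < (\<integral>x. k x \<partial>M)"
    using haar_test_function[OF M] by metis
  have "0 < (\<integral>x. k (x \<otimes> s) \<partial>M)"
    using RM haar_open_pos[OF M] Cc_real_translate(2)[OF k(1) s]
    by (rule radon_integral_pos[where x="inv s"]) (use k s in \<open>auto simp: topspace_eq_carrier\<close>)
  define r where "r = (\<integral>x. k (x \<otimes> s) \<partial>M) / (\<integral>x. k x \<partial>M)"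
  have r: "0 < r" using k \<open>0 < (\<integral>x. k (x \<otimes> s) \<partial>M)\<close> by (simp add: r_def)
  have hom: "homeomorphic_maps T T (\<lambda>x. x \<otimes> s) (\<lambda>x. x \<otimes> inv s)"
    using s by (rule homeomorphic_maps_right_translation)
  have tm: "(\<lambda>x. x \<otimes> s) \<in> measurable M M"
    using RM continuous_map_right_translation[OF s] by (rule radon_measure_continuous_measurable)
  have "distr M M (\<lambda>x. x \<otimes> s) = scale_measure (ennreal r) M"
  proof (rule radon_measure_eqI[OF radon_measure_distr(1)[OF RM hom] radon_measure_scale[OF RM r]])
    fix f assume f: "f \<in> Cc_real T"
    then have fm: "f \<in> borel_measurable M"
      using RM by (intro radon_measure_measurable Cc_real_continuous)
    have "(\<integral>x. f (x \<otimes> s) \<partial>M) = r * (\<integral>x. f x \<partial>M)"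
      using haar_proportional[OF M haar_left_invariant_integral[OF M] k(1) f s] k(4)
      by (simp add: r_def field_simps)
    then show "(\<integral>x. f x \<partial>distr M M (\<lambda>x. x \<otimes> s)) = (\<integral>x. f x \<partial>scale_measure (ennreal r) M)"
      using r fm by (simp add: integral_distr[OF tm fm] integral_scale_measure)
  qed
  then show ?thesis using r that by blast
qed

lemma haar_finite_pos_set:
  assumes M: "left_haar_measure G T M"
  obtains U where "U \<in> sets M" "emeasure M U \<noteq> 0" "emeasure M U \<noteq> \<infinity>"
proof -
  note RM = haar_radon[OF M]
  have "\<one> \<in> topspace T" by (simp add: topspace_eq_carrier)
  then obtain U C where U: "openin T U" "compactin T C" "\<one> \<in> U" "U \<subseteq> C"
    using locally_compact unfolding locally_compact_space_def by meson
  have "emeasure M U \<le> emeasure M C"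
    using U RM by (intro emeasure_mono compactin_sets_radon)
  also have "\<dots> < \<infinity>" using RM U(2) by (rule radon_measure_compact)
  finally have "emeasure M U \<noteq> \<infinity>" by simp
  moreover have "emeasure M U \<noteq> 0" using haar_open_pos[OF M U(1)] U(3) by blast
  moreover have "U \<in> sets M" using RM U by (simp add: radon_measure_sets openin_sets_borel_of)
  ultimately show ?thesis using that by blast
qed

text \<open>The definition of the modular function speaks of all left Haar measures. They are multiples of \<open>M\<close>, so
one of them decides; and a set of finite non-zero measure determines the factor.\<close>

lemma modular_function_eqI:
  assumes M: "left_haar_measure G T M" and g: "g \<in> carrier G" and r: "0 < r"
    and eq: "\<And>E. E \<in> sets M \<Longrightarrow> emeasure M (E #> g) = ennreal r * emeasure M E"
  shows "modular_function G T g = r"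
  unfolding modular_function_def
proof (rule the_equality, intro conjI allI impI ballI)
  fix N E assume N: "left_haar_measure G T N" and E: "E \<in> sets N"
  obtain c where "N = scale_measure (ennreal c) M"
    using haar_measure_unique[OF M N] by metis
  then show "emeasure N (E #> g) = ennreal r * emeasure N E"
    using E eq by (simp add: mult.left_commute)
next
  fix r' assume r': "0 < r' \<and> (\<forall>N. left_haar_measure G T N \<longrightarrow>
    (\<forall>E\<in>sets N. emeasure N (E #> g) = ennreal r' * emeasure N E))"
  obtain U where U: "U \<in> sets M" "emeasure M U \<noteq> 0" "emeasure M U \<noteq> \<infinity>"
    using haar_finite_pos_set[OF M] by metis
  have "emeasure M U * ennreal r' = emeasure M U * ennreal r"
    using r' M U(1) eq by (simp add: mult.commute)
  then have "ennreal r' = ennreal r"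
    using U by (simp add: ennreal_mult_cancel_left)
  then show "r' = r" using r r' by simp
qed (rule r)

lemma
  assumes M: "left_haar_measure G T M" and g: "g \<in> carrier G"
  shows modular_function_pos: "0 < modular_function G T g"
    and distr_right_translation_modular:
      "distr M M (\<lambda>x. x \<otimes> inv g) = scale_measure (ennreal (modular_function G T g)) M"
proof -
  obtain r where r: "0 < r" "distr M M (\<lambda>x. x \<otimes> inv g) = scale_measure (ennreal r) M"
    using haar_distr_right_translation[OF M inv_closed[OF g]] by metis
  have "modular_function G T g = r"
  proof (rule modular_function_eqI[OF M g r(1)])
    fix E assume E: "E \<in> sets M"
    have "E #> g = (\<lambda>x. x \<otimes> inv (inv g)) ` E" using g by (auto simp: r_coset_def)
    then have "emeasure M (E #> g) = emeasure (distr M M (\<lambda>x. x \<otimes> inv g)) E"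
      using radon_measure_distr(2)[OF haar_radon[OF M]
          homeomorphic_maps_right_translation[OF inv_closed[OF g]] E] by simp
    then show "emeasure M (E #> g) = ennreal r * emeasure M E" by (simp add: r(2))
  qed
  then show "0 < modular_function G T g"
    "distr M M (\<lambda>x. x \<otimes> inv g) = scale_measure (ennreal (modular_function G T g)) M"
    using r by simp_all
qed

text \<open>The inverse appears because the indicator function of \<open>E\<close>, translated by \<open>g\<close>, is that of \<open>E g\<inverse>\<close>.\<close>

lemma haar_integral_right_translate:
  assumes M: "left_haar_measure G T M" and g: "g \<in> carrier G" and f: "f \<in> Cc_real T"
  shows "(\<integral>x. f (x \<otimes> g) \<partial>M) = modular_function G T (inv g) * (\<integral>x. f x \<partial>M)"
proof -
  note RM = haar_radon[OF M]
  have fm: "f \<in> borel_measurable M"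
    using RM f by (intro radon_measure_measurable Cc_real_continuous)
  have tm: "(\<lambda>x. x \<otimes> g) \<in> measurable M M"
    using RM continuous_map_right_translation[OF g] by (rule radon_measure_continuous_measurable)
  have "(\<integral>x. f (x \<otimes> g) \<partial>M) = (\<integral>x. f x \<partial>distr M M (\<lambda>x. x \<otimes> g))"
    by (rule integral_distr[OF tm fm, symmetric])
  also have "\<dots> = (\<integral>x. f x \<partial>scale_measure (ennreal (modular_function G T (inv g))) M)"
    using distr_right_translation_modular[OF M inv_closed[OF g]] g by simp
  also have "\<dots> = modular_function G T (inv g) * (\<integral>x. f x \<partial>M)"
    using fm modular_function_pos[OF M inv_closed[OF g]] by (simp add: integral_scale_measure)
  finally show ?thesis .
qed

lemma continuous_modular_inverse:
  assumes M: "left_haar_measure G T M"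
  shows "continuous_map T euclideanreal (\<lambda>s. modular_function G T (inv s))"
proof -
  obtain k where k: "k \<in> Cc_real T" "0 < (\<integral>x. k x \<partial>M)"
    using haar_test_function[OF M] by metis
  show ?thesis
  proof (rule continuous_map_eq)
    show "continuous_map T euclideanreal (\<lambda>s. (\<integral>x. k (x \<otimes> s) \<partial>M) / (\<integral>x. k x \<partial>M))"
      using k by (intro continuous_map_real_divide continuous_right_translate_integral haar_radon[OF M]) auto
    show "(\<integral>x. k (x \<otimes> s) \<partial>M) / (\<integral>x. k x \<partial>M) = modular_function G T (inv s)" if "s \<in> topspace T" for s
      using haar_integral_right_translate[OF M _ k(1)] that k(2) by (simp add: topspace_eq_carrier)
  qed
qed

text \<open>In \<open>haar_integral_product\<close> with \<open>N = M\<close>, the inner integral is the modular factor times the integral of \<open>f\<close>,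
which cancels.\<close>

lemma haar_integral_inverse:
  assumes M: "left_haar_measure G T M" and k: "k \<in> Cc_real T"
  shows "(\<integral>x. k x \<partial>M) = (\<integral>x. modular_function G T (inv x) * k (inv x) \<partial>M)"
proof -
  obtain f where f: "f \<in> Cc_real T" "0 < (\<integral>x. f x \<partial>M)"
    using haar_test_function[OF M] by metis
  have sp: "space M = carrier G"
    using haar_radon[OF M] radon_measure_space topspace_eq_carrier by metis
  have "(\<integral>x. f x \<partial>M) * (\<integral>x. k x \<partial>M) = (\<integral>s. (\<integral>t. f (t \<otimes> s) \<partial>M) * k (inv s) \<partial>M)"
    using haar_integral_product[OF M haar_left_invariant_integral[OF M] f(1) k] .
  also have "\<dots> = (\<integral>s. (\<integral>x. f x \<partial>M) * (modular_function G T (inv s) * k (inv s)) \<partial>M)"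
    by (rule Bochner_Integration.integral_cong)
      (simp_all add: sp haar_integral_right_translate[OF M _ f(1)])
  also have "\<dots> = (\<integral>x. f x \<partial>M) * (\<integral>x. modular_function G T (inv x) * k (inv x) \<partial>M)"
    by simp
  finally show ?thesis using f(2) by simp
qed

end

section \<open>The space of cosets\<close>

locale closed_subgroup = locally_compact_hausdorff_group +
  fixes H
  assumes H: "subgroup H G" and closed_H: "closedin T H"
begin

lemma H_carrier: "h \<in> H \<Longrightarrow> h \<in> carrier G"
  by (rule subgroup.mem_carrier[OF H])

lemma H_inv: "h \<in> H \<Longrightarrow> inv h \<in> H" and H_one: "\<one> \<in> H"
  and H_mult: "\<lbrakk>h \<in> H; k \<in> H\<rbrakk> \<Longrightarrow> h \<otimes> k \<in> H"
  by (rule subgroup.m_inv_closed[OF H], assumption, rule subgroup.one_closed[OF H],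
      rule subgroup.m_closed[OF H])

lemma topspace_Int_H: "topspace T \<inter> H = H"
  by (rule Int_absorb1[OF closedin_subset[OF closed_H]])

lemma subgroup_inv_eq: "h \<in> H \<Longrightarrow> inv\<^bsub>G\<lparr>carrier := H\<rparr>\<^esub> h = inv h"
  using H by (rule m_inv_consistent)

sublocale sub: locally_compact_hausdorff_group "G\<lparr>carrier := H\<rparr>" "subtopology T H"
proof (intro locally_compact_hausdorff_group.intro topological_group.intro
    topological_group_axioms.intro locally_compact_hausdorff_group_axioms.intro)
  show "group (G\<lparr>carrier := H\<rparr>)" using H is_group by (rule subgroup.subgroup_is_group)
  show "topspace (subtopology T H) = carrier (G\<lparr>carrier := H\<rparr>)"
    by (simp add: topspace_Int_H)
  have "continuous_map (prod_topology (subtopology T H) (subtopology T H)) T (\<lambda>p. fst p \<otimes> snd p)"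
    by (intro continuous_map_group_mult continuous_map_into_fulltopology[OF continuous_map_fst]
        continuous_map_into_fulltopology[OF continuous_map_snd])
  then show "continuous_map (prod_topology (subtopology T H) (subtopology T H)) (subtopology T H)
      (\<lambda>(x, y). x \<otimes>\<^bsub>G\<lparr>carrier := H\<rparr>\<^esub> y)"
    unfolding continuous_map_in_subtopology case_prod_unfold
    by (simp add: topspace_Int_H Pi_iff H_mult)
  have "continuous_map (subtopology T H) (subtopology T H) (\<lambda>x. inv x)"
    using continuous_map_from_subtopology[OF continuous_inv, of H]
    unfolding continuous_map_in_subtopology by (simp add: topspace_Int_H Pi_iff H_inv)
  then show "continuous_map (subtopology T H) (subtopology T H) (\<lambda>x. inv\<^bsub>G\<lparr>carrier := H\<rparr>\<^esub> x)"
    by (rule continuous_map_eq) (simp add: topspace_Int_H subgroup_inv_eq)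
  show "locally_compact_space (subtopology T H)"
    using locally_compact closed_H by (rule locally_compact_space_closed_subset)
  show "Hausdorff_space (subtopology T H)"
    using hausdorff by (rule Hausdorff_space_subtopology)
qed

abbreviation "Q \<equiv> coset_space_topology G T H"

lemma topspace_Q: "topspace Q = (\<lambda>g. g <# H) ` carrier G"
  by (simp add: coset_space_topology_def topspace_quotient_topology topspace_eq_carrier)

lemma quotient_map_coset: "quotient_map T Q (\<lambda>g. g <# H)"
  unfolding coset_space_topology_def by (rule quotient_map_quotient_topology)

lemma continuous_map_coset: "continuous_map T Q (\<lambda>g. g <# H)"
  using quotient_map_coset by (rule quotient_imp_continuous_map)

lemma coset_mult: "\<lbrakk>g \<in> carrier G; h \<in> H\<rbrakk> \<Longrightarrow> (g \<otimes> h) <# H = g <# H"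
  using l_repr_independence[OF _ _ H, of "g \<otimes> h" g] by (auto simp: l_coset_def)

lemma coset_eqE:
  assumes "g <# H = g' <# H" "g \<in> carrier G" "g' \<in> carrier G"
  obtains h where "h \<in> H" "g' = g \<otimes> h"
proof -
  have "g' \<otimes> \<one> \<in> g <# H" unfolding assms(1) using H_one by (auto simp: l_coset_def)
  then show ?thesis using that assms by (auto simp: l_coset_def)
qed

text \<open>The saturation of an open set \<open>U\<close> is the union of its right translates \<open>U h\<close> with \<open>h \<in> H\<close>.\<close>

lemma open_map_coset: "open_map T Q (\<lambda>g. g <# H)"
  unfolding open_map_def
proof (intro allI impI)
  fix U assume U: "openin T U"
  then have UG: "U \<subseteq> carrier G" using openin_subset topspace_eq_carrier by metis
  have "{g \<in> carrier G. g <# H \<in> (\<lambda>g. g <# H) ` U} = (\<Union>h\<in>H. (\<lambda>x. x \<otimes> h) ` U)"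
  proof (intro Set.set_eqI iffI)
    fix g assume "g \<in> {g \<in> carrier G. g <# H \<in> (\<lambda>g. g <# H) ` U}"
    then obtain u where "g \<in> carrier G" "u \<in> U" "g <# H = u <# H" by auto
    then show "g \<in> (\<Union>h\<in>H. (\<lambda>x. x \<otimes> h) ` U)"
      using UG coset_eqE[of u g] by (metis UN_I imageI subsetD)
  next
    fix g assume "g \<in> (\<Union>h\<in>H. (\<lambda>x. x \<otimes> h) ` U)"
    then show "g \<in> {g \<in> carrier G. g <# H \<in> (\<lambda>g. g <# H) ` U}"
      using UG H_carrier by (auto simp: subset_iff coset_mult)
  qed
  moreover have "openin T ((\<lambda>x. x \<otimes> h) ` U)" if "h \<in> H" for h
    using homeomorphic_maps_right_translation[OF H_carrier[OF that]] U
    by (metis homeomorphic_maps_map homeomorphic_map_openness_eq)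
  ultimately have "openin T {g \<in> carrier G. g <# H \<in> (\<lambda>g. g <# H) ` U}" by auto
  then show "openin Q ((\<lambda>g. g <# H) ` U)"
    using UG by (auto simp: coset_space_topology_def openin_quotient_topology topspace_eq_carrier)
qed

text \<open>The pairs \<open>(a, b)\<close> with \<open>aH = bH\<close> form the closed set where the inverse of \<open>a\<close> times \<open>b\<close> lies in
  \<open>H\<close>, and \<open>G \<rightarrow> G/H\<close> is open; so distinct cosets can be separated.\<close>

lemma Hausdorff_Q: "Hausdorff_space Q"
  unfolding Hausdorff_space_def
proof (intro allI impI)
  fix C D assume "C \<in> topspace Q \<and> D \<in> topspace Q \<and> C \<noteq> D"
  then obtain x y where xy: "x \<in> carrier G" "y \<in> carrier G" "C = x <# H" "D = y <# H" "C \<noteq> D"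
    by (auto simp: topspace_Q)
  let ?W = "{p \<in> topspace (prod_topology T T). inv (fst p) \<otimes> snd p \<in> topspace T - H}"
  have "openin (prod_topology T T) ?W"
    using closed_H
    by (intro openin_continuous_map_preimage[where Y=T] continuous_map_group_mult
        continuous_map_group_inv continuous_map_fst continuous_map_snd) blast
  moreover have "inv x \<otimes> y \<notin> H"
  proof
    assume "inv x \<otimes> y \<in> H"
    then have "(x \<otimes> (inv x \<otimes> y)) <# H = x <# H" using xy by (intro coset_mult)
    then show False using xy by (simp add: m_assoc[symmetric])
  qed
  then have "(x, y) \<in> ?W" using xy by (simp add: topspace_eq_carrier)
  ultimately obtain U V where UV: "openin T U" "openin T V" "x \<in> U" "y \<in> V" "U \<times> V \<subseteq> ?W"
    unfolding openin_prod_topology_alt by meson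
  have "disjnt ((\<lambda>g. g <# H) ` U) ((\<lambda>g. g <# H) ` V)"
    unfolding disjnt_def
  proof (rule equals0I)
    fix E assume "E \<in> (\<lambda>g. g <# H) ` U \<inter> (\<lambda>g. g <# H) ` V"
    then obtain a b where ab: "a \<in> U" "b \<in> V" "a <# H = b <# H" by auto
    then have c: "a \<in> carrier G" "b \<in> carrier G"
      using UV openin_subset topspace_eq_carrier by blast+
    obtain h where h: "h \<in> H" "b = a \<otimes> h" using coset_eqE[OF ab(3) c] by metis
    then have "inv a \<otimes> b = h" using c H_carrier by (simp add: m_assoc[symmetric])
    moreover have "(a, b) \<in> ?W" using ab UV by blast
    ultimately show False using h by simp
  qed
  then show "\<exists>U V. openin Q U \<and> openin Q V \<and> C \<in> U \<and> D \<in> V \<and> disjnt U V"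
    using open_map_coset[unfolded open_map_def] UV(1-4) xy(3,4) by blast
qed

sublocale Q: lch_space Q
proof
  show "locally_compact_space Q"
    using continuous_map_coset open_map_coset _ locally_compact
    by (rule locally_compact_space_continuous_open_map_image) (simp add: topspace_Q topspace_eq_carrier)
qed (rule Hausdorff_Q)

text \<open>Every point of \<open>G\<close> has an open neighbourhood inside a compact set. The images of these neighbourhoods are
open and cover \<open>K\<close>, and the union of the finitely many compact sets that belong to a finite subcover is
compact.\<close>

lemma compactin_coset_lift:
  assumes K: "compactin Q K"
  obtains C where "compactin T C" "K \<subseteq> (\<lambda>g. g <# H) ` C"
proof -
  have "\<exists>U C. openin T U \<and> compactin T C \<and> g \<in> U \<and> U \<subseteq> C" if "g \<in> carrier G" for g
    using locally_compact that by (auto simp: locally_compact_space_def topspace_eq_carrier)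
  then obtain U C where UC: "\<And>g. g \<in> carrier G \<Longrightarrow> openin T (U g)"
    "\<And>g. g \<in> carrier G \<Longrightarrow> compactin T (C g)" "\<And>g. g \<in> carrier G \<Longrightarrow> g \<in> U g"
    "\<And>g. g \<in> carrier G \<Longrightarrow> U g \<subseteq> C g"
    by metis
  let ?\<U> = "(\<lambda>g. (\<lambda>x. x <# H) ` U g) ` carrier G"
  have op: "\<And>V. V \<in> ?\<U> \<Longrightarrow> openin Q V" using UC(1) open_map_coset by (auto simp: open_map_def)
  moreover have "K \<subseteq> \<Union>?\<U>"
  proof
    fix D assume "D \<in> K"
    then obtain g where g: "g \<in> carrier G" "D = g <# H"
      using compactin_subset_topspace[OF K] unfolding topspace_Q by blast
    then have "D \<in> (\<lambda>x. x <# H) ` U g" using UC(3) by (intro image_eqI[of D _ g]) auto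
    then show "D \<in> \<Union>?\<U>" using g(1) by blast
  qed
  ultimately have "\<exists>\<F>. finite \<F> \<and> \<F> \<subseteq> ?\<U> \<and> K \<subseteq> \<Union>\<F>"
    by (rule compactinD[OF K])
  then obtain A where A: "finite A" "A \<subseteq> carrier G" "K \<subseteq> (\<Union>g\<in>A. (\<lambda>x. x <# H) ` U g)"
    by (metis finite_subset_image)
  show ?thesis
  proof
    show "compactin T (\<Union>g\<in>A. C g)" using A UC(2) by (intro compactin_Union) auto
    have "(\<Union>g\<in>A. (\<lambda>x. x <# H) ` U g) \<subseteq> (\<lambda>g. g <# H) ` (\<Union>g\<in>A. C g)"
      unfolding image_UN using A(2) UC(4) by (intro UN_mono image_mono) auto
    then show "K \<subseteq> (\<lambda>g. g <# H) ` (\<Union>g\<in>A. C g)" using A(3) by (rule order_trans[rotated])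
  qed
qed

end

section \<open>Averaging over cosets\<close>

locale closed_subgroup_haar = closed_subgroup +
  fixes \<nu>
  assumes nu: "left_haar_measure (G\<lparr>carrier := H\<rparr>) (subtopology T H) \<nu>"
begin

lemma radon_nu: "radon_measure (subtopology T H) \<nu>"
  using nu by (rule sub.haar_radon)

lemma space_nu: "space \<nu> = H"
  using radon_measure_space[OF radon_nu] topspace_Int_H by simp

lemma continuous_map_on_coset:
  assumes f: "continuous_map T Z f" and g: "g \<in> carrier G"
  shows "continuous_map (subtopology T H) Z (\<lambda>h. f (g \<otimes> h))"
  by (intro continuous_map_from_subtopology continuous_map_compose_fun[OF f]
      continuous_map_left_translation g)

lemma Cc_real_on_coset:
  assumes f: "f \<in> Cc_real T" and g: "g \<in> carrier G"
  shows "(\<lambda>h. f (g \<otimes> h)) \<in> Cc_real (subtopology T H)"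
proof -
  obtain K where K: "compactin T K" "\<And>x. \<lbrakk>x \<in> topspace T; x \<notin> K\<rbrakk> \<Longrightarrow> f (g \<otimes> x) = 0"
    using Cc_real_translate(1)[OF f g] by (meson Cc_realE)
  show ?thesis
  proof (rule Cc_realI)
    show "continuous_map (subtopology T H) euclideanreal (\<lambda>h. f (g \<otimes> h))"
      using f g by (intro continuous_map_on_coset Cc_real_continuous)
    show "compactin (subtopology T H) (K \<inter> H)"
      using K(1) closed_H by (simp add: compactin_subtopology compact_Int_closedin)
  qed (use K(2) in auto)
qed

text \<open>Changing the representative of a coset is a left translation in \<open>H\<close>.\<close>

lemma integral_coset_representative:
  fixes f :: "'a \<Rightarrow> 'e::{banach, second_countable_topology}"
  assumes f: "continuous_map T euclidean f" and g: "g \<in> carrier G" and k: "k \<in> H"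
  shows "(\<integral>h. f (g \<otimes> k \<otimes> h) \<partial>\<nu>) = (\<integral>h. f (g \<otimes> h) \<partial>\<nu>)"
proof -
  have "(\<integral>h. f (g \<otimes> k \<otimes> h) \<partial>\<nu>) = (\<integral>h. f (g \<otimes> (k \<otimes> h)) \<partial>\<nu>)"
    using g k by (intro Bochner_Integration.integral_cong) (auto simp: space_nu m_assoc H_carrier)
  also have "\<dots> = (\<integral>h. f (g \<otimes> h) \<partial>\<nu>)"
    using sub.haar_integral_left_translate[OF nu, of k "\<lambda>h. f (g \<otimes> h)"] k
      radon_measure_measurable[OF radon_nu continuous_map_on_coset[OF f g]] by simp
  finally show ?thesis .
qed

text \<open>The choice of the representative has no effect, by \<open>integral_coset_representative\<close>. It is the real-valued
counterpart of \<^const>\<open>coset_integral\<close>, for which positivity makes sense.\<close>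

definition coset_average :: "('a \<Rightarrow> real) \<Rightarrow> 'a set \<Rightarrow> real" where
  "coset_average f C = (\<integral>h. f ((SOME g. g \<in> C) \<otimes> h) \<partial>\<nu>)"

lemma coset_average_eq:
  assumes f: "continuous_map T euclideanreal f" and g: "g \<in> carrier G"
  shows "coset_average f (g <# H) = (\<integral>h. f (g \<otimes> h) \<partial>\<nu>)"
proof -
  have "(SOME x. x \<in> g <# H) \<in> g <# H"
    by (rule someI[of _ "g \<otimes> \<one>"]) (use H_one in \<open>auto simp: l_coset_def\<close>)
  then obtain k where "k \<in> H" "(SOME x. x \<in> g <# H) = g \<otimes> k" by (auto simp: l_coset_def)
  then show ?thesis
    unfolding coset_average_def using integral_coset_representative[OF f g] by simp
qed

lemma coset_integral_eq:
  assumes f: "continuous_map T euclidean f" and g: "g \<in> carrier G"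
  shows "coset_integral G \<nu> f (g <# H) = (\<integral>h. f (g \<otimes> h) \<partial>\<nu>)"
  unfolding coset_integral_def
proof (rule the_equality)
  show *: "\<forall>x\<in>g <# H. (\<integral>h. f (x \<otimes> h) \<partial>\<nu>) = (\<integral>h. f (g \<otimes> h) \<partial>\<nu>)"
    using integral_coset_representative[OF f g] by (auto simp: l_coset_def)
  have "g \<otimes> \<one> \<in> g <# H" using H_one by (auto simp: l_coset_def)
  then show "z = (\<integral>h. f (g \<otimes> h) \<partial>\<nu>)" if "\<forall>x\<in>g <# H. (\<integral>h. f (x \<otimes> h) \<partial>\<nu>) = z" for z
    using that * by metis
qed

lemma continuous_map_pair_mult:
  "continuous_map (prod_topology T (subtopology T H)) T (\<lambda>p. fst p \<otimes> snd p)"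
  by (intro continuous_map_group_mult continuous_map_fst
      continuous_map_into_fulltopology[OF continuous_map_snd])

text \<open>If \<open>g \<in> C\<close> and \<open>g h \<in> K\<close>, then \<open>h\<close> lies in \<open>C\<inverse> K\<close>, whose intersection with the closed set \<open>H\<close> is compact.
So the functions \<open>h \<mapsto> f (g h)\<close> have a common compact support while \<open>g\<close> ranges over \<open>C\<close>.\<close>

lemma compactin_H_transporter:
  assumes C: "compactin T C" and K: "compactin T K"
  obtains L where "compactin (subtopology T H) L"
    "\<And>g h. \<lbrakk>g \<in> C; h \<in> H; g \<otimes> h \<in> K\<rbrakk> \<Longrightarrow> h \<in> L"
proof
  let ?L = "(\<lambda>(x, y). x \<otimes> y) ` (m_inv G ` C \<times> K) \<inter> H"
  show "compactin (subtopology T H) ?L"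
    using compactin_group_mult[OF compactin_group_inv[OF C] K] closed_H
    by (simp add: compactin_subtopology compact_Int_closedin)
  show "h \<in> ?L" if "g \<in> C" "h \<in> H" "g \<otimes> h \<in> K" for g h
  proof -
    have "g \<in> carrier G" using C that(1) compactin_subset_topspace topspace_eq_carrier by blast
    then have "h = inv g \<otimes> (g \<otimes> h)" using H_carrier[OF that(2)] by (simp add: m_assoc[symmetric])
    then show ?thesis using that by force
  qed
qed

text \<open>Continuity on \<open>G/H\<close> is continuity of the pullback to \<open>G\<close>, which is an integral depending on a parameter; the
support is contained in the image of that of \<open>f\<close>.\<close>

lemma coset_average_Cc:
  assumes f: "f \<in> Cc_real T"
  shows "coset_average f \<in> Cc_real Q"
proof -
  obtain K where K: "compactin T K" "\<And>x. \<lbrakk>x \<in> topspace T; x \<notin> K\<rbrakk> \<Longrightarrow> f x = 0"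
    using f by (meson Cc_realE)
  note cf = Cc_real_continuous[OF f]
  have "continuous_map T euclideanreal (\<lambda>g. \<integral>h. f (g \<otimes> h) \<partial>\<nu>)"
  proof (rule sub.continuous_map_integral_parameter[OF radon_nu])
    show "continuous_map (prod_topology T (subtopology T H)) euclideanreal (\<lambda>(g, h). f (g \<otimes> h))"
      unfolding case_prod_unfold by (rule continuous_map_compose_fun[OF cf continuous_map_pair_mult])
    fix g assume "g \<in> topspace T"
    then obtain U C where U: "openin T U" "compactin T C" "g \<in> U" "U \<subseteq> C"
      using locally_compact unfolding locally_compact_space_def by meson
    obtain L where L: "compactin (subtopology T H) L"
      "\<And>g h. \<lbrakk>g \<in> C; h \<in> H; g \<otimes> h \<in> K\<rbrakk> \<Longrightarrow> h \<in> L"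
      using compactin_H_transporter[OF U(2) K(1)] by metis
    have "f (g' \<otimes> h) = 0" if "g' \<in> U" "h \<in> topspace (subtopology T H) - L" for g' h
    proof -
      have h: "h \<in> H" "h \<notin> L" using that topspace_Int_H by auto
      then have "g' \<otimes> h \<notin> K" using L(2) that(1) U(4) by blast
      moreover have "g' \<in> carrier G" using that(1) openin_subset[OF U(1)] topspace_eq_carrier by blast
      ultimately show ?thesis using K(2) H_carrier[OF h(1)] by (simp add: topspace_eq_carrier)
    qed
    then show "\<exists>U L. openin T U \<and> g \<in> U \<and> compactin (subtopology T H) L \<and>
      (\<forall>g'\<in>U. \<forall>h\<in>topspace (subtopology T H) - L. f (g' \<otimes> h) = 0)"
      using U(1,3) L(1) by blast
  qed
  then have "continuous_map T euclideanreal (coset_average f \<circ> (\<lambda>g. g <# H))"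
    by (rule continuous_map_eq) (simp add: topspace_eq_carrier coset_average_eq[OF cf])
  then have cont: "continuous_map Q euclideanreal (coset_average f)"
    using continuous_compose_quotient_map_eq[OF quotient_map_coset] by blast
  show ?thesis
  proof (rule Cc_realI[OF cont image_compactin[OF K(1) continuous_map_coset]])
    fix D assume D: "D \<in> topspace Q" "D \<notin> (\<lambda>g. g <# H) ` K"
    then obtain g where g: "g \<in> carrier G" "D = g <# H" by (auto simp: topspace_Q)
    have "f (g \<otimes> h) = 0" if "h \<in> H" for h
    proof -
      have "g \<otimes> h \<notin> K" using D(2) coset_mult[OF g(1) that] g(2) by (metis image_eqI)
      then show ?thesis using K(2) g(1) H_carrier[OF that] by (simp add: topspace_eq_carrier)
    qed
    then have "(\<integral>h. f (g \<otimes> h) \<partial>\<nu>) = (\<integral>h. 0 \<partial>\<nu>)"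
      by (intro Bochner_Integration.integral_cong) (auto simp: space_nu)
    then show "coset_average f D = 0" by (simp add: g coset_average_eq[OF cf])
  qed
qed

lemma integrable_on_coset: "\<lbrakk>f \<in> Cc_real T; g \<in> carrier G\<rbrakk> \<Longrightarrow> integrable \<nu> (\<lambda>h. f (g \<otimes> h))"
  using sub.Cc_real_integrable[OF radon_nu Cc_real_on_coset] .

lemma coset_average_add:
  assumes "f \<in> Cc_real T" "k \<in> Cc_real T" "D \<in> topspace Q"
  shows "coset_average (\<lambda>x. f x + k x) D = coset_average f D + coset_average k D"
  using assms by (auto simp: topspace_Q coset_average_eq Cc_real_continuous Cc_real_add integrable_on_coset)

lemma coset_average_cmult:
  assumes "f \<in> Cc_real T" "D \<in> topspace Q"
  shows "coset_average (\<lambda>x. c * f x) D = c * coset_average f D"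
  using assms by (auto simp: topspace_Q coset_average_eq Cc_real_continuous Cc_real_cmult)

lemma coset_average_nonneg:
  assumes "f \<in> Cc_real T" "\<And>x. x \<in> carrier G \<Longrightarrow> 0 \<le> f x" "D \<in> topspace Q"
  shows "0 \<le> coset_average f D"
  using assms H_carrier
  by (auto simp: topspace_Q coset_average_eq Cc_real_continuous space_nu intro!: integral_nonneg_AE AE_I2)

lemma coset_average_pos:
  assumes f: "f \<in> Cc_real T" and nonneg: "\<And>x. x \<in> carrier G \<Longrightarrow> 0 \<le> f x"
    and g: "g \<in> carrier G" "0 < f g"
  shows "0 < coset_average f (g <# H)"
  unfolding coset_average_eq[OF Cc_real_continuous[OF f] g(1)]
proof (rule sub.radon_integral_pos[OF radon_nu sub.haar_open_pos[OF nu] Cc_real_on_coset[OF f g(1)]])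
  show "0 \<le> f (g \<otimes> h)" if "h \<in> topspace (subtopology T H)" for h
    using that topspace_Int_H H_carrier g(1) nonneg by auto
  show "\<one> \<in> topspace (subtopology T H)" using H_one topspace_Int_H by auto
qed (use g in simp_all)

lemma coset_average_left_translate:
  assumes f: "f \<in> Cc_real T" and a: "a \<in> carrier G" and D: "D \<in> topspace Q"
  shows "coset_average (\<lambda>x. f (a \<otimes> x)) D = coset_average f (a <# D)"
proof -
  obtain g where g: "g \<in> carrier G" "D = g <# H" using D by (auto simp: topspace_Q)
  have "a <# D = (a \<otimes> g) <# H"
    using g a subgroup.subset[OF H] by (simp add: lcos_m_assoc)
  moreover have "(\<integral>h. f (a \<otimes> (g \<otimes> h)) \<partial>\<nu>) = (\<integral>h. f (a \<otimes> g \<otimes> h) \<partial>\<nu>)"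
    using a g by (intro Bochner_Integration.integral_cong) (auto simp: space_nu H_carrier m_assoc)
  ultimately show ?thesis
    using f a g by (simp add: coset_average_eq Cc_real_continuous Cc_real_translate)
qed

lemma coset_average_right_translate:
  assumes f: "f \<in> Cc_real T" and k: "k \<in> H" and D: "D \<in> topspace Q"
  shows "coset_average (\<lambda>x. f (x \<otimes> k)) D =
    modular_function (G\<lparr>carrier := H\<rparr>) (subtopology T H) (inv k) * coset_average f D"
proof -
  obtain g where g: "g \<in> carrier G" "D = g <# H" using D by (auto simp: topspace_Q)
  have "(\<integral>h. f (g \<otimes> h \<otimes> k) \<partial>\<nu>) = (\<integral>h. f (g \<otimes> (h \<otimes> k)) \<partial>\<nu>)"
    using g k by (intro Bochner_Integration.integral_cong) (auto simp: space_nu H_carrier m_assoc)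
  also have "\<dots> = modular_function (G\<lparr>carrier := H\<rparr>) (subtopology T H) (inv k) * (\<integral>h. f (g \<otimes> h) \<partial>\<nu>)"
    using sub.haar_integral_right_translate[OF nu _ Cc_real_on_coset[OF f g(1)], of k] k
    by (simp add: subgroup_inv_eq)
  finally show ?thesis
    using f k g by (simp add: coset_average_eq Cc_real_continuous Cc_real_translate H_carrier)
qed

lemma coset_average_mult:
  assumes f: "f \<in> Cc_real T" and F: "continuous_map Q euclideanreal F" and D: "D \<in> topspace Q"
  shows "coset_average (\<lambda>x. f x * F (x <# H)) D = coset_average f D * F D"
proof -
  obtain g where g: "g \<in> carrier G" "D = g <# H" using D by (auto simp: topspace_Q)
  have "continuous_map T euclideanreal (\<lambda>x. F (x <# H))"
    using continuous_map_compose[OF continuous_map_coset F] by (simp add: o_def)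
  then have c: "continuous_map T euclideanreal (\<lambda>x. f x * F (x <# H))"
    using Cc_real_continuous[OF f] by (intro continuous_map_real_mult)
  have "(\<integral>h. f (g \<otimes> h) * F ((g \<otimes> h) <# H) \<partial>\<nu>) = (\<integral>h. f (g \<otimes> h) * F D \<partial>\<nu>)"
    using g by (intro Bochner_Integration.integral_cong) (auto simp: space_nu coset_mult)
  then show ?thesis using g f by (simp add: coset_average_eq[OF c] coset_average_eq Cc_real_continuous)
qed

text \<open>Choose \<open>p \<ge> 0\<close> whose average is positive on the compact support of \<open>F\<close>, divide \<open>F\<close> by this average and
  pull back. Replacing the average by its maximum with its lower bound on the support makes
  the quotient continuous without changing it where \<open>F\<close> is non-zero.\<close>

lemma coset_average_surj:
  assumes F: "F \<in> Cc_real Q"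
  obtains f where "f \<in> Cc_real T" "\<And>D. D \<in> topspace Q \<Longrightarrow> coset_average f D = F D"
    "\<And>x. \<lbrakk>x \<in> carrier G; 0 \<le> F (x <# H)\<rbrakk> \<Longrightarrow> 0 \<le> f x"
proof -
  obtain K where K: "compactin Q K" "\<And>D. \<lbrakk>D \<in> topspace Q; D \<notin> K\<rbrakk> \<Longrightarrow> F D = 0"
    using F by (meson Cc_realE)
  obtain C where C: "compactin T C" "K \<subseteq> (\<lambda>g. g <# H) ` C"
    using compactin_coset_lift[OF K(1)] by metis
  obtain p where p: "p \<in> subordinate T (topspace T)" "\<And>x. x \<in> C \<Longrightarrow> p x = 1"
    using subordinate_Urysohn[OF C(1) openin_topspace compactin_subset_topspace[OF C(1)]] by metis
  have pc: "p \<in> Cc_real T" and pn: "\<And>x. x \<in> carrier G \<Longrightarrow> 0 \<le> p x"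
    using subordinateD(1,2)[OF p(1)] by (auto simp: topspace_eq_carrier)
  have pos: "0 < coset_average p D" if D: "D \<in> K" for D
  proof -
    obtain x where x: "x \<in> C" "D = x <# H" using C(2) D by auto
    then have "x \<in> carrier G" using compactin_subset_topspace[OF C(1)] topspace_eq_carrier by blast
    then show ?thesis using coset_average_pos[OF pc pn] p(2) x by simp
  qed
  have cp: "continuous_map Q euclideanreal (coset_average p)"
    by (rule Cc_real_continuous[OF coset_average_Cc[OF pc]])
  obtain d where d: "0 < d" "\<And>D. D \<in> K \<Longrightarrow> d \<le> coset_average p D"
  proof (cases "K = {}")
    case True
    then show ?thesis using that[of 1] by simp
  next
    case False
    have "compact (coset_average p ` K)" using image_compactin[OF K(1) cp] by simp
    then obtain s where "s \<in> coset_average p ` K" "\<forall>t\<in>coset_average p ` K. s \<le> t"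
      using False compact_attains_inf[of "coset_average p ` K"] by auto
    then show ?thesis using that[of s] pos by auto
  qed
  define R where "R D = F D / max d (coset_average p D)" for D
  have R: "continuous_map Q euclideanreal R"
    unfolding R_def using d(1) Cc_real_continuous[OF F]
    by (intro continuous_map_real_divide continuous_map_real_max cp) auto
  have cR: "continuous_map T euclideanreal (\<lambda>x. R (x <# H))"
    using continuous_map_compose[OF continuous_map_coset R] by (simp add: o_def)
  show ?thesis
  proof
    show "(\<lambda>x. p x * R (x <# H)) \<in> Cc_real T" using pc cR by (rule Cc_real_mult)
    show "coset_average (\<lambda>x. p x * R (x <# H)) D = F D" if D: "D \<in> topspace Q" for D
    proof (cases "D \<in> K")
      case True
      then show ?thesis
        using pos[OF True] d(2)[OF True] unfolding coset_average_mult[OF pc R D]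
        by (simp add: R_def max_def)
    next
      case False
      then show ?thesis using K(2) D unfolding coset_average_mult[OF pc R D] by (simp add: R_def)
    qed
    show "0 \<le> p x * R (x <# H)" if "x \<in> carrier G" "0 \<le> F (x <# H)" for x
      using that pn d(1) by (simp add: R_def max_def)
  qed
qed

end

locale haar_pair = closed_subgroup_haar +
  fixes \<mu>
  assumes mu: "left_haar_measure G T \<mu>"
begin

lemma radon_mu: "radon_measure T \<mu>"
  using mu by (rule haar_radon)

lemma space_mu: "space \<mu> = carrier G"
  using radon_measure_space[OF radon_mu] topspace_eq_carrier by simp

text \<open>The left side is the double integral of \<open>p(x) f(x h)\<close> over \<open>x \<in> G\<close> and \<open>h \<in> H\<close>. Replacing \<open>x\<close> by \<open>x h\<inverse>\<close>
gives the integrand \<open>\<Delta>\<^sub>G(h\<inverse>) p(x h\<inverse>) f(x)\<close>. Since \<open>\<Delta>\<^sub>G(h\<inverse>) = \<Delta>\<^sub>H(h\<inverse>)\<close>, the inversion formula for \<open>\<nu>\<close>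
turns the integral over \<open>h\<close> into that of \<open>p(x h) f(x)\<close>.\<close>

lemma coset_average_symmetric:
  assumes modular: "\<And>h. h \<in> H \<Longrightarrow>
      modular_function G T h = modular_function (G\<lparr>carrier := H\<rparr>) (subtopology T H) h"
    and f: "f \<in> Cc_real T" and p: "p \<in> Cc_real T"
  shows "(\<integral>x. p x * coset_average f (x <# H) \<partial>\<mu>) = (\<integral>x. f x * coset_average p (x <# H) \<partial>\<mu>)"
proof -
  let ?d = "\<lambda>h. modular_function (G\<lparr>carrier := H\<rparr>) (subtopology T H) (inv h)"
  note cf = Cc_real_continuous[OF f] and cp = Cc_real_continuous[OF p]
  obtain K where K: "compactin T K" "\<And>x. \<lbrakk>x \<in> topspace T; x \<notin> K\<rbrakk> \<Longrightarrow> f x = 0"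
    using f by (meson Cc_realE)
  obtain C where C: "compactin T C" "\<And>x. \<lbrakk>x \<in> topspace T; x \<notin> C\<rbrakk> \<Longrightarrow> p x = 0"
    using p by (meson Cc_realE)
  obtain L where L: "compactin (subtopology T H) L"
    "\<And>g h. \<lbrakk>g \<in> C; h \<in> H; g \<otimes> h \<in> K\<rbrakk> \<Longrightarrow> h \<in> L"
    using compactin_H_transporter[OF C(1) K(1)] by metis
  have lch: "lch_space T" "lch_space (subtopology T H)" by unfold_locales
  have cfst: "continuous_map (prod_topology T (subtopology T H)) T fst"
    by (rule continuous_map_fst)
  have csnd: "continuous_map (prod_topology T (subtopology T H)) T snd"
    by (rule continuous_map_into_fulltopology[OF continuous_map_snd])
  have cd: "continuous_map (subtopology T H) euclideanreal ?d"
    by (rule continuous_map_eq[OF sub.continuous_modular_inverse[OF nu]])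
      (use topspace_Int_H in \<open>auto simp: subgroup_inv_eq\<close>)
  have "(\<integral>x. p x * coset_average f (x <# H) \<partial>\<mu>) = (\<integral>x. (\<integral>h. p x * f (x \<otimes> h) \<partial>\<nu>) \<partial>\<mu>)"
    by (intro Bochner_Integration.integral_cong) (auto simp: space_mu coset_average_eq[OF cf])
  also have "\<dots> = (\<integral>h. (\<integral>x. p x * f (x \<otimes> h) \<partial>\<mu>) \<partial>\<nu>)"
  proof (rule radon_Fubini[OF lch radon_mu radon_nu _ C(1) L(1)])
    show "continuous_map (prod_topology T (subtopology T H)) euclideanreal (\<lambda>(x, h). p x * f (x \<otimes> h))"
      unfolding case_prod_unfold
      by (intro continuous_map_real_mult continuous_map_compose_fun[OF cp]
          continuous_map_compose_fun[OF cf] continuous_map_pair_mult cfst)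
    fix x h assume xh: "x \<in> topspace T" "h \<in> topspace (subtopology T H)" "x \<notin> C \<or> h \<notin> L"
    then have h: "h \<in> H" "h \<in> carrier G" using H_carrier by auto
    show "p x * f (x \<otimes> h) = 0"
    proof (cases "x \<in> C")
      case True
      then have "x \<otimes> h \<notin> K" using L(2) xh(3) h(1) by blast
      then show ?thesis using K(2)[of "x \<otimes> h"] xh(1) h(2) by (simp add: topspace_eq_carrier)
    qed (use C(2) xh in simp)
  qed
  also have "\<dots> = (\<integral>h. (\<integral>x. ?d h * p (x \<otimes> inv h) * f x \<partial>\<mu>) \<partial>\<nu>)"
  proof (rule Bochner_Integration.integral_cong)
    fix h assume "h \<in> space \<nu>"
    then have h: "h \<in> H" "h \<in> carrier G" using H_carrier space_nu by auto
    have "(\<lambda>x. p (x \<otimes> inv h) * f x) \<in> Cc_real T"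
      using h cf by (intro Cc_real_mult(1) Cc_real_translate p) auto
    from haar_integral_right_translate[OF mu h(2) this]
    have "(\<integral>x. p (x \<otimes> h \<otimes> inv h) * f (x \<otimes> h) \<partial>\<mu>) =
        modular_function G T (inv h) * (\<integral>x. p (x \<otimes> inv h) * f x \<partial>\<mu>)" .
    moreover have "(\<integral>x. p (x \<otimes> h \<otimes> inv h) * f (x \<otimes> h) \<partial>\<mu>) = (\<integral>x. p x * f (x \<otimes> h) \<partial>\<mu>)"
      using h by (intro Bochner_Integration.integral_cong) (auto simp: space_mu m_assoc)
    ultimately show "(\<integral>x. p x * f (x \<otimes> h) \<partial>\<mu>) = (\<integral>x. ?d h * p (x \<otimes> inv h) * f x \<partial>\<mu>)"
      using modular[OF H_inv[OF h(1)]] by (simp add: mult.assoc)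
  qed simp
  also have "\<dots> = (\<integral>x. (\<integral>h. ?d h * p (x \<otimes> inv h) * f x \<partial>\<nu>) \<partial>\<mu>)"
  proof (rule radon_Fubini[OF lch radon_mu radon_nu _ K(1) L(1), symmetric])
    have "continuous_map (prod_topology T (subtopology T H)) euclideanreal (\<lambda>q. ?d (snd q))"
      using continuous_map_compose[OF continuous_map_snd cd] by (simp add: o_def)
    then show "continuous_map (prod_topology T (subtopology T H)) euclideanreal
        (\<lambda>(x, h). ?d h * p (x \<otimes> inv h) * f x)"
      unfolding case_prod_unfold
      by (intro continuous_map_real_mult continuous_map_compose_fun[OF cp]
          continuous_map_compose_fun[OF cf] continuous_map_group_mult continuous_map_group_inv
          cfst csnd)
    fix x h assume xh: "x \<in> topspace T" "h \<in> topspace (subtopology T H)" "x \<notin> K \<or> h \<notin> L"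
    then have h: "h \<in> H" "h \<in> carrier G" and x: "x \<in> carrier G"
      using H_carrier topspace_eq_carrier by auto
    show "?d h * p (x \<otimes> inv h) * f x = 0"
    proof (cases "x \<in> K")
      case True
      moreover have "x \<otimes> inv h \<otimes> h = x" using x h by (simp add: m_assoc)
      ultimately have "x \<otimes> inv h \<notin> C" using L(2)[of "x \<otimes> inv h" h] xh(3) h(1) by auto
      then show ?thesis using C(2)[of "x \<otimes> inv h"] x h(2) by (simp add: topspace_eq_carrier)
    qed (use K(2) xh in simp)
  qed
  also have "\<dots> = (\<integral>x. f x * coset_average p (x <# H) \<partial>\<mu>)"
  proof (rule Bochner_Integration.integral_cong)
    fix x assume "x \<in> space \<mu>"
    then have x: "x \<in> carrier G" by (simp add: space_mu)
    have "coset_average p (x <# H) = (\<integral>h. p (x \<otimes> h) \<partial>\<nu>)" by (rule coset_average_eq[OF cp x])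
    also have "\<dots> = (\<integral>h. ?d h * p (x \<otimes> inv h) \<partial>\<nu>)"
      unfolding sub.haar_integral_inverse[OF nu Cc_real_on_coset[OF p x]]
      by (intro Bochner_Integration.integral_cong) (auto simp: space_nu subgroup_inv_eq)
    finally show "(\<integral>h. ?d h * p (x \<otimes> inv h) * f x \<partial>\<nu>) = f x * coset_average p (x <# H)" by simp
  qed simp
  finally show ?thesis .
qed

text \<open>Take \<open>p\<close> with average 1 on the image of the supports of \<open>f\<close> and \<open>f'\<close>. Then the integral of \<open>f\<close> is that of
\<open>f\<close> times the average of \<open>p\<close>, which by symmetry depends only on the average of \<open>f\<close>.\<close>

lemma coset_average_determines_integral:
  assumes modular: "\<And>h. h \<in> H \<Longrightarrow>
      modular_function G T h = modular_function (G\<lparr>carrier := H\<rparr>) (subtopology T H) h"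
    and f: "f \<in> Cc_real T" and f': "f' \<in> Cc_real T"
    and eq: "\<And>D. D \<in> topspace Q \<Longrightarrow> coset_average f D = coset_average f' D"
  shows "(\<integral>x. f x \<partial>\<mu>) = (\<integral>x. f' x \<partial>\<mu>)"
proof -
  obtain K K' where K: "compactin T K" "\<And>x. \<lbrakk>x \<in> topspace T; x \<notin> K\<rbrakk> \<Longrightarrow> f x = 0"
    and K': "compactin T K'" "\<And>x. \<lbrakk>x \<in> topspace T; x \<notin> K'\<rbrakk> \<Longrightarrow> f' x = 0"
    using f f' by (meson Cc_realE)
  have "compactin Q ((\<lambda>g. g <# H) ` (K \<union> K'))"
    using K(1) K'(1) by (intro image_compactin[OF _ continuous_map_coset] compactin_Un)
  then obtain F where F: "F \<in> subordinate Q (topspace Q)"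
    "\<And>D. D \<in> (\<lambda>g. g <# H) ` (K \<union> K') \<Longrightarrow> F D = 1"
    using Q.subordinate_Urysohn[OF _ openin_topspace compactin_subset_topspace] by metis
  obtain p where p: "p \<in> Cc_real T" "\<And>D. D \<in> topspace Q \<Longrightarrow> coset_average p D = F D"
    using coset_average_surj[OF subordinateD(1)[OF F(1)]] by metis
  have *: "(\<integral>x. k x \<partial>\<mu>) = (\<integral>x. p x * coset_average k (x <# H) \<partial>\<mu>)"
    if k: "k \<in> Cc_real T" "\<And>x. \<lbrakk>x \<in> topspace T; x \<notin> K \<union> K'\<rbrakk> \<Longrightarrow> k x = 0" for k
  proof -
    have "(\<integral>x. k x \<partial>\<mu>) = (\<integral>x. k x * coset_average p (x <# H) \<partial>\<mu>)"
    proof (rule Bochner_Integration.integral_cong)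
      fix x assume "x \<in> space \<mu>"
      then have x: "x \<in> carrier G" by (simp add: space_mu)
      then have "coset_average p (x <# H) = F (x <# H)" using p(2) by (simp add: topspace_Q)
      then show "k x = k x * coset_average p (x <# H)"
        using F(2)[of "x <# H"] k(2)[of x] x by (cases "x \<in> K \<union> K'") (auto simp: topspace_eq_carrier)
    qed simp
    then show ?thesis using coset_average_symmetric[OF modular k(1) p(1)] by simp
  qed
  have "(\<integral>x. p x * coset_average f (x <# H) \<partial>\<mu>) = (\<integral>x. p x * coset_average f' (x <# H) \<partial>\<mu>)"
    using eq by (intro Bochner_Integration.integral_cong) (auto simp: space_mu topspace_Q)
  then show ?thesis using *[OF f] *[OF f'] K(2) K'(2) by simp
qed

end

section \<open>Haar measures on the space of cosets\<close>

lemma integral_Complex: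
  assumes "integrable M a" "integrable M b"
  shows "(\<integral>x. Complex (a x) (b x) \<partial>M) = Complex (\<integral>x. a x \<partial>M) (\<integral>x. b x \<partial>M)"
  using assms by (simp add: Complex_eq)

context haar_pair
begin

lemma coset_translate: "\<lbrakk>a \<in> carrier G; g \<in> carrier G\<rbrakk> \<Longrightarrow> a <# (g <# H) = (a \<otimes> g) <# H"
  using subgroup.subset[OF H] by (simp add: lcos_m_assoc)

lemma homeomorphic_maps_coset_translation:
  assumes a: "a \<in> carrier G"
  shows "homeomorphic_maps Q Q (\<lambda>D. a <# D) (\<lambda>D. inv a <# D)"
proof -
  have cont: "continuous_map Q Q (\<lambda>D. b <# D)" if b: "b \<in> carrier G" for b
  proof -
    have "continuous_map T Q (\<lambda>x. (b \<otimes> x) <# H)"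
      using continuous_map_compose[OF continuous_map_left_translation[OF b] continuous_map_coset]
      by (simp add: o_def)
    then have "continuous_map T Q ((\<lambda>D. b <# D) \<circ> (\<lambda>x. x <# H))"
      by (rule continuous_map_eq) (simp add: topspace_eq_carrier coset_translate[OF b])
    then show ?thesis using continuous_compose_quotient_map_eq[OF quotient_map_coset] by blast
  qed
  show ?thesis
    unfolding homeomorphic_maps_def
  proof (intro conjI ballI cont a inv_closed)
    fix D assume "D \<in> topspace Q"
    then obtain g where "g \<in> carrier G" "D = g <# H" by (auto simp: topspace_Q)
    then show "inv a <# (a <# D) = D" "a <# (inv a <# D) = D"
      using a by (simp_all add: coset_translate m_assoc[symmetric])
  qed
qed

lemma coset_haar_radon: "haar_measure_on_cosets G T H \<xi> \<Longrightarrow> radon_measure Q \<xi>"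
  by (simp add: haar_measure_on_cosets_def)

lemma coset_haar_integral_translate:
  assumes xi: "haar_measure_on_cosets G T H \<xi>" and a: "a \<in> carrier G" and F: "F \<in> Cc_real Q"
  shows "(\<integral>D. F (a <# D) \<partial>\<xi>) = (\<integral>D. F D \<partial>\<xi>)"
proof -
  note R = coset_haar_radon[OF xi] and hom = homeomorphic_maps_coset_translation[OF a]
  have "distr \<xi> \<xi> (\<lambda>D. a <# D) = \<xi>"
  proof (rule measure_eqI)
    fix E assume "E \<in> sets (distr \<xi> \<xi> (\<lambda>D. a <# D))"
    then have E: "E \<in> sets \<xi>" by simp
    show "emeasure (distr \<xi> \<xi> (\<lambda>D. a <# D)) E = emeasure \<xi> E"
      unfolding radon_measure_distr(2)[OF R hom E]
      using xi E a by (simp add: haar_measure_on_cosets_def)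
  qed simp
  moreover have "(\<lambda>D. a <# D) \<in> measurable \<xi> \<xi>"
    using hom by (intro radon_measure_continuous_measurable[OF R]) (simp add: homeomorphic_maps_def)
  ultimately show ?thesis
    using integral_distr[of "\<lambda>D. a <# D" \<xi> \<xi> F] radon_measure_measurable[OF R Cc_real_continuous[OF F]]
    by simp
qed

lemma coset_haar_scale:
  assumes xi: "haar_measure_on_cosets G T H \<xi>" and c: "0 < c"
  shows "haar_measure_on_cosets G T H (scale_measure (ennreal c) \<xi>)"
  using xi c radon_measure_scale[OF coset_haar_radon[OF xi] c]
  by (auto simp: haar_measure_on_cosets_def)

text \<open>Averaging commutes with left translations, so integrating averages against \<open>\<xi>\<close> is a left-invariant positive
functional on \<open>G\<close>. The factor is non-zero since \<open>\<xi>\<close> charges open sets.\<close>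

lemma coset_haar_proportional:
  assumes xi: "haar_measure_on_cosets G T H \<xi>"
  obtains c where "0 < c" "\<And>f. f \<in> Cc_real T \<Longrightarrow> (\<integral>D. coset_average f D \<partial>\<xi>) = c * (\<integral>x. f x \<partial>\<mu>)"
proof -
  note R = coset_haar_radon[OF xi]
  have sp: "space \<xi> = topspace Q" using R by (rule radon_measure_space)
  have int: "integrable \<xi> (coset_average f)" if "f \<in> Cc_real T" for f
    using R coset_average_Cc[OF that] by (rule Q.Cc_real_integrable)
  let ?I = "\<lambda>f. \<integral>D. coset_average f D \<partial>\<xi>"
  have "positive_linear_functional T ?I"
    unfolding positive_linear_functional_def
  proof (intro conjI ballI allI impI)
    fix f k assume fk: "f \<in> Cc_real T" "k \<in> Cc_real T"
    have "?I (\<lambda>x. f x + k x) = (\<integral>D. coset_average f D + coset_average k D \<partial>\<xi>)"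
      by (rule Bochner_Integration.integral_cong) (auto simp: sp coset_average_add[OF fk])
    then show "?I (\<lambda>x. f x + k x) = ?I f + ?I k" using int fk by simp
  next
    fix f c assume f: "f \<in> Cc_real T"
    have "?I (\<lambda>x. c * f x) = (\<integral>D. c * coset_average f D \<partial>\<xi>)"
      by (rule Bochner_Integration.integral_cong) (auto simp: sp coset_average_cmult[OF f])
    then show "?I (\<lambda>x. c * f x) = c * ?I f" by simp
  next
    fix f assume "f \<in> Cc_real T" "\<forall>x\<in>topspace T. 0 \<le> f x"
    then show "0 \<le> ?I f"
      by (intro integral_nonneg_AE AE_I2) (auto simp: sp topspace_eq_carrier intro: coset_average_nonneg)
  qed
  moreover have "?I (\<lambda>x. f (a \<otimes> x)) = ?I f" if "a \<in> carrier G" "f \<in> Cc_real T" for a f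
  proof -
    have "?I (\<lambda>x. f (a \<otimes> x)) = (\<integral>D. coset_average f (a <# D) \<partial>\<xi>)"
      using that by (intro Bochner_Integration.integral_cong) (auto simp: sp coset_average_left_translate)
    then show ?thesis using coset_haar_integral_translate[OF xi that(1) coset_average_Cc[OF that(2)]] by simp
  qed
  ultimately obtain c where c: "0 \<le> c" "\<And>f. f \<in> Cc_real T \<Longrightarrow> ?I f = c * (\<integral>x. f x \<partial>\<mu>)"
    using invariant_functional_proportional[OF mu, of ?I] by metis
  obtain k where k: "k \<in> Cc_real T" "\<And>x. x \<in> carrier G \<Longrightarrow> 0 \<le> k x" "k \<one> = 1"
    using haar_test_function[OF mu] by metis
  have "0 < ?I k"
  proof (rule Q.radon_integral_pos[OF R _ coset_average_Cc[OF k(1)]])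
    show "emeasure \<xi> U \<noteq> 0" if "openin Q U" "U \<noteq> {}" for U
      using xi that by (auto simp: haar_measure_on_cosets_def)
    show "0 < coset_average k (\<one> <# H)" using k by (intro coset_average_pos) auto
    show "\<one> <# H \<in> topspace Q" by (auto simp: topspace_Q)
  qed (use k in \<open>auto intro: coset_average_nonneg\<close>)
  then have "c \<noteq> 0" using c(2)[OF k(1)] by auto
  then show ?thesis using that c by (simp add: less_le)
qed

text \<open>Right translation by \<open>k = h\<inverse>\<close> multiplies the integral of \<open>f\<close> against \<open>\<mu>\<close> by \<open>\<Delta>\<^sub>G(h)\<close> and the average of \<open>f\<close>
by \<open>\<Delta>\<^sub>H(h)\<close>; but the average of any function integrates to \<open>c\<close> times the integral of that function.\<close>

lemma coset_haar_imp_modular_eq: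
  assumes xi: "haar_measure_on_cosets G T H \<xi>" and h: "h \<in> H"
  shows "modular_function G T h = modular_function (G\<lparr>carrier := H\<rparr>) (subtopology T H) h"
proof -
  obtain c where c: "0 < c" "\<And>f. f \<in> Cc_real T \<Longrightarrow> (\<integral>D. coset_average f D \<partial>\<xi>) = c * (\<integral>x. f x \<partial>\<mu>)"
    using coset_haar_proportional[OF xi] by metis
  obtain f where f: "f \<in> Cc_real T" "0 < (\<integral>x. f x \<partial>\<mu>)"
    using haar_test_function[OF mu] by metis
  define k where "k = inv h"
  have k: "k \<in> H" "k \<in> carrier G" "inv k = h" using h H_inv H_carrier by (auto simp: k_def)
  have sp: "space \<xi> = topspace Q" using coset_haar_radon[OF xi] by (rule radon_measure_space)
  have "c * (modular_function G T h * (\<integral>x. f x \<partial>\<mu>)) = c * (\<integral>x. f (x \<otimes> k) \<partial>\<mu>)"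
    using haar_integral_right_translate[OF mu k(2) f(1)] k(3) by simp
  also have "\<dots> = (\<integral>D. coset_average (\<lambda>x. f (x \<otimes> k)) D \<partial>\<xi>)"
    using c(2)[OF Cc_real_translate(2)[OF f(1) k(2)]] by simp
  also have "\<dots> = (\<integral>D. modular_function (G\<lparr>carrier := H\<rparr>) (subtopology T H) h * coset_average f D \<partial>\<xi>)"
    by (rule Bochner_Integration.integral_cong)
      (auto simp: sp coset_average_right_translate[OF f(1) k(1)] k(3))
  also have "\<dots> = modular_function (G\<lparr>carrier := H\<rparr>) (subtopology T H) h * (c * (\<integral>x. f x \<partial>\<mu>))"
    using c(2)[OF f(1)] by simp
  finally show ?thesis using c(1) f(2) by simp
qed

text \<open>The functional \<open>I\<close> sends \<open>F\<close> to the integral against \<open>\<mu>\<close> of any \<open>f\<close> with average \<open>F\<close>; that it does not matter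
which \<open>f\<close> is chosen makes \<open>I\<close> additive and homogeneous, positive (use the non-negative \<open>f\<close> from
\<open>coset_average_surj\<close>), and invariant under translations.\<close>

lemma coset_haar_exists:
  assumes modular: "\<And>h. h \<in> H \<Longrightarrow>
      modular_function G T h = modular_function (G\<lparr>carrier := H\<rparr>) (subtopology T H) h"
  shows "\<exists>\<xi>. haar_measure_on_cosets G T H \<xi>"
proof -
  define lift where "lift F = (SOME f. f \<in> Cc_real T \<and> (\<forall>D\<in>topspace Q. coset_average f D = F D))" for F
  have lift: "lift F \<in> Cc_real T \<and> (\<forall>D\<in>topspace Q. coset_average (lift F) D = F D)"
    if F: "F \<in> Cc_real Q" for F
  proof -
    obtain f where "f \<in> Cc_real T" "\<And>D. D \<in> topspace Q \<Longrightarrow> coset_average f D = F D"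
      using coset_average_surj[OF F] by metis
    then have "\<exists>f. f \<in> Cc_real T \<and> (\<forall>D\<in>topspace Q. coset_average f D = F D)" by blast
    then show ?thesis unfolding lift_def by (rule someI_ex)
  qed
  define I where "I F = (\<integral>x. lift F x \<partial>\<mu>)" for F
  have I_eq: "I F = (\<integral>x. f x \<partial>\<mu>)"
    if "F \<in> Cc_real Q" "f \<in> Cc_real T" "\<And>D. D \<in> topspace Q \<Longrightarrow> coset_average f D = F D" for F f
    unfolding I_def using lift[OF that(1)] that
    by (intro coset_average_determines_integral modular) auto
  have "positive_linear_functional Q I"
    unfolding positive_linear_functional_def
  proof (intro conjI ballI allI impI)
    fix E F assume E: "E \<in> Cc_real Q" and F: "F \<in> Cc_real Q"
    have "I (\<lambda>D. E D + F D) = (\<integral>x. lift E x + lift F x \<partial>\<mu>)"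
      using lift[OF E] lift[OF F] E F
      by (intro I_eq Cc_real_add) (auto simp: coset_average_add)
    also have "\<dots> = I E + I F"
      unfolding I_def using lift[OF E] lift[OF F] by (simp add: Cc_real_integrable[OF radon_mu])
    finally show "I (\<lambda>D. E D + F D) = I E + I F" .
  next
    fix F c assume F: "F \<in> Cc_real Q"
    have "I (\<lambda>D. c * F D) = (\<integral>x. c * lift F x \<partial>\<mu>)"
      using lift[OF F] F by (intro I_eq Cc_real_cmult) (auto simp: coset_average_cmult)
    then show "I (\<lambda>D. c * F D) = c * I F" by (simp add: I_def)
  next
    fix F assume F: "F \<in> Cc_real Q" "\<forall>D\<in>topspace Q. 0 \<le> F D"
    obtain f where f: "f \<in> Cc_real T" "\<And>D. D \<in> topspace Q \<Longrightarrow> coset_average f D = F D"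
      "\<And>x. \<lbrakk>x \<in> carrier G; 0 \<le> F (x <# H)\<rbrakk> \<Longrightarrow> 0 \<le> f x"
      using coset_average_surj[OF F(1)] by metis
    have "0 \<le> (\<integral>x. f x \<partial>\<mu>)"
      using f(3) F(2) by (intro integral_nonneg_AE AE_I2) (auto simp: space_mu topspace_Q)
    then show "0 \<le> I F" using I_eq[OF F(1) f(1,2)] by simp
  qed
  then obtain \<xi> where xi: "radon_measure Q \<xi>" "\<And>F. F \<in> Cc_real Q \<Longrightarrow> (\<integral>D. F D \<partial>\<xi>) = I F"
    using riesz_representation[OF Q.locally_compact_space Q.Hausdorff_space] by metis
  have "haar_measure_on_cosets G T H \<xi>"
    unfolding haar_measure_on_cosets_def
  proof (intro conjI allI impI ballI)
    show "radon_measure Q \<xi>" by (rule xi(1))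
    fix U assume U: "openin Q U \<and> U \<noteq> {}"
    then obtain g where g: "g \<in> carrier G" "g <# H \<in> U"
      using openin_subset[of Q U] by (auto simp: topspace_Q subset_iff) 
    then have "compactin Q {g <# H}" by (auto simp: topspace_Q)
    then obtain F where F: "F \<in> subordinate Q U" "F (g <# H) = 1"
      using Q.subordinate_Urysohn[of "{g <# H}" U] U g by auto
    note Fc = subordinateD(1)[OF F(1)]
    obtain f where f: "f \<in> Cc_real T" "\<And>D. D \<in> topspace Q \<Longrightarrow> coset_average f D = F D"
      "\<And>x. \<lbrakk>x \<in> carrier G; 0 \<le> F (x <# H)\<rbrakk> \<Longrightarrow> 0 \<le> f x"
      using coset_average_surj[OF Fc] by metis
    have nonneg: "0 \<le> f x" if "x \<in> carrier G" for x
      using f(3) that subordinateD(2)[OF F(1)] by (simp add: topspace_Q)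
    have "\<exists>x\<in>carrier G. 0 < f x"
    proof (rule ccontr)
      assume "\<not> (\<exists>x\<in>carrier G. 0 < f x)"
      then have "f x = 0" if "x \<in> carrier G" for x using nonneg[OF that] that by force
      then have "(\<integral>h. f (g \<otimes> h) \<partial>\<nu>) = (\<integral>h. 0 \<partial>\<nu>)"
        using g H_carrier by (intro Bochner_Integration.integral_cong) (auto simp: space_nu)
      then show False
        using f(2)[of "g <# H"] g F(2) coset_average_eq[OF Cc_real_continuous[OF f(1)] g(1)]
        by (auto simp: topspace_Q)
    qed
    then obtain x where "x \<in> carrier G" "0 < f x" by blast
    then have "0 < (\<integral>x. f x \<partial>\<mu>)"
      using f(1) nonneg by (intro radon_integral_pos[OF radon_mu haar_open_pos[OF mu]])
        (auto simp: topspace_eq_carrier)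
    then have "0 < (\<integral>D. F D \<partial>\<xi>)" using xi(2)[OF Fc] I_eq[OF Fc f(1,2)] by simp
    moreover have "ennreal (\<integral>D. F D \<partial>\<xi>) \<le> emeasure \<xi> U"
      unfolding Q.radon_measure_open_eq_SUP[OF xi(1) conjunct1[OF U]] using F(1) by (rule SUP_upper)
    ultimately show "emeasure \<xi> U \<noteq> 0" by auto
  next
    fix a E assume a: "a \<in> carrier G" and E: "E \<in> sets \<xi>"
    have hom: "homeomorphic_maps Q Q (\<lambda>D. inv a <# D) (\<lambda>D. a <# D)"
      using homeomorphic_maps_coset_translation[OF inv_closed[OF a]] a by simp
    have ct: "continuous_map Q Q (\<lambda>D. inv a <# D)" using hom by (simp add: homeomorphic_maps_def)
    then have tm: "(\<lambda>D. inv a <# D) \<in> measurable \<xi> \<xi>"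
      by (rule radon_measure_continuous_measurable[OF xi(1)])
    have "distr \<xi> \<xi> (\<lambda>D. inv a <# D) = \<xi>"
    proof (rule Q.radon_measure_eqI[OF radon_measure_distr(1)[OF xi(1) hom] xi(1)])
      fix F assume F: "F \<in> Cc_real Q"
      have fl: "lift F \<in> Cc_real T" using lift[OF F] by blast
      have F': "(\<lambda>D. F (inv a <# D)) \<in> Cc_real Q"
      proof -
        have "coset_average (\<lambda>x. lift F (inv a \<otimes> x)) \<in> Cc_real Q"
          using fl a by (intro coset_average_Cc Cc_real_translate) auto
        moreover have "coset_average (\<lambda>x. lift F (inv a \<otimes> x)) D = F (inv a <# D)" if "D \<in> topspace Q" for D
          using that lift[OF F] ct a
          by (simp add: coset_average_left_translate[OF fl inv_closed] continuous_map_def Pi_iff)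
        ultimately show ?thesis by (rule Cc_real_cong)
      qed
      have "(\<integral>D. F D \<partial>distr \<xi> \<xi> (\<lambda>D. inv a <# D)) = (\<integral>D. F (inv a <# D) \<partial>\<xi>)"
        using radon_measure_measurable[OF xi(1) Cc_real_continuous[OF F]] by (rule integral_distr[OF tm])
      also have "\<dots> = I (\<lambda>D. F (inv a <# D))" using F' by (rule xi(2))
      also have "\<dots> = (\<integral>x. lift F (inv a \<otimes> x) \<partial>\<mu>)"
      proof (rule I_eq[OF F' Cc_real_translate(1)[OF fl inv_closed[OF a]]])
        show "coset_average (\<lambda>x. lift F (inv a \<otimes> x)) D = F (inv a <# D)" if "D \<in> topspace Q" for D
          using that lift[OF F] ct a
          by (simp add: coset_average_left_translate[OF fl inv_closed] continuous_map_def Pi_iff)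
      qed
      also have "\<dots> = (\<integral>x. lift F x \<partial>\<mu>)"
        using a fl by (intro haar_integral_left_translate[OF mu]
            radon_measure_measurable[OF radon_mu] Cc_real_continuous) auto
      also have "\<dots> = (\<integral>D. F D \<partial>\<xi>)" using xi(2)[OF F] by (simp add: I_def)
      finally show "(\<integral>D. F D \<partial>distr \<xi> \<xi> (\<lambda>D. inv a <# D)) = (\<integral>D. F D \<partial>\<xi>)" .
    qed
    then show "emeasure \<xi> ((\<lambda>D. a <# D) ` E) = emeasure \<xi> E"
      using radon_measure_distr(2)[OF xi(1) hom E] by simp
  qed
  then show ?thesis by blast
qed

text \<open>Both measures give every average the integral of the averaged function against \<open>\<mu>\<close>, up to a factor; and
every compactly supported function on \<open>G/H\<close> is an average.\<close>

lemma coset_haar_unique: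
  assumes xi: "haar_measure_on_cosets G T H \<xi>" and xi': "haar_measure_on_cosets G T H \<xi>'"
  obtains c where "0 < c" "\<xi>' = scale_measure (ennreal c) \<xi>"
proof -
  note R = coset_haar_radon[OF xi] and R' = coset_haar_radon[OF xi']
  obtain a where a: "0 < a" "\<And>f. f \<in> Cc_real T \<Longrightarrow> (\<integral>D. coset_average f D \<partial>\<xi>) = a * (\<integral>x. f x \<partial>\<mu>)"
    using coset_haar_proportional[OF xi] by metis
  obtain b where b: "0 < b" "\<And>f. f \<in> Cc_real T \<Longrightarrow> (\<integral>D. coset_average f D \<partial>\<xi>') = b * (\<integral>x. f x \<partial>\<mu>)"
    using coset_haar_proportional[OF xi'] by metis
  have c: "0 < b / a" using a b by simp
  have "\<xi>' = scale_measure (ennreal (b / a)) \<xi>"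
  proof (rule Q.radon_measure_eqI[OF R' radon_measure_scale[OF R c]])
    fix F assume F: "F \<in> Cc_real Q"
    obtain f where f: "f \<in> Cc_real T" "\<And>D. D \<in> topspace Q \<Longrightarrow> coset_average f D = F D"
      using coset_average_surj[OF F] by metis
    have "(\<integral>D. F D \<partial>\<xi>) = a * (\<integral>x. f x \<partial>\<mu>)"
      unfolding a(2)[OF f(1), symmetric]
      by (rule Bochner_Integration.integral_cong) (auto simp: radon_measure_space[OF R] f(2))
    moreover have "(\<integral>D. F D \<partial>\<xi>') = b * (\<integral>x. f x \<partial>\<mu>)"
      unfolding b(2)[OF f(1), symmetric]
      by (rule Bochner_Integration.integral_cong) (auto simp: radon_measure_space[OF R'] f(2))
    ultimately show "(\<integral>D. F D \<partial>\<xi>') = (\<integral>D. F D \<partial>scale_measure (ennreal (b / a)) \<xi>)"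
      using a(1) c radon_measure_measurable[OF R Cc_real_continuous[OF F]]
      by (simp add: integral_scale_measure)
  qed
  then show ?thesis using c that by blast
qed

text \<open>Dividing \<open>\<xi>\<close> by the factor of \<open>coset_haar_proportional\<close> normalises it; complex integrands are treated
through their real and imaginary parts.\<close>

lemma Weil_formula:
  assumes xi: "haar_measure_on_cosets G T H \<xi>"
  obtains c where "0 < c"
    "\<And>f. f \<in> Cc T \<Longrightarrow> (\<integral>x. f x \<partial>\<mu>) = (\<integral>D. coset_integral G \<nu> f D \<partial>scale_measure (ennreal c) \<xi>)"
proof -
  obtain a where a: "0 < a" "\<And>f. f \<in> Cc_real T \<Longrightarrow> (\<integral>D. coset_average f D \<partial>\<xi>) = a * (\<integral>x. f x \<partial>\<mu>)"
    using coset_haar_proportional[OF xi] by metis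
  define \<xi>' where "\<xi>' = scale_measure (ennreal (1 / a)) \<xi>"
  have R: "radon_measure Q \<xi>" using xi by (rule coset_haar_radon)
  have R': "radon_measure Q \<xi>'" unfolding \<xi>'_def using R a(1) by (intro radon_measure_scale) auto
  have real: "(\<integral>D. coset_average f D \<partial>\<xi>') = (\<integral>x. f x \<partial>\<mu>)" if "f \<in> Cc_real T" for f
    unfolding \<xi>'_def
    using a that radon_measure_measurable[OF R Cc_real_continuous[OF coset_average_Cc[OF that]]]
    by (simp add: integral_scale_measure)
  have "(\<integral>x. f x \<partial>\<mu>) = (\<integral>D. coset_integral G \<nu> f D \<partial>\<xi>')" if f: "f \<in> Cc T" for f
  proof -
    let ?S = "T closure_of {x \<in> topspace T. f x \<noteq> 0}"
    have cf: "continuous_map T euclidean f" and S: "compactin T ?S" using f by (auto simp: Cc_def)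
    have S0: "f x = 0" if "x \<in> topspace T" "x \<notin> ?S" for x
      using that closure_of_subset[of "{x \<in> topspace T. f x \<noteq> 0}" T] by auto
    have "continuous_map T euclidean (\<lambda>x. Re (f x))" "continuous_map T euclidean (\<lambda>x. Im (f x))"
      using continuous_map_compose[OF cf, of euclidean Re] continuous_map_compose[OF cf, of euclidean Im]
      by (simp_all add: o_def continuous_on_Re continuous_on_Im)
    then have re: "(\<lambda>x. Re (f x)) \<in> Cc_real T" and im: "(\<lambda>x. Im (f x)) \<in> Cc_real T"
      using S S0 by (auto intro: Cc_realI)
    have "coset_integral G \<nu> f D = Complex (coset_average (\<lambda>x. Re (f x)) D) (coset_average (\<lambda>x. Im (f x)) D)"
      if D: "D \<in> topspace Q" for D
    proof -
      obtain g where g: "g \<in> carrier G" "D = g <# H" using D by (auto simp: topspace_Q)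
      have "coset_integral G \<nu> f D = (\<integral>h. Complex (Re (f (g \<otimes> h))) (Im (f (g \<otimes> h))) \<partial>\<nu>)"
        using coset_integral_eq[OF cf g(1)] g(2) by simp
      also have "\<dots> = Complex (\<integral>h. Re (f (g \<otimes> h)) \<partial>\<nu>) (\<integral>h. Im (f (g \<otimes> h)) \<partial>\<nu>)"
        using integrable_on_coset[OF re g(1)] integrable_on_coset[OF im g(1)] by (rule integral_Complex)
      finally show ?thesis
        using re im g by (simp add: coset_average_eq Cc_real_continuous)
    qed
    then have "(\<integral>D. coset_integral G \<nu> f D \<partial>\<xi>') =
        (\<integral>D. Complex (coset_average (\<lambda>x. Re (f x)) D) (coset_average (\<lambda>x. Im (f x)) D) \<partial>\<xi>')"
      by (intro Bochner_Integration.integral_cong) (auto simp: radon_measure_space[OF R'])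
    also have "\<dots> = Complex (\<integral>x. Re (f x) \<partial>\<mu>) (\<integral>x. Im (f x) \<partial>\<mu>)"
      using Q.Cc_real_integrable[OF R' coset_average_Cc[OF re]] Q.Cc_real_integrable[OF R' coset_average_Cc[OF im]]
      by (simp add: integral_Complex real re im)
    also have "\<dots> = (\<integral>x. Complex (Re (f x)) (Im (f x)) \<partial>\<mu>)"
      using Cc_real_integrable[OF radon_mu re] Cc_real_integrable[OF radon_mu im]
      by (rule integral_Complex[symmetric])
    finally show ?thesis by simp
  qed
  then show ?thesis using that[of "1 / a"] a(1) by (simp add: \<xi>'_def)
qed

end

theorem theorem4p2:
  fixes G :: "('a, 'c) monoid_scheme" and T :: "'a topology" and H :: "'a set"
    and \<mu> \<nu> :: "'a measure"
  assumes "locally_compact_hausdorff_group G T"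
    and "left_haar_measure G T \<mu>"
    and "subgroup H G" and "closedin T H"
    and "left_haar_measure (G\<lparr>carrier := H\<rparr>) (subtopology T H) \<nu>"
  shows "((\<exists>\<xi>. haar_measure_on_cosets G T H \<xi>) \<longleftrightarrow>
            (\<forall>h\<in>H. modular_function G T h =
                    modular_function (G\<lparr>carrier := H\<rparr>) (subtopology T H) h)) \<and>
         (\<forall>\<xi>. haar_measure_on_cosets G T H \<xi> \<longrightarrow>
            (\<forall>\<xi>'. haar_measure_on_cosets G T H \<xi>' \<longleftrightarrow>
                   (\<exists>c::real. c > 0 \<and> \<xi>' = scale_measure (ennreal c) \<xi>)) \<and>
            (\<exists>c::real. c > 0 \<and>
               (\<forall>f\<in>Cc T. (\<integral>g. f g \<partial>\<mu>) =
                  (\<integral>C. coset_integral G \<nu> f C \<partial>(scale_measure (ennreal c) \<xi>)))))"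
proof -
  interpret haar_pair G T H \<nu> \<mu>
    using assms by (intro haar_pair.intro closed_subgroup_haar.intro closed_subgroup.intro
        closed_subgroup_axioms.intro closed_subgroup_haar_axioms.intro haar_pair_axioms.intro)
  show ?thesis
  proof (intro conjI allI impI)
    show "(\<exists>\<xi>. haar_measure_on_cosets G T H \<xi>) \<longleftrightarrow>
            (\<forall>h\<in>H. modular_function G T h =
                    modular_function (G\<lparr>carrier := H\<rparr>) (subtopology T H) h)"
      using coset_haar_exists coset_haar_imp_modular_eq by blast
    fix \<xi> assume xi: "haar_measure_on_cosets G T H \<xi>"
    show "haar_measure_on_cosets G T H \<xi>' \<longleftrightarrow>
        (\<exists>c::real. c > 0 \<and> \<xi>' = scale_measure (ennreal c) \<xi>)" for \<xi>'
      using coset_haar_unique[OF xi] coset_haar_scale[OF xi] by metis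
    show "\<exists>c::real. c > 0 \<and> (\<forall>f\<in>Cc T. (\<integral>g. f g \<partial>\<mu>) =
        (\<integral>C. coset_integral G \<nu> f C \<partial>(scale_measure (ennreal c) \<xi>)))"
      using Weil_formula[OF xi] by metis
  qed
qed

end
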